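(* Let $T\in\mathcal{K}(V)$ be bisectorial of angle $\omega\in(0,\frac{\pi}{2})$, let $\theta\in(\omega,\frac{\pi}{2})$ and $g\in\mathcal{N}^{\mathrm{bnd}}(D_\theta)$, with associated values $g_0,g_\infty\in\mathbb{R}$, i.e. $g(s)=g_\infty+\frac{1}{1+s^2}(g_0-g_\infty)+\widetilde{g}(s)$ with $\widetilde{g}\in\mathcal{N}^0(D_\theta)$. Extend $g$ to $0$ by $g(0):=g_0$. Then, with $g(T)$ given by the extended $\omega$-functional calculus, $$\sigma_S(g(T))\supseteq g(\sigma_S(T))\qquad\text{and}\qquad\sigma_S(g(T))\subseteq g(\sigma_S(T))\cup\{g_\infty\}.$$
   Context: Clifford setting. Fix an integer $n\geq 1$. $\mathbb{R}_n$ is the real Clifford algebra generated by $e_1,\dots,e_n$ with $e_i^2=-1$, $e_ie_j=-e_je_i$ ($i\neq j$), with basis $e_A=e_{i_1}\cdots e_{i_r}$ for $A=(i_1<\dots<i_r)$, $e_\emptyset=1$, and $|s|^2=\sum_As_A^2$ for $s=\sum_As_Ae_A$. Paravectors: $\mathbb{R}^{n+1}=\{s_0+s_1e_1+\dots+s_ne_n\}\subseteq\mathbb{R}_n$ with $\overline{s}=s_0-s_1e_1-\dots-s_ne_n$. $\mathbb{S}=\{s\in\mathbb{R}^{n+1}: s_0=0,|s|=1\}$ and $\mathbb{C}_J=\{x+Jy: x,y\in\mathbb{R}\}$ for $J\in\mathbb{S}$. $U\subseteq\mathbb{R}^{n+1}$ is axially symmetric if $x+Jy\in U$ ($x,y\in\mathbb{R}$,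 $J\in\mathbb{S}$) implies $x+Iy\in U$ for all $I\in\mathbb{S}$. Slice hyperholomorphic functions. For $U$ open and axially symmetric, $f:U\to\mathbb{R}_n$ is left slice hyperholomorphic ($f\in\mathcal{SH}_L(U)$) if there are continuously differentiable $f_0,f_1:\{(x,y)\in\mathbb{R}^2: x+\mathbb{S}y\subseteq U\}\to\mathbb{R}_n$ with $f(x+Jy)=f_0(x,y)+Jf_1(x,y)$ for all $J\in\mathbb{S}$, $f_0(x,-y)=f_0(x,y)$, $f_1(x,-y)=-f_1(x,y)$, $\partial_xf_0=\partial_yf_1$, $\partial_yf_0=-\partial_xf_1$. If $f_0,f_1$ are real valued, $f$ is called intrinsic ($f\in\mathcal{N}(U)$); intrinsic functions take values in $\mathbb{R}^{n+1}$. Operators. $V_\mathbb{R}$ is a real Banach space, $V=\{\sum_Av_A\otimes e_A: v_A\in V_\mathbb{R}\}$ the corresponding Clifford module with norm $\|v\|^2=\sum_A\|v_A\|^2$ and the natural left and right multiplications by $\mathbb{R}_n$. $\mathcal{B}(V)$: bounded everywhere defined right-linear operators; $\mathcal{K}(V)$: closed right-linear operators $T:\operatorname{dom}(T)\to V$ with right-linear domain $\operatorname{dom}(T)\subseteq V$. A Clifford number $a$ is identified with the operator $v\mapsto av$, so $(aT)v=a(Tv)$, $(Ta)v=T(av)$. For $s\in\mathbb{R}^{n+1}$, $Q_s[T]=T^2-2s_0T+|s|^2$ on $\operatorname{dom}(T^2)$; $\rho_S(T)=\{s\in\mathbb{R}^{n+1}: Q_s[T]^{-1}\in\mathcal{B}(V)\}$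 is the $S$-resolvent set, $\sigma_S(T)=\mathbb{R}^{n+1}\setminus\rho_S(T)$ the $S$-spectrum, and $S_L^{-1}(s,T)=Q_s[T]^{-1}\overline{s}-TQ_s[T]^{-1}$ for $s\in\rho_S(T)$. Bisectorial operators. For $\omega\in(0,\frac{\pi}{2})$, $I_\omega=(-\omega,\omega)\cup(\pi-\omega,\pi+\omega)$ and $D_\omega=\{re^{J\phi}: r>0,\,J\in\mathbb{S},\,\phi\in I_\omega\}\subseteq\mathbb{R}^{n+1}$. $T\in\mathcal{K}(V)$ is bisectorial of angle $\omega$ if $\sigma_S(T)\subseteq\overline{D_\omega}$ and for every $\varphi\in(\omega,\frac{\pi}{2})$ there is $C_\varphi\geq 0$ with $\|S_L^{-1}(s,T)\|\leq\frac{C_\varphi}{|s|}$ for all $s\in\mathbb{R}^{n+1}\setminus(D_\varphi\cup\{0\})$. $\omega$-functional calculus. $\mathcal{SH}_L^0(D_\theta)$ is the set of bounded $f\in\mathcal{SH}_L(D_\theta)$ with $\int_0^\infty|f(te^{J\phi})|\frac{dt}{t}<\infty$ for all $J\in\mathbb{S}$, $\phi\in I_\theta$; $\mathcal{N}^0(D_\theta)$ is the set of intrinsic such functions. For $T$ bisectorial of angle $\omega$, $\theta\in(\omega,\frac{\pi}{2})$ and $f\in\mathcal{SH}_L^0(D_\theta)$, $$f(T)=\frac{1}{2\pi}\int_{\partial D_\varphi\cap\mathbb{C}_J}S_L^{-1}(s,T)ds_Jf(s):=\frac{1}{2\pi}\sum_\pm\int_\mathbb{R}S_L^{-1}(\gamma_\pm(t),T)\frac{\gamma_\pm'(t)}{J}f(\gamma_\pm(t))dt\in\mathcal{B}(V),$$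 with $\gamma_\pm(t)=\pm|t|e^{-\operatorname{sgn}(t)J\varphi}$; it does not depend on the choice of $\varphi\in(\omega,\theta)$ and $J\in\mathbb{S}$. Extended $\omega$-functional calculus. $\mathcal{N}^{\mathrm{bnd}}(D_\theta)$ is the set of functions $g(s)=g_\infty+\frac{1}{1+s^2}(g_0-g_\infty)+\widetilde{g}(s)$ on $D_\theta$ with $g_0,g_\infty\in\mathbb{R}$, $\widetilde{g}\in\mathcal{N}^0(D_\theta)$ (these components are unique). For such $g$, $g(T):=g_\infty+(1+T^2)^{-1}(g_0-g_\infty)+\widetilde{g}(T)\in\mathcal{B}(V)$, with $\widetilde{g}(T)$ from the $\omega$-functional calculus; here $1+T^2$ is boundedly invertible since $\mathbb{S}\subseteq\rho_S(T)$. *)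

theory Defs
  imports "HOL-Analysis.Analysis"
begin

section \<open>Clifford numbers and Clifford modules\<close>

text \<open>
  The generators \<open>e\<^sub>i\<close> are indexed by a type \<open>'n\<close> of class \<open>{finite, linorder}\<close>, so that
  \<open>n = CARD('n) \<ge> 1\<close>.  An element \<open>\<Sum>\<^sub>A v\<^sub>A \<otimes> e\<^sub>A\<close> of the Clifford module over \<open>'v\<close> is the vector of its
  components \<open>v\<^sub>A\<close>, \<open>A :: 'n set\<close>; the library norm on this type is \<open>sqrt (\<Sum>\<^sub>A (norm v\<^sub>A)\<^sup>2)\<close>.
  The Clifford algebra is the case \<open>'v = real\<close>.  The componentwise product \<open>(*)\<close>, which the library
  provides on vectors, is not the Clifford product and is never used.
\<close>

type_synonym ('v, 'n) cmodule = "('v, 'n set) vec"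
type_synonym 'n clif = "(real, 'n) cmodule"

definition clif_basis :: "'n::{finite,linorder} set \<Rightarrow> 'n clif"
  where "clif_basis A = axis A 1"

abbreviation clif_one :: "'n::{finite,linorder} clif"
  where "clif_one \<equiv> clif_basis {}"

text \<open>
  \<open>e\<^sub>A e\<^sub>B = clif_sign A B \<cdot> e\<^sub>C\<close> with \<open>C\<close> the symmetric difference of \<open>A\<close> and \<open>B\<close>: sorting the word
  \<open>e\<^sub>A e\<^sub>B\<close> costs one sign for each pair with \<open>b < a\<close>, and cancelling equal letters one sign for each
  pair with \<open>b = a\<close>.
\<close>

definition clif_sign :: "'n::{finite,linorder} set \<Rightarrow> 'n set \<Rightarrow> real"
  where "clif_sign A B = (- 1) ^ card {(a, b). a \<in> A \<and> b \<in> B \<and> b \<le> a}"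

text \<open>For \<open>'v = real\<close> both of the following are the product of the Clifford algebra.\<close>

definition clif_lmult :: "'n::{finite,linorder} clif \<Rightarrow> ('v::real_vector, 'n) cmodule \<Rightarrow> ('v, 'n) cmodule"
    (infixr "*\<^sub>l" 75)
  where "a *\<^sub>l v =
    (\<chi> C. \<Sum>(A, B) | sym_diff A B = C. (clif_sign A B * a $ A) *\<^sub>R v $ B)"

definition clif_rmult :: "('v::real_vector, 'n) cmodule \<Rightarrow> 'n::{finite,linorder} clif \<Rightarrow> ('v, 'n) cmodule"
    (infixl "*\<^sub>r" 75)
  where "v *\<^sub>r a =
    (\<chi> C. \<Sum>(B, A) | sym_diff B A = C. (clif_sign B A * a $ A) *\<^sub>R v $ B)"

text \<open>The defining relations of the algebra, and \<open>e\<^sub>A\<close> as an increasing product of generators:\<close>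

lemma clif_sign_eq_prod:
  "clif_sign A B = (\<Prod>a\<in>A. \<Prod>b\<in>B. if b \<le> a then - 1 else (1::real))"
proof -
  have "{(a, b). a \<in> A \<and> b \<in> B \<and> b \<le> a} = {p \<in> A \<times> B. snd p \<le> fst p}" by auto
  then have "clif_sign A B = (\<Prod>p\<in>A \<times> B. if snd p \<le> fst p then - 1 else (1::real))"
    unfolding clif_sign_def by (simp add: prod.If_cases Int_def)
  then show ?thesis by (simp add: prod.cartesian_product case_prod_unfold)
qed

lemma clif_lmult_nth:
  "(a *\<^sub>l v) $ C = (\<Sum>A\<in>UNIV. (clif_sign A (sym_diff A C) * a $ A) *\<^sub>R v $ (sym_diff A C))"
proof -
  have sd: "sym_diff A (sym_diff A B) = B" for A B :: "'b set" by auto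
  show ?thesis
      unfolding clif_lmult_def vec_lambda_beta
    by (rule sum.reindex_bij_witness[where i="\<lambda>A. (A, sym_diff A C)" and j=fst]) (auto simp only: sd fst_conv snd_conv case_prod_conv mem_Collect_eq UNIV_I prod.collapse split_paired_all)
qed

lemma clif_basis_mult: "clif_basis A *\<^sub>l clif_basis B = clif_sign A B *\<^sub>R clif_basis (sym_diff A B)"
proof (rule vec_eq_iff[THEN iffD2], rule allI)
  fix C
  have "(clif_basis A *\<^sub>l clif_basis B) $ C =
     (\<Sum>D\<in>UNIV. if D = A then clif_sign A (sym_diff A C) * (if sym_diff A C = B then 1 else 0) else 0)"
    unfolding clif_lmult_nth by (rule sum.cong) (auto simp: clif_basis_def axis_def)
  also have "\<dots> = (clif_sign A B *\<^sub>R clif_basis (sym_diff A B)) $ C"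
    by (auto simp: clif_basis_def axis_def)
  finally show "(clif_basis A *\<^sub>l clif_basis B) $ C = (clif_sign A B *\<^sub>R clif_basis (sym_diff A B)) $ C" .
qed

lemma clif_generator_square: "clif_basis {i} *\<^sub>l clif_basis {i} = - clif_one"
  by (simp add: clif_basis_mult clif_sign_eq_prod)

lemma clif_generators_anticommute: "i \<noteq> j \<Longrightarrow> clif_basis {i} *\<^sub>l clif_basis {j} = - (clif_basis {j} *\<^sub>l clif_basis {i})"
  by (auto simp: clif_basis_mult clif_sign_eq_prod Un_commute)

lemma clif_basis_insert_least: "(\<And>a. a \<in> A \<Longrightarrow> i < a) \<Longrightarrow> clif_basis {i} *\<^sub>l clif_basis A = clif_basis (insert i A)"
proof -
  assume *: "\<And>a. a \<in> A \<Longrightarrow> i < a"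
  have "clif_sign {i} A = 1" unfolding clif_sign_eq_prod by (auto intro!: prod.neutral) (meson * leD)
  moreover have "sym_diff {i} A = insert i A" using * by auto
  ultimately show ?thesis by (simp only: clif_basis_mult scaleR_one)
qed

definition clif_inv :: "'n::{finite,linorder} clif \<Rightarrow> 'n clif"
  where "clif_inv a = (THE b. a *\<^sub>l b = clif_one \<and> b *\<^sub>l a = clif_one)"

definition paravectors :: "'n::{finite,linorder} clif set"
  where "paravectors = {s. \<forall>A. card A > 1 \<longrightarrow> s $ A = 0}"

definition sc :: "'n::{finite,linorder} clif \<Rightarrow> real"
  where "sc s = s $ {}"

text \<open>This is the Clifford conjugate on paravectors only.\<close>

definition pv_cnj :: "'n::{finite,linorder} clif \<Rightarrow> 'n clif"
  where "pv_cnj s = (\<chi> A. if A = {} then s $ A else - s $ A)"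

definition unit_imag :: "'n::{finite,linorder} clif set"
  where "unit_imag = {s \<in> paravectors. sc s = 0 \<and> norm s = 1}"

definition slice_pt :: "'n::{finite,linorder} clif \<Rightarrow> real \<Rightarrow> real \<Rightarrow> 'n clif"
  where "slice_pt J x y = x *\<^sub>R clif_one + y *\<^sub>R J"

definition slice_exp :: "'n::{finite,linorder} clif \<Rightarrow> real \<Rightarrow> 'n clif"
  where "slice_exp J \<phi> = slice_pt J (cos \<phi>) (sin \<phi>)"


section \<open>Slice hyperholomorphic functions\<close>

definition axially_symmetric :: "'n::{finite,linorder} clif set \<Rightarrow> bool"
  where "axially_symmetric U \<longleftrightarrow>
    U \<subseteq> paravectors \<and>
    (\<forall>x y. \<forall>J\<in>unit_imag. slice_pt J x y \<in> U \<longrightarrow> (\<forall>I\<in>unit_imag. slice_pt I x y \<in> U))"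

definition slice_dom :: "'n::{finite,linorder} clif set \<Rightarrow> (real \<times> real) set"
  where "slice_dom U = {(x, y). \<forall>J\<in>unit_imag. slice_pt J x y \<in> U}"

definition cont_differentiable_on ::
    "(real \<times> real \<Rightarrow> 'b::real_normed_vector) \<Rightarrow> (real \<times> real) set \<Rightarrow> bool"
  where "cont_differentiable_on h W \<longleftrightarrow>
    (\<exists>h'. (\<forall>p\<in>W. (h has_derivative blinfun_apply (h' p)) (at p)) \<and> continuous_on W h')"

definition pd_x :: "(real \<times> real \<Rightarrow> 'b::real_normed_vector) \<Rightarrow> real \<times> real \<Rightarrow> 'b"
  where "pd_x h p = frechet_derivative h (at p) (1, 0)"

definition pd_y :: "(real \<times> real \<Rightarrow> 'b::real_normed_vector) \<Rightarrow> real \<times> real \<Rightarrow> 'b"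
  where "pd_y h p = frechet_derivative h (at p) (0, 1)"

text \<open>Functions on \<open>U\<close> are total functions whose values outside \<open>U\<close> are irrelevant.\<close>

definition slice_components :: "'n::{finite,linorder} clif set \<Rightarrow> ('n clif \<Rightarrow> 'n clif) \<Rightarrow>
    (real \<times> real \<Rightarrow> 'n clif) \<Rightarrow> (real \<times> real \<Rightarrow> 'n clif) \<Rightarrow> bool"
  where "slice_components U f f0 f1 \<longleftrightarrow>
    openin (top_of_set paravectors) U \<and> axially_symmetric U \<and>
    cont_differentiable_on f0 (slice_dom U) \<and> cont_differentiable_on f1 (slice_dom U) \<and>
    (\<forall>(x, y)\<in>slice_dom U.
      (\<forall>J\<in>unit_imag. f (slice_pt J x y) = f0 (x, y) + J *\<^sub>l f1 (x, y)) \<and>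
      f0 (x, - y) = f0 (x, y) \<and> f1 (x, - y) = - f1 (x, y) \<and>
      pd_x f0 (x, y) = pd_y f1 (x, y) \<and> pd_y f0 (x, y) = - pd_x f1 (x, y))"

definition SH_L :: "'n::{finite,linorder} clif set \<Rightarrow> ('n clif \<Rightarrow> 'n clif) set"
  where "SH_L U = {f. \<exists>f0 f1. slice_components U f f0 f1}"

definition intrinsic :: "'n::{finite,linorder} clif set \<Rightarrow> ('n clif \<Rightarrow> 'n clif) set"
  where "intrinsic U = {f. \<exists>f0 f1. slice_components U f f0 f1 \<and>
    (\<forall>p\<in>slice_dom U. f0 p \<in> range (\<lambda>r. r *\<^sub>R clif_one) \<and> f1 p \<in> range (\<lambda>r. r *\<^sub>R clif_one))}"

definition bisector_angles :: "real \<Rightarrow> real set"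
  where "bisector_angles \<omega> = {- \<omega><..<\<omega>} \<union> {pi - \<omega><..<pi + \<omega>}"

definition double_sector :: "real \<Rightarrow> 'n::{finite,linorder} clif set"
  where "double_sector \<omega> =
    {r *\<^sub>R slice_exp J \<phi> | r J \<phi>. r > 0 \<and> J \<in> unit_imag \<and> \<phi> \<in> bisector_angles \<omega>}"

definition SH_L0 :: "real \<Rightarrow> ('n::{finite,linorder} clif \<Rightarrow> 'n clif) set"
  where "SH_L0 \<theta> = {f \<in> SH_L (double_sector \<theta>). bounded (f ` double_sector \<theta>) \<and>
    (\<forall>J\<in>unit_imag. \<forall>\<phi>\<in>bisector_angles \<theta>.
      set_integrable lborel {0<..} (\<lambda>t. norm (f (t *\<^sub>R slice_exp J \<phi>)) / t))}"

definition N0 :: "real \<Rightarrow> ('n::{finite,linorder} clif \<Rightarrow> 'n clif) set"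
  where "N0 \<theta> = SH_L0 \<theta> \<inter> intrinsic (double_sector \<theta>)"


section \<open>Operators and the S-spectrum\<close>

text \<open>
  An unbounded operator is given by its domain \<open>D\<close> and a total function \<open>T\<close> whose values outside \<open>D\<close>
  are irrelevant; everywhere defined operators have \<open>D = UNIV\<close>.
\<close>

definition bounded_rlinear :: "(('v::real_normed_vector, 'n::{finite,linorder}) cmodule \<Rightarrow> ('v, 'n) cmodule) \<Rightarrow> bool"
  where "bounded_rlinear B \<longleftrightarrow> bounded_linear B \<and> (\<forall>v a. B (v *\<^sub>r a) = B v *\<^sub>r a)"

definition closed_rlinear :: "('v::real_normed_vector, 'n::{finite,linorder}) cmodule set \<Rightarrow>
    (('v, 'n) cmodule \<Rightarrow> ('v, 'n) cmodule) \<Rightarrow> bool"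
  where "closed_rlinear D T \<longleftrightarrow>
    0 \<in> D \<and>
    (\<forall>v\<in>D. \<forall>w\<in>D. v + w \<in> D \<and> T (v + w) = T v + T w) \<and>
    (\<forall>v\<in>D. \<forall>a. v *\<^sub>r a \<in> D \<and> T (v *\<^sub>r a) = T v *\<^sub>r a) \<and>
    closed ((\<lambda>v. (v, T v)) ` D)"

definition dom_sq :: "'a set \<Rightarrow> ('a \<Rightarrow> 'a) \<Rightarrow> 'a set"
  where "dom_sq D T = {v \<in> D. T v \<in> D}"

definition Q_op :: "(('v::real_normed_vector, 'n::{finite,linorder}) cmodule \<Rightarrow> ('v, 'n) cmodule) \<Rightarrow>
    'n clif \<Rightarrow> ('v, 'n) cmodule \<Rightarrow> ('v, 'n) cmodule"
  where "Q_op T s v = T (T v) - (2 * sc s) *\<^sub>R T v + (norm s)\<^sup>2 *\<^sub>R v"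

definition Q_inv :: "('v::real_normed_vector, 'n::{finite,linorder}) cmodule set \<Rightarrow>
    (('v, 'n) cmodule \<Rightarrow> ('v, 'n) cmodule) \<Rightarrow> 'n clif \<Rightarrow> ('v, 'n) cmodule \<Rightarrow> ('v, 'n) cmodule"
  where "Q_inv D T s = inv_into (dom_sq D T) (Q_op T s)"

definition S_resolvent_set :: "('v::real_normed_vector, 'n::{finite,linorder}) cmodule set \<Rightarrow>
    (('v, 'n) cmodule \<Rightarrow> ('v, 'n) cmodule) \<Rightarrow> 'n clif set"
  where "S_resolvent_set D T =
    {s \<in> paravectors. bij_betw (Q_op T s) (dom_sq D T) UNIV \<and> bounded_rlinear (Q_inv D T s)}"

definition S_spectrum :: "('v::real_normed_vector, 'n::{finite,linorder}) cmodule set \<Rightarrow>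
    (('v, 'n) cmodule \<Rightarrow> ('v, 'n) cmodule) \<Rightarrow> 'n clif set"
  where "S_spectrum D T = paravectors - S_resolvent_set D T"

definition S_left_resolvent :: "('v::real_normed_vector, 'n::{finite,linorder}) cmodule set \<Rightarrow>
    (('v, 'n) cmodule \<Rightarrow> ('v, 'n) cmodule) \<Rightarrow> 'n clif \<Rightarrow> ('v, 'n) cmodule \<Rightarrow> ('v, 'n) cmodule"
  where "S_left_resolvent D T s v = Q_inv D T s (pv_cnj s *\<^sub>l v) - T (Q_inv D T s v)"

text \<open>
  \<^const>\<open>onorm\<close> is an operator norm only on bounded operators, hence the explicit boundedness.
\<close>

definition bisectorial :: "real \<Rightarrow> ('v::real_normed_vector, 'n::{finite,linorder}) cmodule set \<Rightarrow>
    (('v, 'n) cmodule \<Rightarrow> ('v, 'n) cmodule) \<Rightarrow> bool"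
  where "bisectorial \<omega> D T \<longleftrightarrow>
    S_spectrum D T \<subseteq> closure (double_sector \<omega>) \<and>
    (\<forall>\<phi>\<in>{\<omega><..<pi / 2}. \<exists>C\<ge>0. \<forall>s\<in>paravectors - (double_sector \<phi> \<union> {0}).
      bounded_linear (S_left_resolvent D T s) \<and> onorm (S_left_resolvent D T s) \<le> C / norm s)"


section \<open>The functional calculi\<close>

text \<open>\<open>\<epsilon> = 1\<close> and \<open>\<epsilon> = -1\<close> give \<open>\<gamma>\<^sub>+\<close> and \<open>\<gamma>\<^sub>-\<close>.\<close>

definition bisector_path :: "'n::{finite,linorder} clif \<Rightarrow> real \<Rightarrow> real \<Rightarrow> real \<Rightarrow> 'n clif"
  where "bisector_path J \<phi> \<epsilon> t = (\<epsilon> * \<bar>t\<bar>) *\<^sub>R slice_exp J (- sgn t * \<phi>)"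

text \<open>
  The integral is that of a function with values in the Banach space of bounded operators.
  The integrand has no meaning at \<open>t = 0\<close>.  The Henstock-Kurzweil integral is used because the
  library's Bochner integral requires a second countable space; on the integrands at hand, which
  are continuous off \<open>0\<close> and absolutely integrable, the two agree.
\<close>

definition omega_calc :: "real \<Rightarrow> 'n::{finite,linorder} clif \<Rightarrow> ('v::banach, 'n) cmodule set \<Rightarrow>
    (('v, 'n) cmodule \<Rightarrow> ('v, 'n) cmodule) \<Rightarrow> ('n clif \<Rightarrow> 'n clif) \<Rightarrow>
    (('v, 'n) cmodule \<Rightarrow>\<^sub>L ('v, 'n) cmodule)"
  where "omega_calc \<phi> J D T f = (1 / (2 * pi)) *\<^sub>R (\<Sum>\<epsilon>\<in>{1, - 1}. integral UNIV (\<lambda>t.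
    let \<gamma> = bisector_path J \<phi> \<epsilon>; \<gamma>' = vector_derivative \<gamma> (at t) in
    Blinfun (\<lambda>v. S_left_resolvent D T (\<gamma> t) ((\<gamma>' *\<^sub>l clif_inv J *\<^sub>l f (\<gamma> t)) *\<^sub>l v))))"

text \<open>
  The value of the calculus does not depend on the path parameters \<open>\<phi>\<close>, \<open>J\<close>, and the components
  \<open>g0\<close>, \<open>ginf\<close>, \<open>gt\<close> of a function \<open>g\<close> are unique on the double sector.  They are arguments below, so
  that no choice is needed; a statement about \<open>g(T)\<close> quantifies over all admissible ones.
\<close>

definition N_bnd_decomp :: "real \<Rightarrow> ('n::{finite,linorder} clif \<Rightarrow> 'n clif) \<Rightarrow>
    real \<Rightarrow> real \<Rightarrow> ('n clif \<Rightarrow> 'n clif) \<Rightarrow> bool"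
  where "N_bnd_decomp \<theta> g g0 ginf gt \<longleftrightarrow> gt \<in> N0 \<theta> \<and>
    (\<forall>s\<in>double_sector \<theta>.
      g s = ginf *\<^sub>R clif_one + (g0 - ginf) *\<^sub>R clif_inv (clif_one + s *\<^sub>l s) + gt s)"

definition extended_calc :: "real \<Rightarrow> 'n::{finite,linorder} clif \<Rightarrow> ('v::banach, 'n) cmodule set \<Rightarrow>
    (('v, 'n) cmodule \<Rightarrow> ('v, 'n) cmodule) \<Rightarrow> real \<Rightarrow> real \<Rightarrow> ('n clif \<Rightarrow> 'n clif) \<Rightarrow>
    (('v, 'n) cmodule \<Rightarrow>\<^sub>L ('v, 'n) cmodule)"
  where "extended_calc \<phi> J D T g0 ginf gt =
    ginf *\<^sub>R id_blinfun
    + (g0 - ginf) *\<^sub>R Blinfun (inv_into (dom_sq D T) (\<lambda>v. v + T (T v)))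
    + omega_calc \<phi> J D T gt"

end

theory Submission
  imports Defs "HOL-Complex_Analysis.Complex_Analysis"
begin

text \<open>
  Right multiplication by a fixed imaginary unit \<open>J\<close> is a complex structure on the module that
  commutes with \<open>T\<close>, so the bicommutant of \<open>(1 + T\<^sup>2)\<^sup>-\<^sup>1\<close>, \<open>T (1 + T\<^sup>2)\<^sup>-\<^sup>1\<close> and this structure is a
  commutative complex Banach algebra.  It contains all \<open>Q\<^sub>s[T]\<^sup>-\<^sup>1\<close> and \<open>g(T)\<close> and is closed under
  inverses.  By Gelfand theory an element is singular iff it lies in a closed proper ideal modulo
  which \<open>(1 + T\<^sup>2)\<^sup>-\<^sup>1\<close> and \<open>T (1 + T\<^sup>2)\<^sup>-\<^sup>1\<close> are complex scalars \<open>\<alpha>\<close> and \<open>\<beta>\<close>.  If \<open>\<alpha> = 0\<close>, the ideal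
  sits at the point \<open>\<infinity>\<close> of the spectrum, all resolvents are \<open>0\<close> modulo it and \<open>g(T)\<close> is \<open>g\<^sub>\<infinity>\<close>.
  Otherwise \<open>T\<close> is \<open>\<mu> = \<beta> / \<alpha>\<close> modulo the ideal, \<open>\<mu>\<close> represents a sphere in the S-spectrum of \<open>T\<close>, and
  Cauchy's formula on the double sector shows that \<open>g(T)\<close> is \<open>g(\<mu>)\<close>.  Both inclusions follow by
  applying this to the element \<open>Q\<^sub>s[T] (1 + T\<^sup>2)\<^sup>-\<^sup>1\<close>, which is singular iff \<open>s\<close> is in the S-spectrum of
  \<open>T\<close>, and to \<open>Q\<^sub>p[g(T)]\<close>.  Multiplicativity of the functional calculus is not needed.
\<close>

text \<open>The S-resolvent and the integrand contain left factors from the slice of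
  \<open>J\<close>, and left multiplication by \<open>J\<close> in general does not commute with
  \<open>T\<close>. The integral therefore has to be folded at \<open>t = 0\<close> before its
  integrand lies in the commutative algebra. The relation
  \<open>\<beta>^2 = \<alpha> - \<alpha>^2\<close> puts the two scalars of an ideal on a rational
  curve with parameter \<open>\<mu>\<close>, namely \<open>\<alpha> = 1 / (1 + \<mu>^2)\<close> and
  \<open>\<beta> = \<mu> / (1 + \<mu>^2)\<close>, completed by the pair (0, 0) at infinity. Since
  Q_s has real coefficients, it cannot distinguish \<open>\<mu>\<close> from its conjugate;
  intrinsic functions commute with conjugation, so the ambiguity is harmless for g. Closure under
  inverses ensures that an operator lying in a proper ideal is singular on the whole space and not
  merely inside the algebra. The delicate point is \<open>\<mu> = 0\<close>, the vertex of the
  contour: only boundedness and integrability are known of the component in \<open>N0\<close> near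
  it, yet its integral contributes 0, and this is what makes \<open>g0\<close> the right value at
  0.\<close>

section \<open>Ideals in commutative Banach algebras\<close>

text \<open>
  \<open>1 = 0\<close> is allowed here, unlike in \<^class>\<open>real_normed_algebra_1\<close>: the operators on a trivial space form
  such an algebra.
\<close>

class unital_banach_algebra = real_normed_algebra + monoid_mult + banach

text \<open>The right inverse is the fixed point of the contraction
  \<open>\<lambda>y. 1 + (1 - z) * y\<close>, the left inverse that of its mirror image, and
  associativity identifies them. The argument uses no bound on \<open>norm 1\<close>, which may be 0
  or exceed 1.\<close>

lemma invertible_near_one:
  fixes z :: "'a::unital_banach_algebra"
  assumes "norm (1 - z) < 1"
  obtains y where "z * y = 1" "y * z = 1"
proof -
  have "\<exists>!y. 1 + (1 - z) * y = y"
  proof (rule banach_fix_type[of "norm (1 - z)"])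
    show "\<forall>x y. dist (1 + (1 - z) * x) (1 + (1 - z) * y) \<le> norm (1 - z) * dist x y"
      by (metis add_diff_cancel_left dist_norm norm_mult_ineq right_diff_distrib)
  qed (use assms in auto)
  then obtain y where y: "1 + (1 - z) * y = y" by blast
  have "\<exists>!y. 1 + y * (1 - z) = y"
  proof (rule banach_fix_type[of "norm (1 - z)"])
    show "\<forall>x y. dist (1 + x * (1 - z)) (1 + y * (1 - z)) \<le> norm (1 - z) * dist x y"
      by (metis add_diff_cancel_left dist_norm norm_mult_ineq left_diff_distrib mult.commute)
  qed (use assms in auto)
  then obtain y' where y': "1 + y' * (1 - z) = y'" by blast
  have 1: "z * y = 1" using y by (simp add: algebra_simps)
  have 2: "y' * z = 1" using y' by (simp add: algebra_simps)
  have "y' = y" by (metis 1 2 mult.assoc mult_1_left mult_1_right)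
  then show ?thesis using that 1 2 by simp
qed

lemma one_minus_power_eq:
  fixes y :: "'a::{ring, monoid_mult}"
  shows "(\<Sum>k<n. y ^ k) * (1 - y) = 1 - y ^ n"
proof (induction n)
  case (Suc n)
  have "(\<Sum>k<Suc n. y ^ k) * (1 - y) = (\<Sum>k<n. y ^ k) * (1 - y) + y ^ n * (1 - y)"
    by (simp add: distrib_right)
  then show ?case unfolding Suc by (simp add: right_diff_distrib power_commutes)
qed simp

text \<open>Averaging over the roots of unity keeps only the constant term of a polynomial of degree
  below \<open>n\<close>. This filter is applied to the geometric sums in the spectrum
  argument.\<close>

lemma sum_roots_of_unity:
  assumes "k < n"
  shows "(\<Sum>i<n. cis (2 * pi * real i / real n) ^ k) = (if k = 0 then of_nat n else 0)"
proof (cases "k = 0")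
  case False
  define z where "z = cis (2 * pi * real k / real n)"
  have n: "real n > 0" using assms by simp
  have "cis (2 * pi * real i / real n) ^ k = z ^ i" for i
    unfolding z_def Complex.DeMoivre by (rule arg_cong[where f=cis]) simp
  moreover have "z ^ n = 1" unfolding z_def Complex.DeMoivre using n cis_multiple_2pi[of "real k"]
    by (simp add: mult_ac)
  moreover have "z \<noteq> 1"
  proof
    assume "z = 1"
    then have "cos (2 * pi * real k / real n) = 1" unfolding z_def by (metis cis.simps(1) one_complex.simps(1))
    then obtain x :: int where "2 * pi * real k / real n = x * 2 * pi" using cos_one_2pi_int by auto
    then have "real k = x * real n" using n by (simp add: field_simps)
    then have "int k = x * int n" by (metis of_int_eq_iff of_int_mult of_int_of_nat_eq)
    then show False using assms False
      by (metis dvd_triv_right int_dvd_int_iff linorder_not_less nat_dvd_not_less neq0_conv)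
  qed
  ultimately show ?thesis using False by (simp add: geometric_sum)
qed simp

lemma subspace_closure:
  fixes N :: "'a::real_normed_vector set"
  assumes "subspace N"
  shows "subspace (closure N)"
  unfolding subspace_def
proof (intro conjI ballI allI)
  show "0 \<in> closure N" using assms closure_subset subspace_0 by blast
next
  fix x y assume "x \<in> closure N" "y \<in> closure N"
  then obtain f g where "\<And>n. f n \<in> N" "f \<longlonglongrightarrow> x" "\<And>n. g n \<in> N" "g \<longlonglongrightarrow> y"
    unfolding closure_sequential by blast
  then show "x + y \<in> closure N"
    unfolding closure_sequential
    by (intro exI[of _ "\<lambda>n. f n + g n"]) (auto intro!: tendsto_add subspace_add[OF assms])
next
  fix c x assume "x \<in> closure N"
  then obtain f where "\<And>n. f n \<in> N" "f \<longlonglongrightarrow> x" unfolding closure_sequential by blast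
  then show "c *\<^sub>R x \<in> closure N"
    unfolding closure_sequential
    by (intro exI[of _ "\<lambda>n. c *\<^sub>R f n"]) (auto intro!: tendsto_intros subspace_scale[OF assms])
qed

text \<open>The surrounding algebra is real, and \<open>j\<close> serves as imaginary unit. By
  \<open>inverse_mem\<close>, invertibility in \<open>S\<close> is the same as invertibility in the
  surrounding type, so that ideals of \<open>S\<close> detect singular elements there.\<close>

locale complex_subalgebra =
  fixes S :: "'a::unital_banach_algebra set" and j :: 'a
  assumes subspace: "subspace S" and closed: "closed S"
    and one_mem [simp]: "1 \<in> S" and j_mem [simp]: "j \<in> S"
    and mult_mem [simp]: "\<And>x y. x \<in> S \<Longrightarrow> y \<in> S \<Longrightarrow> x * y \<in> S"
    and commute: "\<And>x y. x \<in> S \<Longrightarrow> y \<in> S \<Longrightarrow> x * y = y * x"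
    and j_square: "j * j = - 1"
    and inverse_mem: "\<And>x y. x \<in> S \<Longrightarrow> x * y = 1 \<Longrightarrow> y * x = 1 \<Longrightarrow> y \<in> S"
begin

lemma add_mem [simp]: "x \<in> S \<Longrightarrow> y \<in> S \<Longrightarrow> x + y \<in> S"
  and diff_mem [simp]: "x \<in> S \<Longrightarrow> y \<in> S \<Longrightarrow> x - y \<in> S"
  and scaleR_mem [simp]: "x \<in> S \<Longrightarrow> c *\<^sub>R x \<in> S"
  and zero_mem [simp]: "0 \<in> S"
  and uminus_mem [simp]: "x \<in> S \<Longrightarrow> - x \<in> S"
  using subspace by (auto simp: subspace_add subspace_diff subspace_scale subspace_0 subspace_neg)

lemma sum_mem [simp]: "(\<And>i. i \<in> I \<Longrightarrow> f i \<in> S) \<Longrightarrow> sum f I \<in> S"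
  using subspace by (rule subspace_sum)

lemma power_mem [simp]: "x \<in> S \<Longrightarrow> x ^ n \<in> S"
  by (induction n) auto

lemma left_commute: "x \<in> S \<Longrightarrow> y \<in> S \<Longrightarrow> x * (y * z) = y * (x * z)"
  by (metis commute mult.assoc)

lemmas ac = mult.assoc commute left_commute

lemma power_mult: "x \<in> S \<Longrightarrow> y \<in> S \<Longrightarrow> (x * y) ^ n = x ^ n * y ^ n"
  by (induction n) (simp_all add: ac)

text \<open>The complex scalars of the algebra. As \<open>norm j\<close> is arbitrary, this
  embedding is bounded but not isometric, hence the constant in \<open>norm_emb\<close>.\<close>

definition emb :: "complex \<Rightarrow> 'a"
  where "emb z = Re z *\<^sub>R 1 + Im z *\<^sub>R j"

lemma emb_mem [simp]: "emb z \<in> S" by (simp add: emb_def)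
lemma emb_0 [simp]: "emb 0 = 0" by (simp add: emb_def)
lemma emb_1 [simp]: "emb 1 = 1" by (simp add: emb_def)
lemma emb_add: "emb (z + w) = emb z + emb w" by (simp add: emb_def algebra_simps)
lemma emb_diff: "emb (z - w) = emb z - emb w" by (simp add: emb_def algebra_simps)
lemma emb_minus: "emb (- z) = - emb z" by (simp add: emb_def)
lemma emb_of_real: "emb (of_real r) = r *\<^sub>R 1" by (simp add: emb_def)
lemma emb_scaleR: "emb (r *\<^sub>R z) = r *\<^sub>R emb z" by (simp add: emb_def algebra_simps)
lemma emb_mult: "emb (z * w) = emb z * emb w"
  by (simp add: emb_def algebra_simps j_square)
lemma emb_power: "emb (z ^ n) = emb z ^ n"
  by (induction n) (simp_all add: emb_mult)
lemma emb_sum: "emb (sum f I) = (\<Sum>i\<in>I. emb (f i))"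
  by (induction I rule: infinite_finite_induct) (simp_all add: emb_add)
lemma norm_emb: "norm (emb z) \<le> (norm (1::'a) + norm j) * norm z"
proof -
  have "norm (emb z) \<le> \<bar>Re z\<bar> * norm (1::'a) + \<bar>Im z\<bar> * norm j"
    unfolding emb_def by (metis norm_scaleR norm_triangle_ineq)
  also have "\<dots> \<le> norm z * norm (1::'a) + norm z * norm j"
    by (intro add_mono mult_right_mono abs_Re_le_cmod abs_Im_le_cmod) auto
  finally show ?thesis by (simp add: algebra_simps)
qed
lemma bounded_linear_emb: "bounded_linear emb"
  by (rule bounded_linear_intro[where K="norm (1::'a) + norm j"])
     (use norm_emb in \<open>auto simp: emb_add emb_scaleR mult.commute\<close>)

section \<open>Closed proper ideals and the quotient norm\<close>

definition proper_ideal :: "'a set \<Rightarrow> bool"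
  where "proper_ideal M \<longleftrightarrow> subspace M \<and> closed M \<and> M \<subseteq> S \<and> 1 \<notin> M \<and> (\<forall>a\<in>S. \<forall>m\<in>M. a * m \<in> M)"

text \<open>The new ideal is the closure of M + xS. If it contained 1, some \<open>m + x * y\<close>
  would be within distance 1 of 1 and so invertible, and its inverse would turn \<open>y\<close>
  into an inverse of \<open>x\<close> modulo \<open>M\<close>.\<close>

lemma proper_ideal_extend:
  assumes M: "proper_ideal M" and x: "x \<in> S" and ninv: "\<And>y. y \<in> S \<Longrightarrow> 1 - x * y \<notin> M"
  obtains M' where "proper_ideal M'" "M \<subseteq> M'" "x \<in> M'"
proof -
  define N where "N = {m + x * y | m y. m \<in> M \<and> y \<in> S}"
  have Ms: "subspace M" and MS: "M \<subseteq> S" and Mi: "\<And>a m. a \<in> S \<Longrightarrow> m \<in> M \<Longrightarrow> a * m \<in> M"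
    using M by (auto simp: proper_ideal_def)
  have NS: "N \<subseteq> S" using MS x by (auto simp: N_def)
  have sub: "subspace N" unfolding subspace_def
  proof (intro conjI ballI allI)
    show "0 \<in> N" unfolding N_def using Ms by (auto intro!: exI[of _ 0] simp: subspace_0)
  next
    fix u w assume "u \<in> N" "w \<in> N"
    then obtain m y m' y' where "u = m + x * y" "w = m' + x * y'" "m \<in> M" "y \<in> S" "m' \<in> M" "y' \<in> S"
      by (auto simp: N_def)
    then have "u + w = (m + m') + x * (y + y')" "m + m' \<in> M" "y + y' \<in> S"
      using Ms by (auto simp: algebra_simps subspace_add)
    then show "u + w \<in> N" unfolding N_def by blast
  next
    fix c u assume "u \<in> N"
    then obtain m y where "u = m + x * y" "m \<in> M" "y \<in> S" by (auto simp: N_def)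
    then have "c *\<^sub>R u = c *\<^sub>R m + x * (c *\<^sub>R y)" "c *\<^sub>R m \<in> M" "c *\<^sub>R y \<in> S"
      using Ms by (auto simp: algebra_simps subspace_scale)
    then show "c *\<^sub>R u \<in> N" unfolding N_def by blast
  qed
  have Ni: "a * u \<in> N" if a: "a \<in> S" and u: "u \<in> N" for a u
  proof -
    obtain m y where "u = m + x * y" "m \<in> M" "y \<in> S" using u by (auto simp: N_def)
    then have "a * u = a * m + x * (a * y)" "a * m \<in> M" "a * y \<in> S"
      using a x Mi by (auto simp: algebra_simps left_commute)
    then show ?thesis unfolding N_def by blast
  qed
  have "1 \<notin> closure N"
  proof
    assume "1 \<in> closure N"
    then obtain z where z: "z \<in> N" "dist z 1 < 1" using closure_approachable zero_less_one by blast
    then have "norm (1 - z) < 1" by (simp add: dist_norm norm_minus_commute)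
    then obtain w where w: "z * w = 1" "w * z = 1" by (rule invertible_near_one)
    obtain m y where my: "z = m + x * y" "m \<in> M" "y \<in> S" using z by (auto simp: N_def)
    have wS: "w \<in> S" using inverse_mem[OF _ w] z NS by auto
    \<comment> \<open>Multiply \<open>z = m + x * y\<close> by the inverse \<open>w\<close> of
      \<open>z\<close>.\<close>
    have "1 - x * (y * w) = w * m"
    proof -
      have "w * m + x * (y * w) = z * w"
        using my wS x MS by (simp add: algebra_simps commute[of w m] subsetD)
      then show ?thesis using w by (simp add: algebra_simps)
    qed
    then show False using ninv[of "y * w"] my wS Mi by simp
  qed
  moreover have "closure N \<subseteq> S" using NS closed by (rule closure_minimal)
  moreover have "a * m \<in> closure N" if "a \<in> S" "m \<in> closure N" for a m
  proof -
    have "(*) a ` closure N \<subseteq> closure N"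
      by (rule image_closure_subset) (auto intro!: continuous_intros subsetD[OF closure_subset] Ni that)
    then show ?thesis using that by auto
  qed
  ultimately have "proper_ideal (closure N)"
    using sub unfolding proper_ideal_def by (auto simp: subspace_closure)
  moreover have "M \<subseteq> closure N"
  proof -
    have "m \<in> N" if "m \<in> M" for m unfolding N_def using that by (intro CollectI exI[of _ m] exI[of _ 0]) auto
    then show ?thesis using closure_subset by blast
  qed
  moreover have "x \<in> closure N"
  proof -
    have "x \<in> N" unfolding N_def using Ms by (intro CollectI exI[of _ 0] exI[of _ 1]) (auto simp: subspace_0)
    then show ?thesis using closure_subset by blast
  qed
  ultimately show ?thesis using that by blast
qed

text \<open>The distance to \<open>M\<close> is the norm of the quotient by \<open>M\<close>. It
  need not be attained, so representatives that are optimal up to \<open>e\<close> are multiplied,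
  and \<open>e\<close> tends to 0.\<close>

lemma infdist_mult:
  assumes M: "proper_ideal M" and xy: "x \<in> S" "y \<in> S"
  shows "infdist (x * y) M \<le> infdist x M * infdist y M"
proof -
  have Ms: "subspace M" and MS: "M \<subseteq> S" and Mi: "\<And>a m. a \<in> S \<Longrightarrow> m \<in> M \<Longrightarrow> a * m \<in> M" and ne: "M \<noteq> {}"
    using M by (auto simp: proper_ideal_def dest: subspace_0)
  have "infdist (x * y) M \<le> (infdist x M + e) * (infdist y M + e)" if "e > 0" for e
  proof -
    have ex: "\<exists>m\<in>M. dist u m < infdist u M + e" for u
    proof (rule ccontr)
      assume "\<not> ?thesis"
      then have "infdist u M + e \<le> (INF m\<in>M. dist u m)"
        by (intro cINF_greatest[OF ne]) (auto simp: not_less)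
      then show False using \<open>e > 0\<close> by (simp add: infdist_notempty[OF ne])
    qed
    obtain m where m: "m \<in> M" "dist x m < infdist x M + e" using ex by blast
    obtain n where n: "n \<in> M" "dist y n < infdist y M + e" using ex by blast
    \<comment> \<open>The element of \<open>M\<close> that differs from \<open>x * y\<close> by the
      product \<open>(x - m) * (y - n)\<close>.\<close>
    have "x * n + (y * m - n * m) \<in> M"
      using Ms MS Mi m n xy by (meson subsetD subspace_add subspace_diff)
    moreover have "x * y - (x * n + (y * m - n * m)) = (x - m) * (y - n)"
      using m n MS xy by (simp add: algebra_simps commute[of m] subsetD)
    ultimately have "infdist (x * y) M \<le> norm ((x - m) * (y - n))"
      by (metis dist_norm infdist_le)
    also have "\<dots> \<le> norm (x - m) * norm (y - n)" by (rule norm_mult_ineq)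
    also have "\<dots> \<le> (infdist x M + e) * (infdist y M + e)"
      using m n \<open>e > 0\<close> by (intro mult_mono) (auto simp: dist_norm infdist_nonneg add_nonneg_nonneg)
    finally show ?thesis .
  qed
  then have "\<forall>\<^sub>F e in at_right 0. infdist (x * y) M \<le> (infdist x M + e) * (infdist y M + e)"
    by (auto simp: eventually_at_filter)
  moreover have "((\<lambda>e. (infdist x M + e) * (infdist y M + e)) \<longlongrightarrow> (infdist x M + 0) * (infdist y M + 0)) (at_right 0)"
    by (intro tendsto_intros)
  ultimately show ?thesis
    using tendsto_lowerbound[of _ _ "at_right (0::real)"] by fastforce
qed

text \<open>
  Gelfand--Mazur for the quotient of \<open>S\<close> by a closed ideal.  If \<open>a\<close> had empty spectrum, then
  \<open>v w = (1 - w a)\<^sup>-\<^sup>1\<close> would be an entire function; its averages over the \<open>n\<close>-th roots of unity of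
  radius \<open>r\<close> are \<open>(1 - (r a)\<^sup>n)\<^sup>-\<^sup>1\<close>, and the uniform continuity of \<open>v\<close> lets one increase \<open>r\<close> in
  fixed steps while \<open>(r a)\<^sup>n\<close> stays bounded, which contradicts the invertibility of \<open>a\<close>.
\<close>

lemma spectrum_mod_ideal_nonempty:
  assumes M: "proper_ideal M" and a [simp]: "a \<in> S"
  obtains z where "\<And>y. y \<in> S \<Longrightarrow> 1 - (a - emb z) * y \<notin> M"
proof (rule ccontr)
  assume "\<not> thesis"
  then have inv: "\<exists>y\<in>S. 1 - (a - emb z) * y \<in> M" for z using that by blast
  have Ms: "subspace M" and MS: "\<And>m. m \<in> M \<Longrightarrow> m \<in> S" and cl: "closed M" and one: "1 \<notin> M"
    and Mi: "\<And>a m. a \<in> S \<Longrightarrow> m \<in> M \<Longrightarrow> a * m \<in> M" and ne: "M \<noteq> {}"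
    using M by (auto simp: proper_ideal_def dest: subspace_0)
  note Madd = subspace_add[OF Ms] and Mdiff = subspace_diff[OF Ms] and Msc = subspace_scale[OF Ms]
    and M0 = subspace_0[OF Ms] and Mneg = subspace_neg[OF Ms]
  have Mi': "m * a \<in> M" if "a \<in> S" "m \<in> M" for a m using Mi[OF that] commute[OF that(1) MS[OF that(2)]] by simp
  \<comment> \<open>The quotient norm, handled as a seminorm upstairs; with the facts that follow,
    all computations modulo \<open>M\<close> are carried out on representatives.\<close>
  define q where "q x = infdist x M" for x
  have q0: "q x \<ge> 0" for x by (simp add: q_def infdist_nonneg)
  have qle: "q x \<le> norm (x - m)" if "m \<in> M" for x m
    unfolding q_def using infdist_le[OF that, of x] by (simp add: dist_norm)
  have qnorm: "q x \<le> norm x" for x using qle[OF M0] by simp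
  have qM: "q x = 0 \<longleftrightarrow> x \<in> M" for x
    unfolding q_def using in_closed_iff_infdist_zero[OF cl ne] by simp
  have q_mult: "q (x * y) \<le> q x * q y" if "x \<in> S" "y \<in> S" for x y
    unfolding q_def by (rule infdist_mult[OF M that])
  have q_shift: "q (x + m) = q x" if "m \<in> M" for x m
  proof -
    have *: "infdist (x + m) M \<le> infdist x M" if "m \<in> M" for x m
      unfolding infdist_notempty[OF ne, of x]
    proof (rule cINF_greatest[OF ne])
      fix k assume "k \<in> M"
      then show "infdist (x + m) M \<le> dist x k"
        using infdist_le[OF Madd[OF that \<open>k \<in> M\<close>], of "x + m"] by (simp add: dist_norm)
    qed
    show ?thesis unfolding q_def using *[OF that, of x] *[OF Mneg[OF that], of "x + m"] by simp
  qed
  have q_cong: "q x = q y" if "x - y \<in> M" for x y using q_shift[OF that, of y] by simp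
  have q_scale: "q (c *\<^sub>R x) \<le> \<bar>c\<bar> * q x" for c x
  proof (cases "c = 0")
    case False
    have "q (c *\<^sub>R x) / \<bar>c\<bar> \<le> q x"
      unfolding q_def infdist_notempty[OF ne, of x]
    proof (rule cINF_greatest[OF ne])
      fix k assume "k \<in> M"
      have "infdist (c *\<^sub>R x) M \<le> norm (c *\<^sub>R x - c *\<^sub>R k)"
        using infdist_le[OF Msc[OF \<open>k \<in> M\<close>, of c]] by (simp add: dist_norm)
      also have "\<dots> = \<bar>c\<bar> * dist x k" by (simp add: dist_norm flip: scaleR_diff_right)
      finally show "infdist (c *\<^sub>R x) M / \<bar>c\<bar> \<le> dist x k" using False by (simp add: field_simps)
    qed
    then show ?thesis using False by (simp add: field_simps)
  qed (use qM[of 0] M0 in simp)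
  have q_add: "q (x + y) \<le> q x + q y" for x y
  proof -
    have "q (x + y) - q x \<le> q y"
      unfolding q_def infdist_notempty[OF ne, of y]
    proof (rule cINF_greatest[OF ne])
      fix k assume k: "k \<in> M"
      have "infdist (x + y) M - norm (y - k) \<le> infdist x M"
        unfolding infdist_notempty[OF ne, of x]
      proof (rule cINF_greatest[OF ne])
        fix l assume l: "l \<in> M"
        have "infdist (x + y) M \<le> norm ((x - l) + (y - k))"
          using infdist_le[OF Madd[OF l k], of "x + y"] by (simp add: dist_norm algebra_simps)
        also have "\<dots> \<le> norm (x - l) + norm (y - k)" by (rule norm_triangle_ineq)
        finally show "infdist (x + y) M - norm (y - k) \<le> dist x l" by (simp add: dist_norm)
      qed
      then show "infdist (x + y) M - infdist x M \<le> dist y k" by (simp add: dist_norm)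
    qed
    then show ?thesis by simp
  qed
  have q_minus: "q (- x) \<le> q x" for x using q_scale[of "-1" x] by simp
  have q_diff: "q (x - y) \<le> q x + q y" for x y using q_add[of x "- y"] q_minus[of y] by simp
  have q_comm: "q (x - y) = q (y - x)" for x y
    using q_minus[of "x - y"] q_minus[of "y - x"] by simp
  have q1: "q 1 > 0" using q0[of 1] qM[of 1] one by simp
  obtain b where b: "b \<in> S" "1 - a * b \<in> M" using inv[of 0] by auto
  \<comment> \<open>For \<open>w \<noteq> 0\<close> the inverse of \<open>1 - w a\<close> modulo
    \<open>M\<close> is \<open>- 1 / w\<close> times the inverse of
    \<open>a - 1 / w\<close>.\<close>
  have "\<exists>y\<in>S. 1 - (1 - emb w * a) * y \<in> M" for w
  proof (cases "w = 0")
    case True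
    then show ?thesis using M0 by (intro bexI[of _ 1]) auto
  next
    case False
    obtain y where y: "y \<in> S" "1 - (a - emb (1/w)) * y \<in> M" using inv by blast
    have u: "emb w * emb (1/w) = 1" using False by (metis emb_1 emb_mult nonzero_eq_divide_eq mult.commute)
    have "emb w * a * (emb (1/w) * y) = (emb w * emb (1/w)) * (a * y)"
      using y(1) by (simp add: ac)
    then have "(1 - emb w * a) * (- (emb (1/w) * y)) = (a - emb (1/w)) * y"
      unfolding u by (simp add: algebra_simps)
    then show ?thesis using y by (intro bexI[of _ "- (emb (1/w) * y)"]) auto
  qed
  then obtain v where vS [simp]: "\<And>w. v w \<in> S" and v: "\<And>w. 1 - (1 - emb w * a) * v w \<in> M" by metis
  \<comment> \<open>The resolvent identity: multiply each of the two congruences defining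
    \<open>v\<close> by the other inverse and subtract.\<close>
  have v_diff: "v w - v w' - (emb w - emb w') * a * v w * v w' \<in> M" for w w'
  proof -
    have "v w' * (1 - (1 - emb w * a) * v w) \<in> M" "v w * (1 - (1 - emb w' * a) * v w') \<in> M"
      using Mi v by auto
    then have "v w * (1 - (1 - emb w' * a) * v w') - v w' * (1 - (1 - emb w * a) * v w) \<in> M" by (rule Mdiff[rotated])
    moreover have "v w * (1 - (1 - emb w' * a) * v w') - v w' * (1 - (1 - emb w * a) * v w)
       = v w - v w' - (emb w - emb w') * a * v w * v w'"
      by (simp add: algebra_simps ac)
    ultimately show ?thesis by simp
  qed
  define E where "E = (norm (1::'a) + norm j) * norm a"
  have E0: "E \<ge> 0" by (simp add: E_def)
  have q_vdiff: "q (v w - v w') \<le> E * norm (w - w') * (q (v w) * q (v w'))" for w w'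
  proof -
    have "q (v w - v w') = q ((emb (w - w') * a) * (v w * v w'))"
      using q_cong[OF v_diff[of w w']] by (simp add: emb_diff mult.assoc)
    also have "\<dots> \<le> q (emb (w - w') * a) * (q (v w) * q (v w'))"
      using q_mult[of "emb (w - w') * a" "v w * v w'"] q_mult[of "v w" "v w'"]
        mult_left_mono[OF _ q0] by (meson a emb_mem mult_mem order_trans vS)
    also have "q (emb (w - w') * a) \<le> norm (emb (w - w')) * norm a"
      using qnorm norm_mult_ineq order_trans by blast
    also have "\<dots> \<le> E * norm (w - w')"
      unfolding E_def using mult_right_mono[OF norm_emb[of "w - w'"], of "norm a"] by (simp add: mult_ac)
    finally show ?thesis using q0 by (simp add: mult_right_mono)
  qed
  have cont: "isCont (\<lambda>w. q (v w)) w0" for w0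
  proof -
    define k where "k = q (v w0)"
    \<comment> \<open>The identity estimates \<open>v w - v w0\<close> by a multiple of
      \<open>q (v w)\<close> itself. Close to \<open>w0\<close> this is at most half of
      \<open>q (v w)\<close> and is absorbed, which leaves
      \<open>q (v w) \<le> 2 * k\<close>.\<close>
    have bnd: "\<bar>q (v w) - k\<bar> \<le> E * norm (w - w0) * (2 * k * k)" if w: "E * norm (w - w0) * k \<le> 1/2" for w
    proof -
      have *: "\<bar>q (v w) - k\<bar> \<le> q (v w - v w0)"
        using q_add[of "v w - v w0" "v w0"] q_add[of "v w0 - v w" "v w"] q_comm[of "v w" "v w0"]
        by (simp add: k_def)
      have "E * norm (w - w0) * (q (v w) * k) \<le> 1/2 * q (v w)"
        using mult_right_mono[OF w q0[of "v w"]] by (simp add: mult_ac)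
      then have "q (v w) \<le> 2 * k" using * q_vdiff[of w w0] unfolding k_def by linarith
      then have "E * norm (w - w0) * (q (v w) * k) \<le> E * norm (w - w0) * (2 * k * k)"
        using E0 q0 by (intro mult_left_mono mult_right_mono) (auto simp: k_def)
      then show ?thesis using * q_vdiff[of w w0] unfolding k_def by linarith
    qed
    have lim: "((\<lambda>w. E * norm (w - w0) * c) \<longlongrightarrow> 0) (at w0)" for c
      by (rule tendsto_eq_intros refl | simp)+
    have "((\<lambda>w. q (v w) - k) \<longlongrightarrow> 0) (at w0)"
    proof (rule Lim_null_comparison[OF _ lim[of "2 * k * k"]])
      have "\<forall>\<^sub>F w in at w0. E * norm (w - w0) * k < 1/2" by (rule order_tendstoD[OF lim]) simp
      then show "\<forall>\<^sub>F w in at w0. norm (q (v w) - k) \<le> E * norm (w - w0) * (2 * k * k)"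
        by eventually_elim (use bnd in auto)
    qed
    then show ?thesis unfolding isCont_def k_def by (rule LIM_zero_cancel)
  qed
  \<comment> \<open>Since \<open>b\<close> inverts \<open>a\<close> modulo \<open>M\<close>, the
    powers of \<open>a\<close> decay at most geometrically, with ratio
    \<open>1 / q b\<close>.\<close>
  have qab: "q 1 \<le> q (a ^ n) * q b ^ n" for n
  proof -
    have "1 - a ^ n * b ^ n \<in> M"
    proof (induction n)
      case (Suc n)
      have "1 - a ^ Suc n * b ^ Suc n = (1 - a * b) + (a * b) * (1 - a ^ n * b ^ n)"
        using b by (simp add: algebra_simps ac)
      then show ?case using Madd[OF b(2) Mi[OF _ Suc, of "a * b"]] b(1) by (simp only: mult_mem a)
    qed (use M0 in simp)
    then have "q 1 = q (a ^ n * b ^ n)" by (rule q_cong)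
    also have "\<dots> \<le> q (a ^ n) * q (b ^ n)" using b by (intro q_mult) auto
    finally have ab: "q 1 \<le> q (a ^ n) * q (b ^ n)" .
    have pow: "q (b ^ n) \<le> q b ^ n" if "n > 0"
      using that
    proof (induction n rule: nat_induct_non_zero)
      case (Suc n)
      have "q (b ^ Suc n) \<le> q b * q (b ^ n)" using b q_mult by simp
      also have "\<dots> \<le> q b * q b ^ n" using Suc q0 by (intro mult_left_mono) auto
      finally show ?case by simp
    qed simp
    show ?thesis
    proof (cases "n = 0")
      case False
      then have "q (a ^ n) * q (b ^ n) \<le> q (a ^ n) * q b ^ n" using pow q0 by (intro mult_left_mono) auto
      then show ?thesis using ab by simp
    qed simp
  qed
  have qb: "q b > 0" using qab[of 1] q1 q0[of b] by (cases "q b = 0") auto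
  \<comment> \<open>At this radius \<open>qab\<close> gives the \<open>n\<close>-th power of
    \<open>R a\<close> a quotient norm of at least \<open>2 ^ n * q 1\<close>, so these powers
    cannot stay bounded.\<close>
  define R where "R = 2 * q b"
  have R0: "R > 0" using qb by (simp add: R_def)
  have "compact ((\<lambda>w. q (v w)) ` cball 0 R)"
    by (intro compact_continuous_image continuous_at_imp_continuous_on ballI cont compact_cball)
  then have "bounded ((\<lambda>w. q (v w)) ` cball 0 R)" by (rule compact_imp_bounded)
  then obtain K0 where "\<forall>x\<in>(\<lambda>w. q (v w)) ` cball 0 R. norm x \<le> K0" by (auto simp only: bounded_iff)
  then have K0: "q (v w) \<le> K0" if "norm w \<le> R" for w using that by force
  have K00: "K0 \<ge> 0" using K0[of 0] R0 q0[of "v 0"] by simp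
  define L where "L = E * (K0 * K0)"
  have L0: "L \<ge> 0" using E0 by (simp add: L_def)
  have lip: "q (v w - v w') \<le> L * norm (w - w')" if "norm w \<le> R" "norm w' \<le> R" for w w'
  proof -
    have "E * norm (w - w') * (q (v w) * q (v w')) \<le> E * norm (w - w') * (K0 * K0)"
      using E0 K0 K00 q0 that by (intro mult_left_mono mult_mono) auto
    then show ?thesis using q_vdiff[of w w'] by (simp add: L_def mult_ac)
  qed
  define zeta where "zeta n i = cis (2 * pi * real i / real n)" for n i :: nat
  \<comment> \<open>The mean of \<open>v\<close> over the \<open>n\<close>-th roots of unity, scaled
    to radius \<open>r\<close>; by \<open>U_inv\<close> it inverts \<open>1 - (r a)^n\<close> modulo
    \<open>M\<close>.\<close>
  define U where "U n r = (1 / real n) *\<^sub>R (\<Sum>i<n. v (of_real r * zeta n i))" for n :: nat and r :: real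
  have US [simp]: "U n r \<in> S" for n r by (simp add: U_def)
  have q_avg: "q ((1 / real n) *\<^sub>R (\<Sum>i<n. f i)) \<le> c" if n: "n > 0" and c: "\<And>i. q (f i) \<le> c" for f c and n :: nat
  proof -
    have "q (\<Sum>i<m. f i) \<le> real m * c" for m :: nat
    proof (induction m)
      case (Suc m)
      then show ?case using q_add[of "\<Sum>i<m. f i" "f m"] c[of m] by (simp add: algebra_simps)
    qed (use qM[of 0] M0 in simp)
    then have "1 / real n * q (\<Sum>i<n. f i) \<le> 1 / real n * (real n * c)" by (intro mult_left_mono) auto
    then show ?thesis using q_scale[of "1 / real n" "\<Sum>i<n. f i"] n by simp
  qed
  have nz: "norm (of_real r * zeta n i) = r" if "r \<ge> 0" for r n i
    using that by (simp add: zeta_def norm_mult)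
  have U_bound: "q (U n r) \<le> K0" if "n > 0" "0 \<le> r" "r \<le> R" for n r
    unfolding U_def by (rule q_avg[OF \<open>n > 0\<close>]) (use that nz in \<open>auto intro!: K0\<close>)
  have U_diff: "q (U n r - U n r') \<le> L * \<bar>r - r'\<bar>" if "n > 0" "0 \<le> r" "r \<le> R" "0 \<le> r'" "r' \<le> R" for n r r'
  proof -
    have "norm (of_real r * zeta n i - of_real r' * zeta n i) = \<bar>r - r'\<bar>" for i
      by (simp add: zeta_def norm_mult flip: left_diff_distrib of_real_diff)
    then have "q (v (of_real r * zeta n i) - v (of_real r' * zeta n i)) \<le> L * \<bar>r - r'\<bar>" for i
      using lip[of "of_real r * zeta n i" "of_real r' * zeta n i"] nz that by auto
    from q_avg[OF \<open>n > 0\<close> this] show ?thesis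
      by (simp add: U_def sum_subtractf flip: scaleR_diff_right)
  qed
  have U_inv: "(1 - (r *\<^sub>R a) ^ n) * U n r - 1 \<in> M" if n: "n > 0" for n r
  proof -
    define x where "x = r *\<^sub>R a"
    have xS [simp]: "x \<in> S" by (simp add: x_def)
    have *: "(1 - x ^ n) * v (of_real r * zeta n i) - (\<Sum>k<n. emb (zeta n i ^ k) * x ^ k) \<in> M" for i
    proof -
      define y where "y = emb (of_real r * zeta n i) * a"
      have y: "y = emb (zeta n i) * x"
        unfolding y_def x_def by (simp add: emb_mult emb_of_real)
      have "zeta n i ^ n = 1" unfolding zeta_def Complex.DeMoivre using n cis_multiple_2pi[of "real i"] by (simp add: mult_ac)
      then have yn: "y ^ n = x ^ n" unfolding y by (simp add: power_mult flip: emb_power)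
      have yS [simp]: "y \<in> S" by (simp add: y)
      \<comment> \<open>As \<open>v\<close> inverts \<open>1 - y\<close>, multiplication by the
        geometric sum leaves \<open>1 - y ^ n\<close> in front of \<open>v\<close>, and
        \<open>y ^ n = x ^ n\<close> does not depend on the root of unity.\<close>
      have "(\<Sum>k<n. y ^ k) * (1 - (1 - y) * v (of_real r * zeta n i)) \<in> M"
        using v[of "of_real r * zeta n i"] by (intro Mi) (auto simp: y_def)
      also have "(\<Sum>k<n. y ^ k) * (1 - (1 - y) * v (of_real r * zeta n i)) =
         (\<Sum>k<n. y ^ k) - (\<Sum>k<n. y ^ k) * (1 - y) * v (of_real r * zeta n i)"
        by (simp add: algebra_simps)
      also have "\<dots> = (\<Sum>k<n. emb (zeta n i ^ k) * x ^ k) - (1 - x ^ n) * v (of_real r * zeta n i)"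
        unfolding one_minus_power_eq yn by (simp add: y power_mult emb_power)
      finally have "(\<Sum>k<n. emb (zeta n i ^ k) * x ^ k) - (1 - x ^ n) * v (of_real r * zeta n i) \<in> M" .
      from Mneg[OF this] show ?thesis by (simp only: minus_diff_eq)
    qed
    have "(1 / real n) *\<^sub>R (\<Sum>i<n. (1 - x ^ n) * v (of_real r * zeta n i) - (\<Sum>k<n. emb (zeta n i ^ k) * x ^ k)) \<in> M"
      by (intro Msc subspace_sum[OF Ms] *)
    also have "(\<Sum>i<n. (1 - x ^ n) * v (of_real r * zeta n i) - (\<Sum>k<n. emb (zeta n i ^ k) * x ^ k)) =
      (1 - x ^ n) * (\<Sum>i<n. v (of_real r * zeta n i)) - (\<Sum>k<n. emb (\<Sum>i<n. zeta n i ^ k) * x ^ k)"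
      by (subst sum_subtractf, subst sum.swap) (simp add: sum_distrib_left sum_distrib_right emb_sum)
    also have "(\<Sum>k<n. emb (\<Sum>i<n. zeta n i ^ k) * x ^ k) = (\<Sum>k<n. if k = 0 then real n *\<^sub>R 1 else 0)"
      using emb_of_real[of "real n"]
      by (intro sum.cong refl) (auto simp: zeta_def sum_roots_of_unity)
    also have "\<dots> = real n *\<^sub>R 1" using n by simp
    finally show ?thesis using n by (simp add: U_def x_def scaleR_diff_right)
  qed
  define bdd where "bdd r \<longleftrightarrow> (\<exists>K. \<forall>n. q ((r *\<^sub>R a) ^ n) \<le> K)" for r
  have step: "bdd (r + h)" if r: "bdd r" "0 \<le> r" "r + h \<le> R" "0 \<le> h" "L * (2 * h) \<le> 1/4" "h > 0" for r h
  proof -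
    obtain K where K: "\<And>n. q ((r *\<^sub>R a) ^ n) \<le> K" using r(1) by (auto simp: bdd_def)
    \<comment> \<open>At a strictly smaller radius the powers tend to 0 by comparison with
      \<open>r\<close>, so \<open>U n r1\<close> tends to 1 modulo \<open>M\<close>; the Lipschitz
      bound carries closeness to 1 over to \<open>r + h\<close>. At \<open>r = 0\<close> also
      \<open>r1 = 0\<close>, and the ratio \<open>c\<close> is set to 0.\<close>
    define r1 where "r1 = max 0 (r - h)"
    define c where "c = (if r = 0 then 0 else r1 / r)"
    have r1: "r1 = c * r" "0 \<le> r1" "r1 \<le> R" "\<bar>r1 - (r + h)\<bar> \<le> 2 * h" and c: "0 \<le> c" "c < 1"
      using r by (auto simp: r1_def c_def field_simps max_def)
    have small: "q ((r1 *\<^sub>R a) ^ n) \<le> c ^ n * K" for n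
    proof -
      have "(r1 *\<^sub>R a) ^ n = c ^ n *\<^sub>R (r *\<^sub>R a) ^ n"
      proof (induction n)
        case (Suc n)
        show ?case unfolding power_Suc Suc by (simp add: r1(1) mult_ac)
      qed simp
      moreover have "c ^ n * q ((r *\<^sub>R a) ^ n) \<le> c ^ n * K" using K c by (intro mult_left_mono) auto
      ultimately show ?thesis using q_scale[of "c ^ n" "(r *\<^sub>R a) ^ n"] c by simp
    qed
    have "(\<lambda>n. c ^ n * K * K0) \<longlonglongrightarrow> 0 * K * K0"
      by (intro tendsto_intros LIMSEQ_realpow_zero c)
    then have "\<forall>\<^sub>F n in sequentially. c ^ n * K * K0 < 1/4" by (rule order_tendstoD) simp
    then obtain N where N: "\<And>n. n \<ge> N \<Longrightarrow> c ^ n * K * K0 < 1/4" by (auto simp: eventually_sequentially)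
    have big: "q (((r + h) *\<^sub>R a) ^ n) \<le> q 1" if n: "n \<ge> N" "n > 0" for n
    proof -
      define x1 where "x1 = (r1 *\<^sub>R a) ^ n"
      define x2 where "x2 = ((r + h) *\<^sub>R a) ^ n"
      have [simp]: "x1 \<in> S" "x2 \<in> S" by (auto simp: x1_def x2_def)
      have "U n r1 - 1 - x1 * U n r1 \<in> M"
        using U_inv[OF n(2), of r1] by (simp add: x1_def algebra_simps)
      then have "q (U n r1 - 1) = q (x1 * U n r1)" by (rule q_cong)
      also have "\<dots> \<le> q x1 * q (U n r1)" by (intro q_mult) auto
      also have "\<dots> \<le> (c ^ n * K) * K0"
        using small[of n] U_bound[OF n(2) r1(2,3)] q0 K00
        by (intro mult_mono) (auto simp: x1_def intro: order_trans[OF q0])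
      also have "\<dots> \<le> 1/4" using N[OF n(1)] by simp
      finally have 1: "q (U n r1 - 1) \<le> 1/4" .
      have "q (U n (r + h) - U n r1) \<le> L * \<bar>(r + h) - r1\<bar>"
        using r r1 by (intro U_diff n(2)) auto
      also have "\<dots> \<le> L * (2 * h)" using L0 r1 by (intro mult_left_mono) auto
      finally have 2: "q (U n (r + h) - U n r1) \<le> 1/4" using r by simp
      define d where "d = U n (r + h) - 1"
      have [simp]: "d \<in> S" by (simp add: d_def)
      have d: "q d \<le> 1/2" using q_add[of "U n (r + h) - U n r1" "U n r1 - 1"] 1 2 by (simp add: d_def)
      have "- ((1 - x2) * U n (r + h) - 1) \<in> M" using Mneg[OF U_inv[OF n(2), of "r + h"]] by (simp add: x2_def)
      also have "- ((1 - x2) * U n (r + h) - 1) = x2 - (1 - x2) * d" by (simp add: d_def algebra_simps)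
      \<comment> \<open>Because \<open>d\<close> has quotient norm at most 1/2, \<open>q x2\<close>
        is at most half of \<open>q 1 + q x2\<close>, hence at most \<open>q 1\<close>, uniformly in
        \<open>n\<close>.\<close>
      finally have "q x2 = q ((1 - x2) * d)" by (rule q_cong)
      also have "\<dots> \<le> q (1 - x2) * q d" by (intro q_mult) auto
      also have "\<dots> \<le> (q 1 + q x2) * (1/2)" using d q0 q_diff[of 1 x2] by (intro mult_mono) auto
      finally show ?thesis by (simp add: x2_def)
    qed
    define B where "B = Max ((\<lambda>n. q (((r + h) *\<^sub>R a) ^ n)) ` {..N})"
    have "q (((r + h) *\<^sub>R a) ^ n) \<le> max B (q 1)" for n
    proof (cases "n \<le> N")
      case True
      then have "q (((r + h) *\<^sub>R a) ^ n) \<le> B" unfolding B_def by (intro Max_ge) auto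
      then show ?thesis by simp
    next
      case False
      then show ?thesis using big[of n] by simp
    qed
    then show ?thesis unfolding bdd_def by blast
  qed
  \<comment> \<open>The radius \<open>R\<close> is reached in \<open>m\<close> steps of length
    \<open>R / m\<close>; the condition \<open>L * (2 * h) \<le> 1/4\<close> on a step
    \<open>h\<close> then reads \<open>8 * L * R \<le> m\<close>.\<close>
  obtain m :: nat where m: "8 * L * R < real m" using reals_Archimedean2 by blast
  have m0: "real m > 0" using m L0 R0 by (smt (verit) mult_nonneg_nonneg)
  have hs: "L * (2 * (R / real m)) \<le> 1/4" using m m0 by (simp add: field_simps)
  have "k \<le> m \<Longrightarrow> bdd (real k * (R / real m))" for k
  proof (induction k)
    case 0
    have "q ((0 *\<^sub>R a) ^ n) \<le> norm (1::'a)" for n using qnorm[of 1] qM[of 0] M0 by (cases n) auto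
    then show ?case by (auto simp: bdd_def)
  next
    case (Suc k)
    have "real (Suc k) * R \<le> real m * R" using Suc.prems R0 by (intro mult_right_mono) auto
    then have "real k * (R / real m) + R / real m \<le> R" using m0 by (simp add: field_simps)
    from step[OF _ _ this _ hs] Suc show ?case using m0 R0 by (simp add: algebra_simps add_divide_distrib)
  qed
  from this[of m] have "bdd R" using m0 by simp
  then obtain K where K: "\<And>n. q ((R *\<^sub>R a) ^ n) \<le> K" by (auto simp: bdd_def)
  have grow: "2 ^ n * q 1 \<le> K" for n
  proof -
    have e: "(R *\<^sub>R a) ^ n = R ^ n *\<^sub>R a ^ n" by (induction n) (auto simp: mult_ac)
    have "R ^ n * q (a ^ n) = R ^ n * q ((1 / R ^ n) *\<^sub>R (R *\<^sub>R a) ^ n)" using R0 e by simp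
    also have "\<dots> \<le> R ^ n * (\<bar>1 / R ^ n\<bar> * q ((R *\<^sub>R a) ^ n))"
      using R0 by (intro mult_left_mono q_scale) auto
    also have "\<dots> = q ((R *\<^sub>R a) ^ n)" using R0 by simp
    finally have *: "R ^ n * q (a ^ n) \<le> K" using K[of n] by simp
    have "2 ^ n * q 1 \<le> 2 ^ n * (q (a ^ n) * q b ^ n)" using qab by (intro mult_left_mono) auto
    also have "\<dots> = R ^ n * q (a ^ n)" by (simp add: R_def power_mult_distrib)
    finally show ?thesis using * by simp
  qed
  obtain n where "K / q 1 < 2 ^ n" using real_arch_pow[of 2 "K / q 1"] by auto
  then show False using grow[of n] q1 by (simp add: field_simps)
qed

text \<open>A spectral value \<open>z\<close> of \<open>a\<close> modulo \<open>M\<close> makes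
  \<open>a - emb z\<close> non-invertible modulo \<open>M\<close>, so adjoining this difference
  keeps the closed ideal proper.\<close>

lemma proper_ideal_eigenvalue:
  assumes M: "proper_ideal M" and a: "a \<in> S"
  obtains M' z where "proper_ideal M'" "M \<subseteq> M'" "a - emb z \<in> M'"
proof -
  obtain z where "\<And>y. y \<in> S \<Longrightarrow> 1 - (a - emb z) * y \<notin> M"
    using spectrum_mod_ideal_nonempty[OF M a] by blast
  then obtain M' where "proper_ideal M'" "M \<subseteq> M'" "a - emb z \<in> M'"
    using proper_ideal_extend[OF M, of "a - emb z"] a by (metis diff_mem emb_mem)
  then show ?thesis using that by blast
qed

text \<open>The zero ideal is enlarged three times: by \<open>x\<close>, then by the differences of
  \<open>a\<close> and of \<open>b\<close> to an eigenvalue. It is proper to begin with, because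
  \<open>x * 0 \<noteq> 1\<close> excludes \<open>1 = 0\<close>.\<close>

lemma singular_proper_ideal:
  assumes x: "x \<in> S" and "\<And>y. y \<in> S \<Longrightarrow> x * y \<noteq> 1" and a: "a \<in> S" and b: "b \<in> S"
  obtains M \<alpha> \<beta> where "proper_ideal M" "x \<in> M" "a - emb \<alpha> \<in> M" "b - emb \<beta> \<in> M"
proof -
  have "(1::'a) \<noteq> 0" using assms(2)[of 0] by simp
  then have "proper_ideal {0}" by (auto simp: proper_ideal_def subspace_def)
  moreover have "1 - x * y \<notin> {0}" if "y \<in> S" for y using assms(2)[OF that] by auto
  ultimately obtain M1 where M1: "proper_ideal M1" "x \<in> M1" using proper_ideal_extend x by metis
  obtain M2 \<alpha> where M2: "proper_ideal M2" "M1 \<subseteq> M2" "a - emb \<alpha> \<in> M2"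
    using proper_ideal_eigenvalue[OF M1(1) a] by blast
  obtain M3 \<beta> where "proper_ideal M3" "M2 \<subseteq> M3" "b - emb \<beta> \<in> M3"
    using proper_ideal_eigenvalue[OF M2(1) b] by blast
  then show ?thesis using that M1 M2 by blast
qed

text \<open>Nonzero complex scalars are units of \<open>S\<close>. Hence a congruence between
  scalars modulo \<open>M\<close> is an equality, and this is how the equations for
  \<open>\<alpha>\<close>, \<open>\<beta>\<close> and the spectral values are read off.\<close>

lemma proper_ideal_emb_iff:
  assumes "proper_ideal M"
  shows "emb z \<in> M \<longleftrightarrow> z = 0"
proof
  assume z: "emb z \<in> M"
  show "z = 0"
  proof (rule ccontr)
    assume "z \<noteq> 0"
    then have "emb (1 / z) * emb z = 1" by (simp flip: emb_mult)
    then show False using assms z unfolding proper_ideal_def by (metis emb_mem)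
  qed
qed (use assms in \<open>auto simp: proper_ideal_def subspace_0\<close>)

lemma ideal_facts:
  assumes "proper_ideal M"
  shows "subspace M" "closed M" "M \<subseteq> S" "1 \<notin> M" "\<And>a m. a \<in> S \<Longrightarrow> m \<in> M \<Longrightarrow> a * m \<in> M"
    "\<And>x y. x \<in> M \<Longrightarrow> y \<in> M \<Longrightarrow> x + y \<in> M" "\<And>x y. x \<in> M \<Longrightarrow> y \<in> M \<Longrightarrow> x - y \<in> M"
    "\<And>c x. x \<in> M \<Longrightarrow> c *\<^sub>R x \<in> M" "0 \<in> M"
  using assms unfolding proper_ideal_def
  by (auto simp: subspace_add subspace_diff subspace_scale subspace_0)

lemma ideal_cong_mult:
  assumes M: "proper_ideal M" and "x - x' \<in> M" "y - y' \<in> M" "x \<in> S" "y' \<in> S" "x' \<in> S"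
  shows "x * y - x' * y' \<in> M"
proof -
  have "x * (y - y') + y' * (x - x') \<in> M"
    using assms ideal_facts(5,6)[OF M] by blast
  moreover have "x * (y - y') + y' * (x - x') = x * y - x' * y'"
    using assms by (simp add: algebra_simps commute)
  ultimately show ?thesis by simp
qed

end

section \<open>Integrals of functions with values in a Banach space\<close>

text \<open>Riemann sums stay in \<open>M\<close> and their limits do so too. This transports
  membership in the algebra, in the right-linear operators or in an ideal from an integrand to its
  integral.\<close>

lemma has_integral_in_closed_subspace:
  fixes f :: "'n::euclidean_space \<Rightarrow> 'b::banach"
  assumes f: "(f has_integral y) UNIV" and mem: "\<And>x. f x \<in> M" and M: "subspace M" "closed M"
  shows "y \<in> M"
proof -
  have box: "z \<in> M" if z: "(f has_integral z) (cbox a b)" for z a b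
  proof -
    have "\<exists>w\<in>M. dist w z < e" if "e > 0" for e
    proof -
      obtain d where d: "gauge d"
        "\<And>p. p tagged_division_of (cbox a b) \<Longrightarrow> d fine p \<Longrightarrow> norm ((\<Sum>(x,k)\<in>p. measure lborel k *\<^sub>R f x) - z) < e"
        using has_integralD[OF z \<open>e > 0\<close>] by metis
      obtain p where p: "p tagged_division_of (cbox a b)" "d fine p"
        using fine_division_exists[OF d(1)] by blast
      have "(\<Sum>(x,k)\<in>p. measure lborel k *\<^sub>R f x) \<in> M"
        using M(1) mem by (auto intro!: subspace_sum subspace_scale)
      then show ?thesis using d(2)[OF p] by (auto simp: dist_norm)
    qed
    then show ?thesis using closure_approachable closure_closed[OF M(2)] by blast
  qed
  have "\<exists>w\<in>M. dist w y < e" if e: "e > 0" for e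
  proof -
    have "\<not> (\<exists>a b. (UNIV :: 'n set) = cbox a b)"
      using not_compact_UNIV by (metis compact_cbox)
    then obtain B where B: "B > 0" "\<forall>a b. ball 0 B \<subseteq> cbox a b \<longrightarrow>
      (\<exists>z. ((\<lambda>x. if x \<in> UNIV then f x else 0) has_integral z) (cbox a b) \<and> norm (z - y) < e)"
      using has_integral_altD[OF f _ e] by blast
    obtain a where "ball 0 B \<subseteq> cbox (- a) (a :: 'n)"
      using bounded_subset_cbox_symmetric[OF bounded_ball] by blast
    from B(2)[rule_format, OF this] obtain z where "(f has_integral z) (cbox (- a) a)" "norm (z - y) < e"
      by auto
    then show ?thesis using box by (auto simp: dist_norm)
  qed
  then show ?thesis using closure_approachable closure_closed[OF M(2)] by blast
qed

text \<open>On a fine division the Riemann sums of \<open>f\<close> and \<open>h n\<close> differ by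
  at most a Riemann sum of \<open>g n\<close>, so those of \<open>f\<close> are Cauchy once the
  integral of \<open>g n\<close> is small. Only the error bound is real valued; \<open>f\<close> may
  take values in any Banach space.\<close>

lemma integrable_on_L1_limit:
  fixes f :: "'n::euclidean_space \<Rightarrow> 'b::banach"
  assumes f: "\<And>n. h n integrable_on cbox a b" and g: "\<And>n. g n integrable_on cbox a b"
    and le: "\<And>n x. x \<in> cbox a b \<Longrightarrow> norm (f x - h n x) \<le> g n x"
    and lim: "(\<lambda>n::nat. integral (cbox a b) (g n)) \<longlonglongrightarrow> (0::real)"
  shows "f integrable_on cbox a b"
  unfolding integrable_Cauchy
proof (intro allI impI)
  fix e :: real assume e: "e > 0"
  have "\<forall>\<^sub>F n in sequentially. integral (cbox a b) (g n) < e / 6"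
    using lim e by (intro order_tendstoD) auto
  then obtain n where n: "integral (cbox a b) (g n) < e / 6" by (auto simp: eventually_sequentially)
  have e6: "e / 6 > 0" using e by simp
  obtain d1 where d1: "gauge d1"
    "\<And>p. p tagged_division_of (cbox a b) \<Longrightarrow> d1 fine p \<Longrightarrow>
      norm ((\<Sum>(x,k)\<in>p. measure lborel k *\<^sub>R h n x) - integral (cbox a b) (h n)) < e / 6"
    using has_integralD[OF integrable_integral[OF f[of n]] e6] by metis
  obtain d2 where d2: "gauge d2"
    "\<And>p. p tagged_division_of (cbox a b) \<Longrightarrow> d2 fine p \<Longrightarrow>
      norm ((\<Sum>(x,k)\<in>p. measure lborel k *\<^sub>R g n x) - integral (cbox a b) (g n)) < e / 6"
    using has_integralD[OF integrable_integral[OF g[of n]] e6] by metis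
  have close: "norm ((\<Sum>(x,k)\<in>p. measure lborel k *\<^sub>R f x) - integral (cbox a b) (h n)) < e / 2"
    if p: "p tagged_division_of (cbox a b)" "(\<lambda>x. d1 x \<inter> d2 x) fine p" for p
  proof -
    have fine: "d1 fine p" "d2 fine p" using p(2) by (auto simp: fine_Int)
    have "norm ((\<Sum>(x,k)\<in>p. measure lborel k *\<^sub>R f x) - (\<Sum>(x,k)\<in>p. measure lborel k *\<^sub>R h n x))
        = norm (\<Sum>(x,k)\<in>p. measure lborel k *\<^sub>R (f x - h n x))"
      by (simp add: sum_subtractf case_prod_unfold scaleR_diff_right)
    also have "\<dots> \<le> (\<Sum>(x,k)\<in>p. measure lborel k *\<^sub>R g n x)"
    proof (rule sum_norm_le, clarify)
      fix x k assume "(x, k) \<in> p"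
      then have "x \<in> cbox a b" using p(1) by (meson subsetD tag_in_interval)
      then show "norm (measure lborel k *\<^sub>R (f x - h n x)) \<le> measure lborel k *\<^sub>R g n x"
        using le by (simp add: mult_left_mono)
    qed
    also have "\<dots> < e / 3"
      using d2(2)[OF p(1) fine(2)] n unfolding real_norm_def by linarith
    finally have "norm ((\<Sum>(x,k)\<in>p. measure lborel k *\<^sub>R f x) - (\<Sum>(x,k)\<in>p. measure lborel k *\<^sub>R h n x)) < e / 3" .
    from norm_diff_triangle_less[OF this d1(2)[OF p(1) fine(1)]] show ?thesis by simp
  qed
  show "\<exists>\<gamma>. gauge \<gamma> \<and> (\<forall>D1 D2. D1 tagged_division_of cbox a b \<and> \<gamma> fine D1 \<and>
      D2 tagged_division_of cbox a b \<and> \<gamma> fine D2 \<longrightarrow>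
      norm ((\<Sum>(x,k)\<in>D1. measure lborel k *\<^sub>R f x) - (\<Sum>(x,k)\<in>D2. measure lborel k *\<^sub>R f x)) < e)"
  proof (intro exI[of _ "\<lambda>x. d1 x \<inter> d2 x"] conjI allI impI)
    show "gauge (\<lambda>x. d1 x \<inter> d2 x)" using d1 d2 by (auto simp: gauge_Int)
    fix D1 D2
    assume *: "D1 tagged_division_of cbox a b \<and> (\<lambda>x. d1 x \<inter> d2 x) fine D1 \<and>
      D2 tagged_division_of cbox a b \<and> (\<lambda>x. d1 x \<inter> d2 x) fine D2"
    have "norm ((\<Sum>(x,k)\<in>D1. measure lborel k *\<^sub>R f x) - integral (cbox a b) (h n)) < e / 2"
      "norm (integral (cbox a b) (h n) - (\<Sum>(x,k)\<in>D2. measure lborel k *\<^sub>R f x)) < e / 2"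
      using close * by (auto simp: norm_minus_commute)
    then show "norm ((\<Sum>(x,k)\<in>D1. measure lborel k *\<^sub>R f x) - (\<Sum>(x,k)\<in>D2. measure lborel k *\<^sub>R f x)) < e"
      using norm_diff_triangle_less[of _ _ "e / 2" _ "e / 2"] by simp
  qed
qed

text \<open>Away from a small interval around 0 the function is continuous on bounded intervals;
  what is cut off is bounded by \<open>g\<close> on a shrinking interval, whose integral tends to
  0.\<close>

lemma integrable_on_dominated_off_0:
  fixes f :: "real \<Rightarrow> 'b::banach"
  assumes cont: "continuous_on (- {0}) f" and le: "\<And>t. t \<noteq> 0 \<Longrightarrow> norm (f t) \<le> g t"
    and g: "g integrable_on UNIV"
  shows "f integrable_on UNIV"
proof -
  define f' where "f' t = (if t = 0 then 0 else f t)" for t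
  define g' where "g' t = (if t = 0 then 0 else g t)" for t
  have g': "g' integrable_on UNIV"
    using g by (rule integrable_spike[OF _ negligible_sing[of 0]]) (simp add: g'_def)
  have le': "norm (f' t) \<le> g' t" for t using le by (simp add: f'_def g'_def)
  have g'0: "g' t \<ge> 0" for t using le'[of t] norm_ge_zero order_trans by blast
  have "f' integrable_on cbox a b" for a b :: real
  proof (rule integrable_on_L1_limit)
    define A where "A n = {t::real. \<bar>t\<bar> \<ge> 1 / real (Suc n)}" for n
    define h where "h n t = (if t \<in> A n then f t else 0)" for n t
    define gg where "gg n t = (if t \<in> A n then 0 else g' t)" for n t
    have An: "cbox a b \<inter> A n = {a..min b (- (1 / real (Suc n)))} \<union> {max a (1 / real (Suc n))..b}" for n
      by (auto simp: A_def abs_if)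
    have sub: "{a..min b (- (1 / real (Suc n)))} \<subseteq> - {0}" "{max a (1 / real (Suc n))..b} \<subseteq> - {0}" for n
      by (auto simp: field_simps)
    have neg: "negligible ({a..min b (- (1 / real (Suc n)))} \<inter> {max a (1 / real (Suc n))..b})" for n
    proof -
      have "1 / real (Suc n) > 0" by simp
      then have "{a..min b (- (1 / real (Suc n)))} \<inter> {max a (1 / real (Suc n))..b} = {}"
        by (auto simp del: divide_less_0_iff zero_less_divide_iff)
      then show ?thesis by simp
    qed
    show "h n integrable_on cbox a b" for n
    proof -
      have "f integrable_on cbox a b \<inter> A n" unfolding An
        by (intro integrable_Un neg integrable_continuous_interval continuous_on_subset[OF cont] sub)
      then show ?thesis unfolding h_def
        by (subst integrable_restrict_Int) (simp add: Int_commute)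
    qed
    have g'ab: "g' integrable_on cbox a b" using g' integrable_on_subcbox by blast
    have Ag: "g' integrable_on cbox a b \<inter> A n" for n unfolding An
      by (intro integrable_Un neg integrable_on_subinterval[OF g']) auto
    have gg_eq: "gg n t = g' t - (if t \<in> A n then g' t else 0)" for n t by (simp add: gg_def)
    show ggi: "gg n integrable_on cbox a b" for n
      unfolding gg_eq[abs_def]
      by (intro integrable_diff g'ab) (subst integrable_restrict_Int, use Ag[of n] in \<open>simp add: Int_commute\<close>)
    show "norm (f' x - h n x) \<le> gg n x" for n x
      using le'[of x] g'0[of x] by (auto simp: h_def gg_def f'_def A_def)
    have "(\<lambda>n. integral (cbox a b) (gg n)) \<longlonglongrightarrow> integral (cbox a b) (\<lambda>_. 0)"
    proof (rule dominated_convergence(2)[OF ggi g'ab])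
      show "norm (gg n x) \<le> g' x" for n x using g'0[of x] by (auto simp: gg_def)
      show "(\<lambda>n. gg n x) \<longlonglongrightarrow> 0" for x
      proof (cases "x = 0")
        case False
        then obtain N where N: "1 / real (Suc N) < \<bar>x\<bar>" using nat_approx_posE[of "\<bar>x\<bar>"] by auto
        have "gg n x = 0" if "n \<ge> N" for n
        proof -
          have "1 / real (Suc n) \<le> 1 / real (Suc N)" using that by (simp add: frac_le)
          then show ?thesis using N by (auto simp: gg_def A_def)
        qed
        then show ?thesis by (intro tendsto_eventually) (auto simp: eventually_sequentially)
      qed (auto simp: gg_def g'_def cong: if_cong)
    qed
    then show "(\<lambda>n. integral (cbox a b) (gg n)) \<longlonglongrightarrow> 0" by simp
  qed
  then have "f' integrable_on UNIV"
    by (intro integrable_on_all_intervals_integrable_bound[OF _ le' g']) auto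
  then show ?thesis
    by (rule integrable_spike[OF _ negligible_sing[of 0]]) (simp add: f'_def)
qed

lemma has_integral_reflect_UNIV:
  fixes f :: "real \<Rightarrow> 'b::real_normed_vector"
  assumes "(f has_integral y) UNIV"
  shows "((\<lambda>t. f (- t)) has_integral y) UNIV"
proof -
  have nc: "\<not> (\<exists>a b. (UNIV :: real set) = cbox a b)"
    using not_compact_UNIV by (metis compact_cbox)
  show ?thesis
  proof (subst has_integral_alt, subst if_not_P[OF nc], intro allI impI)
    fix e :: real assume "e > 0"
    then obtain B where B: "B > 0" "\<forall>a b. ball 0 B \<subseteq> cbox a b \<longrightarrow>
      (\<exists>z. ((\<lambda>x. if x \<in> UNIV then f x else 0) has_integral z) (cbox a b) \<and> norm (z - y) < e)"
      using has_integral_altD[OF assms nc] by blast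
    show "\<exists>B>0. \<forall>a b. ball 0 B \<subseteq> cbox a b \<longrightarrow>
      (\<exists>z. ((\<lambda>t. if t \<in> UNIV then f (- t) else 0) has_integral z) (cbox a b) \<and> norm (z - y) < e)"
    proof (intro exI[of _ B] conjI B allI impI)
      fix a b :: real assume ab: "ball 0 B \<subseteq> cbox a b"
      have "x \<in> cbox (- b) (- a)" if "x \<in> ball 0 B" for x
      proof -
        have "- x \<in> ball 0 B" using that by simp
        then have "- x \<in> cbox a b" using ab by blast
        then show ?thesis by auto
      qed
      then have "ball 0 B \<subseteq> cbox (- b) (- a)" by blast
      from B(2)[rule_format, OF this]
      obtain z where z: "(f has_integral z) (cbox (- b) (- a))" "norm (z - y) < e" by auto
      then show "\<exists>z. ((\<lambda>t. if t \<in> UNIV then f (- t) else 0) has_integral z) (cbox a b) \<and> norm (z - y) < e"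
        using has_integral_reflect_lemma[OF z(1)] by auto
    qed
  qed
qed

lemma has_integral_even_extension:
  fixes f :: "real \<Rightarrow> 'b::banach"
  assumes "(f has_integral y) {0<..}"
  shows "((\<lambda>t. f \<bar>t\<bar>) has_integral (y + y)) UNIV"
proof -
  have 1: "((\<lambda>t. if t \<in> {0<..} then f t else 0) has_integral y) UNIV"
    using assms by (subst has_integral_restrict_UNIV)
  have 2: "((\<lambda>t. if - t \<in> {0<..} then f (- t) else 0) has_integral y) UNIV"
    using has_integral_reflect_UNIV[OF 1] .
  show ?thesis
    by (rule has_integral_spike[OF negligible_sing[of 0] _ has_integral_add[OF 1 2]]) auto
qed

text \<open>A resolvent identity turns local boundedness into continuity.\<close>

lemma continuous_on_resolvent_type:
  fixes X :: "'t::topological_space \<Rightarrow> 'a::real_normed_algebra"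
  assumes diff: "\<And>t u. t \<in> S \<Longrightarrow> u \<in> S \<Longrightarrow> X t - X u = X t * E t u"
    and bound: "\<And>t. t \<in> S \<Longrightarrow> norm (X t) \<le> b t" and b: "continuous_on S b"
    and lim: "\<And>u. ((\<lambda>t. norm (E t u)) \<longlongrightarrow> 0) (at u within S)"
  shows "continuous_on S X"
  unfolding continuous_on
proof
  fix u assume u: "u \<in> S"
  have "(b \<longlongrightarrow> b u) (at u within S)" using b u by (simp add: continuous_on)
  from tendsto_mult[OF this lim[of u]] have lim0: "((\<lambda>t. b t * norm (E t u)) \<longlongrightarrow> 0) (at u within S)" by simp
  have "norm (X t - X u) \<le> b t * norm (E t u)" if "t \<in> S" for t
    using norm_mult_ineq[of "X t" "E t u"] mult_right_mono[OF bound[OF that], of "norm (E t u)"]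
    by (simp add: diff[OF that u])
  then have ev: "\<forall>\<^sub>F t in at u within S. norm (X t - X u) \<le> b t * norm (E t u)"
    unfolding eventually_at_filter by (intro always_eventually) auto
  have "((\<lambda>t. X t - X u) \<longlongrightarrow> 0) (at u within S)"
    by (rule Lim_null_comparison[OF ev lim0])
  then show "(X \<longlongrightarrow> X u) (at u within S)" by (rule Lim_null[THEN iffD2])
qed

section \<open>Cauchy's formula on a sector\<close>

text \<open>For \<open>0 < \<theta>\<close> and \<open>\<theta> < pi / 2\<close> the inequality
  forces \<open>Re z > 0\<close>: this is the right half of the planar double sector, open and
  without its vertex.\<close>

definition wedge :: "real \<Rightarrow> complex set"
  where "wedge \<theta> = {z. \<bar>Im z\<bar> < tan \<theta> * Re z}"

text \<open>The function \<open>\<bar>Im z\<bar> - tan \<omega> * \<bar>Re z\<bar>\<close> is at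
  most 0 at \<open>\<mu>\<close>, changes by at most \<open>1 + tan \<omega>\<close> times the
  distance, and grows linearly along the rays of angle \<open>\<phi>\<close>. The quotient of the
  two rates is the constant \<open>c\<close>.\<close>

lemma ray_dist_bound:
  assumes \<omega>: "0 < \<omega>" "\<omega> < \<phi>" "\<phi> < pi / 2" and \<mu>: "\<bar>Im \<mu>\<bar> \<le> tan \<omega> * \<bar>Re \<mu>\<bar>"
  obtains c where "c > 0"
    "\<And>t. t \<ge> 0 \<Longrightarrow> norm (of_real t * cis \<phi> - \<mu>) \<ge> c * t"
    "\<And>t. t \<ge> 0 \<Longrightarrow> norm (of_real t * cis (- \<phi>) - \<mu>) \<ge> c * t"
proof -
  define \<delta> where "\<delta> = (sin \<phi> - tan \<omega> * cos \<phi>) / (1 + tan \<omega>)"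
  have tw: "tan \<omega> > 0" using \<omega> by (simp add: tan_gt_zero)
  have cp: "cos \<phi> > 0" "sin \<phi> > 0" using \<omega> by (auto intro: cos_gt_zero sin_gt_zero)
  have "tan \<omega> < tan \<phi>" using \<omega> by (intro tan_monotone) auto
  then have "tan \<omega> * cos \<phi> < sin \<phi>" using cp by (simp add: tan_def field_simps)
  then have d: "\<delta> > 0" using tw by (simp add: \<delta>_def)
  have main: "norm (z - \<mu>) \<ge> (\<bar>Im z\<bar> - tan \<omega> * \<bar>Re z\<bar>) / (1 + tan \<omega>)" for z
  proof -
    have "\<bar>Im z\<bar> - tan \<omega> * \<bar>Re z\<bar> \<le> \<bar>Im (z - \<mu>)\<bar> + tan \<omega> * (\<bar>Re \<mu>\<bar> - \<bar>Re z\<bar>)"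
      using \<mu> by (simp add: algebra_simps)
    also have "\<dots> \<le> norm (z - \<mu>) + tan \<omega> * norm (z - \<mu>)"
    proof (intro add_mono mult_left_mono abs_Im_le_cmod)
      show "\<bar>Re \<mu>\<bar> - \<bar>Re z\<bar> \<le> norm (z - \<mu>)" using abs_Re_le_cmod[of "z - \<mu>"] by simp
    qed (use tw in auto)
    also have "\<dots> = (1 + tan \<omega>) * norm (z - \<mu>)" by (simp add: algebra_simps)
    finally show ?thesis using tw by (simp add: divide_simps mult.commute)
  qed
  have "norm (of_real t * cis \<phi> - \<mu>) \<ge> \<delta> * t" "norm (of_real t * cis (- \<phi>) - \<mu>) \<ge> \<delta> * t" if "t \<ge> 0" for t
    using main[of "of_real t * cis \<phi>"] main[of "of_real t * cis (- \<phi>)"] that cp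
    by (simp_all add: \<delta>_def abs_mult algebra_simps diff_divide_distrib)
  then show ?thesis using that d by blast
qed

lemma contour_integral_ray:
  assumes R: "R > 0" and G: "continuous_on (closed_segment 0 (of_real R * cis \<psi>)) G"
  shows "((\<lambda>t. cis \<psi> * G (of_real t * cis \<psi>)) has_integral
    contour_integral (linepath 0 (of_real R * cis \<psi>)) G) {0..R}"
proof -
  let ?a = "of_real R * cis \<psi>"
  let ?I = "contour_integral (linepath 0 ?a) G"
  have "(G has_contour_integral ?I) (linepath 0 ?a)"
    using G by (intro has_contour_integral_integral contour_integrable_continuous_linepath)
  then have "((\<lambda>x. G (of_real x * ?a) * ?a) has_integral ?I) (cbox 0 1)"
    unfolding has_contour_integral_linepath by (simp add: linepath_def scaleR_conv_of_real)
  from has_integral_affinity'[OF this, of "1 / R" 0] R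
  have "((\<lambda>t. G (of_real t * cis \<psi>) * ?a) has_integral R *\<^sub>R ?I) {0..R}"
    by (simp add: field_simps)
  from has_integral_cmul[OF this, of "1 / R"] R show ?thesis
    by (simp add: scaleR_conv_of_real field_simps)
qed

lemma wedge_triangle_interior:
  assumes \<phi>: "0 < \<phi>" "\<phi> < pi / 2" and R: "R > 0" and z: "z \<in> wedge \<phi>" "Re z < R * cos \<phi>"
  shows "z \<in> interior (convex hull {0, of_real R * cis (- \<phi>), of_real R * cis \<phi>})"
proof -
  have cp: "cos \<phi> > 0" "sin \<phi> > 0" using \<phi> by (auto intro: cos_gt_zero sin_gt_zero)
  define U where "U = wedge \<phi> \<inter> {z. Re z < R * cos \<phi>}"
  have "open U" unfolding U_def wedge_def
    by (intro open_Int open_Collect_less continuous_intros)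
  moreover have "U \<subseteq> convex hull {0, of_real R * cis (- \<phi>), of_real R * cis \<phi>}"
  proof
    fix w assume "w \<in> U"
    then have w: "\<bar>Im w\<bar> * cos \<phi> < sin \<phi> * Re w" "Re w < R * cos \<phi>"
      using cp by (auto simp: U_def wedge_def tan_def field_simps)
    \<comment> \<open>The barycentric coordinates of the two outer vertices, solved from
      \<open>Re w = (\<alpha> + \<beta>) * R * cos \<phi>\<close> and
      \<open>Im w = (\<beta> - \<alpha>) * R * sin \<phi>\<close>.\<close>
    define \<alpha> where "\<alpha> = (Re w / cos \<phi> - Im w / sin \<phi>) / (2 * R)"
    define \<beta> where "\<beta> = (Re w / cos \<phi> + Im w / sin \<phi>) / (2 * R)"
    have "Im w * cos \<phi> \<le> \<bar>Im w\<bar> * cos \<phi>" "- Im w * cos \<phi> \<le> \<bar>Im w\<bar> * cos \<phi>"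
      by (rule mult_right_mono; use cp in simp)+
    then have "Im w * cos \<phi> \<le> sin \<phi> * Re w" "- Im w * cos \<phi> \<le> sin \<phi> * Re w"
      using w(1) by linarith+
    then have "\<alpha> \<ge> 0" "\<beta> \<ge> 0" using w cp R by (auto simp: \<alpha>_def \<beta>_def field_simps)
    moreover have ab: "\<alpha> + \<beta> = Re w / (R * cos \<phi>)" using R cp by (simp add: \<alpha>_def \<beta>_def field_simps)
    moreover have "Re w / (R * cos \<phi>) \<le> 1" using w R cp by (simp add: field_simps)
    moreover have "w = (1 - \<alpha> - \<beta>) *\<^sub>R 0 + \<alpha> *\<^sub>R (of_real R * cis (- \<phi>)) + \<beta> *\<^sub>R (of_real R * cis \<phi>)"
      using R cp by (simp add: complex_eq_iff \<alpha>_def \<beta>_def field_simps)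
    ultimately show "w \<in> convex hull {0, of_real R * cis (- \<phi>), of_real R * cis \<phi>}"
      unfolding convex_hull_3 by (intro CollectI exI[of _ "1 - \<alpha> - \<beta>"] exI[of _ \<alpha>] exI[of _ \<beta>]) auto
  qed
  ultimately show ?thesis using z interior_maximal unfolding U_def by blast
qed

text \<open>Outward along the lower edge of the wedge and back along the upper one, i.e. its
  positively oriented boundary, with both edges sharing the parameter \<open>t\<close>.\<close>

definition ray_difference :: "real \<Rightarrow> (complex \<Rightarrow> complex) \<Rightarrow> real \<Rightarrow> complex"
  where "ray_difference \<phi> G t = cis (- \<phi>) * G (of_real t * cis (- \<phi>)) - cis \<phi> * G (of_real t * cis \<phi>)"

text \<open>The wedge is cut off by the vertical line through \<open>R cis \<phi>\<close>. This
  third side of the triangle has length at most \<open>2 * R\<close> and distance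
  \<open>R * cos \<phi>\<close> from 0, so quadratic decay makes its contribution of order 1/R;
  domination by \<open>g\<close> then turns the limit of the truncated rays into an integral over
  the half-line.\<close>

lemma wedge_boundary_integral:
  assumes \<phi>: "0 < \<phi>" "\<phi> < pi / 2"
    and cont: "\<And>R. R > 0 \<Longrightarrow> continuous_on (closed_segment 0 (of_real R * cis (- \<phi>))) G"
      "\<And>R. R > 0 \<Longrightarrow> continuous_on (closed_segment 0 (of_real R * cis \<phi>)) G"
      "\<And>R. R \<ge> R0 \<Longrightarrow> continuous_on (closed_segment (of_real R * cis (- \<phi>)) (of_real R * cis \<phi>)) G"
    and decay: "\<And>z. \<bar>Im z\<bar> \<le> tan \<phi> * Re z \<Longrightarrow> norm z \<ge> R0 \<Longrightarrow> norm (G z) \<le> K / (norm z)\<^sup>2"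
    and triangle: "\<And>R. R > R0 \<Longrightarrow> (G has_contour_integral c)
      (linepath 0 (of_real R * cis (- \<phi>)) +++ linepath (of_real R * cis (- \<phi>)) (of_real R * cis \<phi>)
       +++ linepath (of_real R * cis \<phi>) 0)"
    and g: "g integrable_on {0<..}"
      "\<And>t. t > 0 \<Longrightarrow> norm (ray_difference \<phi> G t) \<le> g t"
  shows "(ray_difference \<phi> G has_integral c) {0<..}"
proof -
  define q where "q = ray_difference \<phi> G"
  have cp: "cos \<phi> > 0" "sin \<phi> > 0" using \<phi> by (auto intro: cos_gt_zero sin_gt_zero)
  define E where "E R = contour_integral (linepath (of_real R * cis (- \<phi>)) (of_real R * cis \<phi>)) G" for R
  \<comment> \<open>\<open>R0 / cos \<phi>\<close> keeps the vertical side, whose abscissa is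
    \<open>R * cos \<phi>\<close>, in the region where \<open>decay\<close> applies;
    \<open>R0 + 1\<close> makes \<open>R > R0\<close> strict.\<close>
  define R1 where "R1 = max 1 (max (R0 + 1) (R0 / cos \<phi>))"
  have q_int: "(q has_integral (c - E R)) {0..R}" if R: "R \<ge> R1" for R
  proof -
    have R': "R > 0" "R > R0" using R by (auto simp: R1_def)
    let ?a = "of_real R * cis (- \<phi>)" and ?b = "of_real R * cis \<phi>"
    have "contour_integral (linepath 0 ?a) G + contour_integral (linepath ?a ?b) G + contour_integral (linepath ?b 0) G = c"
      using triangle[OF R'(2)] by (rule has_chain_integral_chain_integral3)
    moreover have "contour_integral (linepath ?b 0) G = - contour_integral (linepath 0 ?b) G"
      using contour_integral_reverse_linepath[OF cont(2)[OF R'(1)]] by simp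
    ultimately have "contour_integral (linepath 0 ?a) G - contour_integral (linepath 0 ?b) G = c - E R"
      by (simp add: E_def algebra_simps)
    then show ?thesis
      using has_integral_diff[OF contour_integral_ray[OF R'(1) cont(1)[OF R'(1)]] contour_integral_ray[OF R'(1) cont(2)[OF R'(1)]]]
      by (simp add: q_def ray_difference_def[abs_def])
  qed
  have K0: "K \<ge> 0"
  proof -
    define z where "z = complex_of_real (max R0 1)"
    have "norm (G z) \<le> K / (norm z)\<^sup>2"
      by (rule decay) (use \<phi> in \<open>auto simp: z_def tan_gt_zero less_imp_le\<close>)
    moreover have "norm z > 0" by (simp add: z_def)
    ultimately show ?thesis using norm_ge_zero[of "G z"]
      by (metis divide_less_0_iff not_less order_trans zero_less_power)
  qed
  have E_bound: "norm (E R) \<le> (2 * K / (cos \<phi>)\<^sup>2) / R" if R: "R \<ge> R1" for R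
  proof -
    have R': "R > 0" "R \<ge> R0" "R \<ge> R0 / cos \<phi>" using R by (auto simp: R1_def)
    let ?a = "of_real R * cis (- \<phi>)" and ?b = "of_real R * cis \<phi>"
    have "norm (E R) \<le> K / (R * cos \<phi>)\<^sup>2 * norm (?b - ?a)"
      unfolding E_def
    proof (rule contour_integral_bound_linepath)
      show "G contour_integrable_on linepath ?a ?b"
        by (rule contour_integrable_continuous_linepath[OF cont(3)[OF R'(2)]])
      fix z assume "z \<in> closed_segment ?a ?b"
      then obtain u where u: "0 \<le> u" "u \<le> 1" "z = (1 - u) *\<^sub>R ?a + u *\<^sub>R ?b"
        unfolding closed_segment_def by auto
      have re: "Re z = R * cos \<phi>" and im: "Im z = (2 * u - 1) * (R * sin \<phi>)"
        by (simp_all add: u algebra_simps)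
      have "\<bar>2 * u - 1\<bar> * (R * sin \<phi>) \<le> 1 * (R * sin \<phi>)"
        using u R' cp by (intro mult_right_mono) auto
      then have "\<bar>Im z\<bar> \<le> tan \<phi> * Re z"
        using R' cp by (simp add: im re abs_mult tan_def)
      moreover have nz: "norm z \<ge> R * cos \<phi>" using complex_Re_le_cmod[of z] re by simp
      moreover have "R * cos \<phi> \<ge> R0" using R'(3) cp by (simp add: field_simps)
      ultimately have "norm (G z) \<le> K / (norm z)\<^sup>2" by (intro decay) auto
      also have "\<dots> \<le> K / (R * cos \<phi>)\<^sup>2"
      proof -
        have "R * cos \<phi> > 0" using R' cp by simp
        moreover from this have "norm z > 0" using nz by linarith
        ultimately show ?thesis using nz K0
          by (intro frac_le power_mono zero_less_power) linarith+
      qed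
      finally show "norm (G z) \<le> K / (R * cos \<phi>)\<^sup>2" .
    qed (use K0 in auto)
    also have "norm (?b - ?a) \<le> 2 * R"
      using norm_triangle_ineq4[of ?b ?a] R' by (simp add: norm_mult)
    then have "K / (R * cos \<phi>)\<^sup>2 * norm (?b - ?a) \<le> K / (R * cos \<phi>)\<^sup>2 * (2 * R)"
      using K0 by (intro mult_left_mono) auto
    also have "\<dots> = (2 * K / (cos \<phi>)\<^sup>2) / R" using R' cp by (simp add: power2_eq_square field_simps)
    finally show ?thesis by simp
  qed
  have E_lim: "(\<lambda>n. E (real n)) \<longlonglongrightarrow> 0"
  proof (rule Lim_null_comparison)
    show "(\<lambda>n. (2 * K / (cos \<phi>)\<^sup>2) / real n) \<longlonglongrightarrow> 0" by (rule lim_const_over_n)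
    obtain N where N: "real N \<ge> R1" using real_arch_simple by blast
    show "\<forall>\<^sub>F n in sequentially. norm (E (real n)) \<le> (2 * K / (cos \<phi>)\<^sup>2) / real n"
      using E_bound N unfolding eventually_sequentially
      by (intro exI[of _ N] allI impI E_bound) (meson of_nat_le_iff order_trans)
  qed
  obtain N where N: "real N \<ge> R1" using real_arch_simple by blast
  \<comment> \<open>The shift by \<open>N\<close> makes every truncation radius at least
    \<open>R1\<close>.\<close>
  define f where "f n t = (if t \<in> {0..real (n + N)} then q t else 0)" for n :: nat and t
  have fint: "(f n has_integral (c - E (real (n + N)))) {0<..}" for n
  proof -
    have "real (n + N) \<ge> R1" using N by simp
    from q_int[OF this] have "(q has_integral (c - E (real (n + N)))) ({0..real (n + N)} \<inter> {0<..})"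
      by (rule has_integral_spike_set_eq[THEN iffD1, rotated -1])
        (auto intro!: negligible_subset[OF negligible_sing[of 0]])
    then show ?thesis unfolding f_def has_integral_restrict_Int .
  qed
  have f_le: "norm (f n x) \<le> g x" if "x \<in> {0<..}" for n x
  proof -
    have "norm (q x) \<le> g x" using g(2)[of x] that by (simp add: q_def)
    moreover have "0 \<le> g x" using calculation norm_ge_zero order_trans by blast
    ultimately show ?thesis by (auto simp: f_def)
  qed
  have f_lim: "(\<lambda>n. f n x) \<longlonglongrightarrow> q x" if x: "x \<in> {0<..}" for x
  proof (rule tendsto_eventually)
    obtain M where "real M \<ge> x" using real_arch_simple by blast
    then show "\<forall>\<^sub>F n in sequentially. f n x = q x"
      using x unfolding eventually_sequentially f_def by (intro exI[of _ M]) auto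
  qed
  note dc = dominated_convergence[of f "{0<..}" g q, OF has_integral_integrable[OF fint] g(1) f_le f_lim]
  have "q integrable_on {0<..}" "(\<lambda>n. integral {0<..} (f n)) \<longlonglongrightarrow> integral {0<..} q"
    using dc by blast+
  moreover have "(\<lambda>n. integral {0<..} (f n)) \<longlonglongrightarrow> c - 0"
    unfolding integral_unique[OF fint]
    by (intro tendsto_diff tendsto_const LIMSEQ_ignore_initial_segment E_lim)
  ultimately have "integral {0<..} q = c" using LIMSEQ_unique by fastforce
  then show ?thesis using \<open>q integrable_on {0<..}\<close> integrable_integral unfolding q_def by blast
qed

section \<open>Regularization at the vertex and at infinity\<close>

lemma norm_add_of_real_ge:
  assumes "Re z \<ge> 0" "a \<ge> 0"
  shows "norm z \<le> norm (z + of_real a)" "a \<le> norm (z + of_real a)"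
proof -
  show "norm z \<le> norm (z + of_real a)"
    unfolding cmod_def using assms by (auto intro!: real_sqrt_le_mono power_mono)
  show "a \<le> norm (z + of_real a)" using complex_Re_le_cmod[of "z + of_real a"] assms by simp
qed

text \<open>
  Nothing is known about the decay of \<open>h\<close> along the arcs at \<open>0\<close> and \<open>\<infinity>\<close>; multiplication with the
  square of the following function, which converges boundedly to \<open>1\<close> as \<open>e \<rightarrow> 0\<close>, provides it.
\<close>

definition regularizer :: "real \<Rightarrow> complex \<Rightarrow> complex"
  where "regularizer e z = z / ((z + of_real e) * (of_real e * z + 1))"

text \<open>The first bound yields domination uniform in \<open>e\<close>, the second vanishing at
  0, the third decay at infinity.\<close>

lemma regularizer_bounds:
  assumes "Re z \<ge> 0" "e > 0"
  shows "norm (regularizer e z) \<le> 1" "norm (regularizer e z) \<le> norm z / e"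
    "norm (regularizer e z) \<le> 1 / (e * norm z)"
proof -
  have 1: "norm z \<le> norm (z + of_real e)" "e \<le> norm (z + of_real e)"
    using norm_add_of_real_ge[of z e] assms by auto
  have 2: "e * norm z \<le> norm (of_real e * z + 1)" "1 \<le> norm (of_real e * z + 1)"
    using norm_add_of_real_ge[of "of_real e * z" 1] assms by (auto simp: norm_mult)
  define p where "p = norm (z + of_real e)"
  define w where "w = norm (of_real e * z + 1)"
  have pw: "p > 0" "w > 0" "norm z \<le> p" "e \<le> p" "e * norm z \<le> w" "1 \<le> w"
    using 1 2 assms by (auto simp: p_def w_def)
  have n: "norm (regularizer e z) = norm z / p * (1 / w)"
    by (simp add: regularizer_def norm_divide norm_mult p_def w_def)
  have a: "norm z / p \<le> 1" "1 / w \<le> 1" using pw by auto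
  show "norm (regularizer e z) \<le> 1" unfolding n using mult_mono[OF a] pw by simp
  have "norm z / p \<le> norm z / e" using pw assms by (intro divide_left_mono) auto
  from mult_mono[OF this a(2)] show "norm (regularizer e z) \<le> norm z / e" unfolding n using pw assms by simp
  show "norm (regularizer e z) \<le> 1 / (e * norm z)"
  proof (cases "z = 0")
    case False
    then have "1 / w \<le> 1 / (e * norm z)" using pw assms by (intro divide_left_mono) auto
    from mult_mono[OF a(1) this] show ?thesis unfolding n using pw assms by simp
  qed (simp add: regularizer_def)
qed

lemma regularizer_tendsto:
  assumes "Re z \<ge> 0" "z \<noteq> 0"
  shows "(\<lambda>n. regularizer (1 / real (Suc n)) z) \<longlonglongrightarrow> 1"
proof -
  define x where "x n = 1 / real (Suc n)" for n
  have "x \<longlonglongrightarrow> 0" unfolding x_def using LIMSEQ_inverse_real_of_nat by (simp add: inverse_eq_divide)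
  then have "(\<lambda>n. regularizer (x n) z) \<longlonglongrightarrow> z / ((z + of_real 0) * (of_real 0 * z + 1))"
    unfolding regularizer_def using assms by (intro tendsto_intros) auto
  then show ?thesis using assms by (simp add: x_def)
qed

text \<open>The regularized functions \<open>F n\<close> are continuous at the vertex and decay, so
  the triangle formula applies to them; the bound \<open>g\<close> does not depend on
  \<open>n\<close>, and both sides pass to the limit. For \<open>Re \<mu> \<le> 0\<close> the pole
  lies in the left half of the sector or at the vertex itself, and there is no residue.\<close>

lemma wedge_Cauchy:
  fixes h :: "complex \<Rightarrow> complex"
  assumes \<omega>: "0 < \<omega>" "\<omega> < \<phi>" "\<phi> < \<theta>" "\<theta> < pi / 2"
    and hol: "h holomorphic_on wedge \<theta>" and bnd: "\<And>z. z \<in> wedge \<theta> \<Longrightarrow> norm (h z) \<le> B"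
    and int: "(\<lambda>t. norm (h (of_real t * cis (- \<phi>))) / t) integrable_on {0<..}"
      "(\<lambda>t. norm (h (of_real t * cis \<phi>)) / t) integrable_on {0<..}"
    and \<mu>: "\<bar>Im \<mu>\<bar> \<le> tan \<omega> * \<bar>Re \<mu>\<bar>"
  shows "(ray_difference \<phi> (\<lambda>z. h z / (z - \<mu>)) has_integral (if Re \<mu> > 0 then 2 * pi * \<i> * h \<mu> else 0)) {0<..}"
proof -
  have \<phi>: "0 < \<phi>" "\<phi> < pi / 2" using \<omega> by auto
  have cp: "cos \<phi> > 0" "sin \<phi> > 0" using \<phi> by (auto intro: cos_gt_zero sin_gt_zero)
  define k where "k = tan \<phi>"
  have k0: "k > 0" using \<phi> by (simp add: k_def tan_gt_zero)
  have kt: "tan \<omega> < k" "k < tan \<theta>" unfolding k_def using \<omega> by (auto intro!: tan_monotone)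
  have B0: "B \<ge> 0" using bnd[of 1] kt k0 by (auto simp: wedge_def intro: order_trans[OF norm_ge_zero])
  define C where "C = {z. \<bar>Im z\<bar> \<le> k * Re z}"
  have C_eq: "C = {z. inner (Complex (- k) 1) z \<le> 0} \<inter> {z. inner (Complex (- k) (- 1)) z \<le> 0}"
    by (auto simp: C_def inner_complex_def abs_le_iff)
  have convC: "convex C" unfolding C_eq by (intro convex_Int convex_halfspace_le)
  have Re0: "Re z \<ge> 0" if "z \<in> C" for z
    using that k0 unfolding C_def by (metis abs_ge_zero mem_Collect_eq order_trans zero_le_mult_iff not_le order_less_imp_le)
  have Re_pos: "Re z > 0" if "z \<in> C" "z \<noteq> 0" for z
    using that Re0[OF that(1)] by (cases "Re z = 0") (auto simp: C_def complex_eq_iff)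
  have C_wedge: "z \<in> wedge \<theta>" if "z \<in> C" "z \<noteq> 0" for z
    using that(1) mult_strict_right_mono[OF kt(2) Re_pos[OF that]] unfolding C_def wedge_def mem_Collect_eq
    by linarith
  have Re_norm: "cos \<phi> * norm z \<le> Re z" if "z \<in> C" for z
  proof (rule power2_le_imp_le)
    have "\<bar>Im z\<bar>\<^sup>2 \<le> (k * Re z)\<^sup>2" using that by (intro power_mono) (auto simp: C_def)
    then have "(cos \<phi>)\<^sup>2 * (Im z)\<^sup>2 \<le> (sin \<phi>)\<^sup>2 * (Re z)\<^sup>2"
      using cp by (simp add: k_def tan_def power_mult_distrib power_divide field_simps)
    then have "(cos \<phi>)\<^sup>2 * ((Re z)\<^sup>2 + (Im z)\<^sup>2) \<le> (Re z)\<^sup>2"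
      by (simp add: algebra_simps sin_squared_eq)
    then show "(cos \<phi> * norm z)\<^sup>2 \<le> (Re z)\<^sup>2"
      by (simp add: power_mult_distrib cmod_power2)
  qed (rule Re0[OF that])
  have ray: "of_real t * cis (- \<phi>) \<in> C" "of_real t * cis \<phi> \<in> C" if "t \<ge> 0" for t
    using that cp by (auto simp: C_def k_def tan_def abs_mult)
  obtain c where c: "c > 0" "\<And>t. t \<ge> 0 \<Longrightarrow> norm (of_real t * cis \<phi> - \<mu>) \<ge> c * t"
    "\<And>t. t \<ge> 0 \<Longrightarrow> norm (of_real t * cis (- \<phi>) - \<mu>) \<ge> c * t"
    using ray_dist_bound[OF \<omega>(1,2) \<phi>(2) \<mu>] by blast
  \<comment> \<open>\<open>2 * norm \<mu>\<close> gives
    \<open>norm (z - \<mu>) \<ge> norm z / 2\<close> for \<open>norm z \<ge> R0\<close>, and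
    \<open>norm \<mu> / cos \<phi>\<close> keeps the vertical side to the right of
    \<open>\<mu>\<close>, strictly because of the summand 1.\<close>
  define R0 where "R0 = 2 * norm \<mu> + 1 + norm \<mu> / cos \<phi>"
  have R0: "R0 \<ge> 1" "R0 \<ge> 2 * norm \<mu>" "R0 * cos \<phi> > Re \<mu>"
  proof -
    have "(2 * norm \<mu> + 1) * cos \<phi> > 0" using cp by (intro mult_pos_pos) (auto intro: add_nonneg_pos)
    then show "R0 * cos \<phi> > Re \<mu>" using cp complex_Re_le_cmod[of \<mu>] by (simp add: R0_def algebra_simps)
  qed (use cp in \<open>auto simp: R0_def\<close>)
  \<comment> \<open>Dominates all regularized integrands: the regularizer has modulus at most 1 and
    the rays keep distance \<open>c * t\<close> from \<open>\<mu>\<close>.\<close>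
  define g where "g t = (norm (h (of_real t * cis (- \<phi>))) / t + norm (h (of_real t * cis \<phi>)) / t) / c" for t
  have g: "g integrable_on {0<..}" unfolding g_def by (intro integrable_on_divide integrable_add int)
  \<comment> \<open>For \<open>Re \<mu> \<le> 0\<close> no point is removed, although
    \<open>\<mu> = 0\<close> lies on the segment: the regularized quotient is continuous there as
    well.\<close>
  have seg0: "closed_segment 0 (of_real R * cis \<psi>) \<subseteq> C - (if Re \<mu> > 0 then {\<mu>} else {})"
    if R: "R > 0" and \<psi>: "\<psi> \<in> {\<phi>, - \<phi>}" for R \<psi>
  proof
    fix z assume "z \<in> closed_segment 0 (of_real R * cis \<psi>)"
    then obtain u where u: "0 \<le> u" "u \<le> 1" "z = u *\<^sub>R (of_real R * cis \<psi>)" unfolding closed_segment_def by auto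
    then have z: "z = of_real (u * R) * cis \<psi>" "u * R \<ge> 0" using R by (auto simp: scaleR_conv_of_real)
    have "z \<noteq> \<mu>" if "Re \<mu> > 0"
    proof
      assume "z = \<mu>"
      then have "c * (u * R) \<le> 0" using c(2,3)[OF z(2)] \<psi> z(1) by auto
      then have "u * R \<le> 0" using c(1) by (meson mult_pos_pos not_le)
      then have "u * R = 0" using z(2) by (rule antisym)
      then show False using \<open>z = \<mu>\<close> z(1) that by auto
    qed
    then show "z \<in> C - (if Re \<mu> > 0 then {\<mu>} else {})" using ray[OF z(2)] \<psi> z(1) by auto
  qed
  have seg1: "closed_segment (of_real R * cis (- \<phi>)) (of_real R * cis \<phi>) \<subseteq> C - {\<mu>}" if R: "R \<ge> R0" for R
  proof
    fix z assume z: "z \<in> closed_segment (of_real R * cis (- \<phi>)) (of_real R * cis \<phi>)"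
    then obtain u where u: "z = (1 - u) *\<^sub>R (of_real R * cis (- \<phi>)) + u *\<^sub>R (of_real R * cis \<phi>)"
      unfolding closed_segment_def by auto
    have "Re z = R * cos \<phi>" by (simp add: u algebra_simps)
    moreover have "R0 * cos \<phi> \<le> R * cos \<phi>" using R cp by (intro mult_right_mono) auto
    ultimately have "z \<noteq> \<mu>" using R0(3) by auto
    moreover have "z \<in> C"
      using closed_segment_subset[OF ray[of R] convC] z R R0(1) by auto
    ultimately show "z \<in> C - {\<mu>}" by simp
  qed
  \<comment> \<open>The square matters at the vertex: if \<open>\<mu> = 0\<close>, the denominator
    takes away one factor \<open>z\<close>, and the quotient still has to tend to 0.\<close>
  define F where "F n z = h z * (regularizer (1 / real (Suc n)) z)\<^sup>2" for n z
  define cn where "cn n = (if Re \<mu> > 0 then 2 * pi * \<i> * F n \<mu> else 0)" for n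
  have main: "(ray_difference \<phi> (\<lambda>z. F n z / (z - \<mu>)) has_integral cn n) {0<..}"
    and q_le: "t > 0 \<Longrightarrow> norm (ray_difference \<phi> (\<lambda>z. F n z / (z - \<mu>)) t) \<le> g t" for n t
  proof -
    define e where "e = 1 / real (Suc n)"
    have e: "e > 0" by (simp add: e_def)
    define G where "G z = F n z / (z - \<mu>)" for z
    have F_h: "norm (F n z) \<le> norm (h z)" if "z \<in> C" for z
    proof -
      have "(norm (regularizer e z))\<^sup>2 \<le> 1"
        using regularizer_bounds(1)[OF Re0[OF that] e] by (simp add: power_le_one)
      then show ?thesis unfolding F_def e_def[symmetric]
        by (simp add: norm_mult norm_power mult_left_le)
    qed
    have F0: "F n 0 = 0" by (simp add: F_def regularizer_def)
    have F_small: "norm (F n z) \<le> B / e\<^sup>2 * (norm z)\<^sup>2" if "z \<in> C" for z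
    proof (cases "z = 0")
      case False
      have "norm (F n z) \<le> B * (norm z / e)\<^sup>2"
        unfolding F_def e_def[symmetric] norm_mult norm_power
        using regularizer_bounds(2)[OF Re0[OF that] e] bnd[OF C_wedge[OF that False]] B0
        by (intro mult_mono power_mono) auto
      then show ?thesis by (simp add: power_divide)
    qed (simp add: F0)
    have den: "z + of_real e \<noteq> 0" "of_real e * z + 1 \<noteq> 0" if "Re z \<ge> 0" for z
      using that e norm_add_of_real_ge(2)[of z e] norm_add_of_real_ge(2)[of "of_real e * z" 1] by auto
    have openc: "open (wedge \<theta>)" unfolding wedge_def by (intro open_Collect_less continuous_intros)
    have F_diff: "F n field_differentiable (at z)" if "z \<in> C" "z \<noteq> 0" for z
    proof -
      have "h field_differentiable (at z)"
        using hol openc C_wedge[OF that] by (simp add: holomorphic_on_imp_differentiable_at)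
      then show ?thesis unfolding F_def[abs_def] regularizer_def e_def[symmetric]
        using den[OF Re0[OF that(1)]] by (intro derivative_intros) auto
    qed
    have F_cont: "continuous_on C (F n)"
      unfolding continuous_on_eq_continuous_within
    proof
      fix z assume z: "z \<in> C"
      show "continuous (at z within C) (F n)"
      proof (cases "z = 0")
        case False
        then show ?thesis using F_diff[OF z]
          by (simp add: continuous_at_imp_continuous_at_within field_differentiable_imp_continuous_at)
      next
        case True
        have "((\<lambda>z. B / e\<^sup>2 * (norm z)\<^sup>2) \<longlongrightarrow> B / e\<^sup>2 * (norm (0::complex))\<^sup>2) (at 0 within C)"
          by (intro tendsto_intros)
        moreover have "\<forall>\<^sub>F z in at 0 within C. norm (F n z) \<le> B / e\<^sup>2 * (norm z)\<^sup>2"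
          unfolding eventually_at_filter by (intro always_eventually allI impI F_small)
        ultimately have "(F n \<longlongrightarrow> 0) (at 0 within C)"
          using Lim_null_comparison by force
        then show ?thesis by (simp add: continuous_within True F0)
      qed
    qed
    have G_cont: "continuous_on (C - (if Re \<mu> > 0 then {\<mu>} else {})) G"
    proof (cases "Re \<mu> > 0")
      case True
      then show ?thesis unfolding G_def[abs_def]
        by (intro continuous_intros continuous_on_subset[OF F_cont]) auto
    next
      case False
      have "continuous (at z within C) G" if z: "z \<in> C" for z
      proof (cases "z = 0")
        case False
        then have "z \<noteq> \<mu>" using Re_pos[OF z] \<open>\<not> Re \<mu> > 0\<close> by auto
        then show ?thesis unfolding G_def[abs_def] using F_cont z
          by (intro continuous_intros) (auto simp: continuous_on_eq_continuous_within)
      next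
        case True
        have G_small: "norm (G z) \<le> B / e\<^sup>2 / cos \<phi> * norm z" if z: "z \<in> C" for z
        proof (cases "z = 0")
          case zn: False
          have "cos \<phi> * norm z \<le> Re z - Re \<mu>" using Re_norm[OF z] False by simp
          also have "\<dots> \<le> norm (z - \<mu>)" using complex_Re_le_cmod[of "z - \<mu>"] by simp
          finally have "norm (G z) \<le> B / e\<^sup>2 * (norm z)\<^sup>2 / (cos \<phi> * norm z)"
            unfolding G_def norm_divide using F_small[OF z] B0 zn cp
            by (intro frac_le) auto
          then show ?thesis using zn cp by (simp add: power2_eq_square)
        qed (simp add: G_def F0)
        have "((\<lambda>z. B / e\<^sup>2 / cos \<phi> * norm z) \<longlongrightarrow> B / e\<^sup>2 / cos \<phi> * norm (0::complex)) (at 0 within C)"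
          by (intro tendsto_intros)
        moreover have "\<forall>\<^sub>F z in at 0 within C. norm (G z) \<le> B / e\<^sup>2 / cos \<phi> * norm z"
          unfolding eventually_at_filter by (intro always_eventually allI impI G_small)
        ultimately have "(G \<longlongrightarrow> 0) (at 0 within C)"
          using Lim_null_comparison by force
        then show ?thesis by (simp add: continuous_within True G_def F0)
      qed
      then show ?thesis using False by (simp add: continuous_on_eq_continuous_within)
    qed
    have q_le': "norm (ray_difference \<phi> G t) \<le> g t" if t: "t > 0" for t
    proof -
      have "norm (G (of_real t * cis (- \<phi>))) \<le> norm (h (of_real t * cis (- \<phi>))) / (c * t)"
        "norm (G (of_real t * cis \<phi>)) \<le> norm (h (of_real t * cis \<phi>)) / (c * t)"
        unfolding G_def norm_divide using F_h ray[of t] c t by (intro frac_le; simp)+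
      then have "norm (ray_difference \<phi> G t)
        \<le> norm (h (of_real t * cis (- \<phi>))) / (c * t) + norm (h (of_real t * cis \<phi>)) / (c * t)"
        unfolding ray_difference_def by (intro order_trans[OF norm_triangle_ineq4]) (simp add: norm_mult)
      also have "\<dots> = g t" using t c by (simp add: g_def field_simps)
      finally show ?thesis .
    qed
    then show "t > 0 \<Longrightarrow> norm (ray_difference \<phi> (\<lambda>z. F n z / (z - \<mu>)) t) \<le> g t" by (simp add: G_def[abs_def])
    have "(ray_difference \<phi> G has_integral cn n) {0<..}"
    proof (rule wedge_boundary_integral[OF \<phi>, where ?R0.0=R0 and K="2 * B / e" and g=g])
      show "continuous_on (closed_segment 0 (of_real R * cis (- \<phi>))) G" if "R > 0" for R
        by (rule continuous_on_subset[OF G_cont seg0[OF that]]) simp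
      show "continuous_on (closed_segment 0 (of_real R * cis \<phi>)) G" if "R > 0" for R
        by (rule continuous_on_subset[OF G_cont seg0[OF that]]) simp
      show "continuous_on (closed_segment (of_real R * cis (- \<phi>)) (of_real R * cis \<phi>)) G" if "R \<ge> R0" for R
        by (rule continuous_on_subset[OF G_cont]) (use seg1[OF that] in auto)
      show "norm (G z) \<le> 2 * B / e / (norm z)\<^sup>2" if z: "\<bar>Im z\<bar> \<le> tan \<phi> * Re z" "norm z \<ge> R0" for z
      proof -
        have zC: "z \<in> C" using z by (simp add: C_def k_def)
        have nz: "norm z > 0" using z R0 by linarith
        then have zn: "z \<noteq> 0" by auto
        have "norm z / 2 \<le> norm (z - \<mu>)" using norm_triangle_ineq2[of z \<mu>] z R0 by linarith
        moreover have "norm (F n z) \<le> B * (1 * (1 / (e * norm z)))"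
          unfolding F_def e_def[symmetric] norm_mult norm_power power2_eq_square
          using regularizer_bounds[OF Re0[OF zC] e] bnd[OF C_wedge[OF zC zn]] B0
          by (intro mult_mono) auto
        ultimately have "norm (G z) \<le> B * (1 * (1 / (e * norm z))) / (norm z / 2)"
          unfolding G_def norm_divide using nz e B0 by (intro frac_le) auto
        then show ?thesis using nz e by (simp add: power2_eq_square field_simps)
      qed
      show "(G has_contour_integral cn n) (linepath 0 (of_real R * cis (- \<phi>)) +++
          linepath (of_real R * cis (- \<phi>)) (of_real R * cis \<phi>) +++ linepath (of_real R * cis \<phi>) 0)"
        (is "(G has_contour_integral _) ?\<gamma>") if R: "R > R0" for R
      proof -
        have Rp: "R > 0" using R R0 by linarith
        have im: "path_image ?\<gamma> \<subseteq> C - (if Re \<mu> > 0 then {\<mu>} else {})"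
          using seg0[OF Rp, of \<phi>] seg0[OF Rp, of "- \<phi>"] seg1[of R] R
          by (auto simp: path_image_join closed_segment_commute)
        have vp: "valid_path ?\<gamma>" "pathfinish ?\<gamma> = pathstart ?\<gamma>" by auto
        have int_C: "z \<in> C" if "z \<in> interior C" for z using that interior_subset by auto
        show ?thesis
        proof (cases "Re \<mu> > 0")
          case True
          have "tan \<omega> * Re \<mu> < k * Re \<mu>" by (rule mult_strict_right_mono[OF kt(1) True])
          moreover have "\<bar>Im \<mu>\<bar> \<le> tan \<omega> * Re \<mu>" using \<mu> True by simp
          ultimately have \<mu>c: "\<mu> \<in> wedge \<phi>" unfolding wedge_def k_def mem_Collect_eq by linarith
          have "wedge \<phi> \<subseteq> C" by (auto simp: wedge_def C_def k_def)
          moreover have "open (wedge \<phi>)" unfolding wedge_def by (intro open_Collect_less continuous_intros)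
          ultimately have \<mu>i: "\<mu> \<in> interior C" using \<mu>c interior_maximal by blast
          have "R0 * cos \<phi> \<le> R * cos \<phi>" using R cp by (intro mult_right_mono) auto
          then have "Re \<mu> < R * cos \<phi>" using R0(3) by linarith
          then have "\<mu> \<in> interior (convex hull {0, of_real R * cis (- \<phi>), of_real R * cis \<phi>})"
            by (intro wedge_triangle_interior \<phi> Rp \<mu>c)
          \<comment> \<open>The sign says that the triangle runs counterclockwise, so that the
            winding number around \<open>\<mu>\<close> is 1 and not -1.\<close>
          moreover have "0 < Im ((of_real R * cis (- \<phi>) - 0) * cnj (of_real R * cis (- \<phi>) - \<mu>))"
          proof -
            have "\<bar>Im \<mu>\<bar> * cos \<phi> < sin \<phi> * Re \<mu>" using \<mu>c cp by (simp add: wedge_def tan_def field_simps)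
            moreover have "- Im \<mu> * cos \<phi> \<le> \<bar>Im \<mu>\<bar> * cos \<phi>" by (rule mult_right_mono) (use cp in auto)
            ultimately have "0 < R * (sin \<phi> * Re \<mu> + cos \<phi> * Im \<mu>)" using Rp by (intro mult_pos_pos) (auto simp: mult.commute)
            then show ?thesis by (simp add: algebra_simps)
          qed
          ultimately have "winding_number ?\<gamma> \<mu> = 1" using winding_number_triangle by metis
          moreover have "((\<lambda>w. F n w / (w - \<mu>)) has_contour_integral (2 * pi * \<i> * winding_number ?\<gamma> \<mu> * F n \<mu>)) ?\<gamma>"
            by (rule Cauchy_integral_formula_weak[OF convC, of "{0}"])
              (use True im vp \<mu>i in \<open>auto simp: F_cont intro!: F_diff int_C\<close>)
          ultimately show ?thesis using True by (simp add: cn_def G_def[abs_def])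
        next
          case False
          have "(G has_contour_integral 0) ?\<gamma>"
          proof (rule Cauchy_theorem_convex[OF _ convC, of _ "{0}"])
            show "G field_differentiable at x" if "x \<in> interior C - {0}" for x
            proof -
              have x: "x \<in> C" "x \<noteq> 0" using that int_C by auto
              then have "x \<noteq> \<mu>" using Re_pos False by auto
              then show ?thesis unfolding G_def[abs_def] using F_diff[OF x] by (intro derivative_intros) auto
            qed
          qed (use False im vp G_cont in auto)
          then show ?thesis using False by (simp add: cn_def)
        qed
      qed
    qed (use g q_le' in auto)
    then show "(ray_difference \<phi> (\<lambda>z. F n z / (z - \<mu>)) has_integral cn n) {0<..}" by (simp add: G_def[abs_def])
  qed
  have F_lim: "(\<lambda>n. F n z) \<longlonglongrightarrow> h z" if "Re z \<ge> 0" "z \<noteq> 0" for z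
  proof -
    have "(\<lambda>n. F n z) \<longlonglongrightarrow> h z * 1\<^sup>2"
      unfolding F_def by (intro tendsto_intros regularizer_tendsto that)
    then show ?thesis by simp
  qed
  define q where "q = ray_difference \<phi> (\<lambda>z. h z / (z - \<mu>))"
  define qn where "qn n = ray_difference \<phi> (\<lambda>z. F n z / (z - \<mu>))" for n
  have qn_int: "(qn n has_integral cn n) {0<..}" for n using main[of n] unfolding qn_def .
  have qn_le: "norm (qn n x) \<le> g x" if "x \<in> {0<..}" for n x using q_le[of x n] that by (simp add: qn_def)
  have qn_lim: "(\<lambda>n. qn n x) \<longlonglongrightarrow> q x" if x: "x \<in> {0<..}" for x
  proof -
    have "x > 0" "c * x > 0" using x c(1) by auto
    then have "norm (of_real x * cis \<phi> - \<mu>) > 0" "norm (of_real x * cis (- \<phi>) - \<mu>) > 0"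
      using c(2)[of x] c(3)[of x] by linarith+
    then show ?thesis unfolding q_def qn_def ray_difference_def
      using x cp by (intro tendsto_intros F_lim) auto
  qed
  note dc = dominated_convergence[of qn "{0<..}" g q, OF has_integral_integrable[OF qn_int] g qn_le qn_lim]
  have "q integrable_on {0<..}" "(\<lambda>n. integral {0<..} (qn n)) \<longlonglongrightarrow> integral {0<..} q"
    using dc by blast+
  moreover have "integral {0<..} (qn n) = cn n" for n
    using qn_int by (rule integral_unique)
  moreover have "cn \<longlonglongrightarrow> (if Re \<mu> > 0 then 2 * pi * \<i> * h \<mu> else 0)"
    unfolding cn_def by (auto intro!: tendsto_intros F_lim)
  ultimately have "(q has_integral (if Re \<mu> > 0 then 2 * pi * \<i> * h \<mu> else 0)) {0<..}"
    by (metis (no_types, lifting) LIMSEQ_unique ext integrable_integral)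
  then show ?thesis by (simp add: q_def)
qed

section \<open>The Banach algebra of bounded operators\<close>

text \<open>A copy of the bounded operators from a space to itself, on which composition can serve
  as the multiplication of a Banach algebra.\<close>

typedef (overloaded) 'a endo = "UNIV :: ('a::banach \<Rightarrow>\<^sub>L 'a) set"
  morphisms blinfun_of endo_of ..

setup_lifting type_definition_endo

instantiation endo :: (banach) real_normed_vector
begin
lift_definition zero_endo :: "'a endo" is 0 .
lift_definition plus_endo :: "'a endo \<Rightarrow> 'a endo \<Rightarrow> 'a endo" is "(+)" .
lift_definition minus_endo :: "'a endo \<Rightarrow> 'a endo \<Rightarrow> 'a endo" is "(-)" .
lift_definition uminus_endo :: "'a endo \<Rightarrow> 'a endo" is uminus .
lift_definition scaleR_endo :: "real \<Rightarrow> 'a endo \<Rightarrow> 'a endo" is scaleR .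
lift_definition norm_endo :: "'a endo \<Rightarrow> real" is norm .
lift_definition dist_endo :: "'a endo \<Rightarrow> 'a endo \<Rightarrow> real" is dist .
definition "sgn x = inverse (norm x) *\<^sub>R x" for x :: "'a endo"
definition "uniformity = (INF e\<in>{0<..}. principal {(x, y :: 'a endo). dist x y < e})"
definition "open U = (\<forall>x\<in>U. eventually (\<lambda>(x', y). x' = x \<longrightarrow> y \<in> U) uniformity)" for U :: "'a endo set"
instance
  by standard (simp_all add: uniformity_endo_def open_endo_def sgn_endo_def,
    (transfer, simp add: algebra_simps dist_norm norm_triangle_ineq)+)
end

instantiation endo :: (banach) unital_banach_algebra
begin
lift_definition times_endo :: "'a endo \<Rightarrow> 'a endo \<Rightarrow> 'a endo" is blinfun_compose .
lift_definition one_endo :: "'a endo" is id_blinfun .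
instance
proof
  fix x y z :: "'a endo" and r :: real
  show "x * y * z = x * (y * z)" by (transfer, rule blinfun_eqI, simp)
  show "(x + y) * z = x * z + y * z" "x * (y + z) = x * y + x * z"
    by (transfer; rule blinfun_eqI; simp add: blinfun.bilinear_simps)+
  show "r *\<^sub>R x * y = r *\<^sub>R (x * y)" "x * r *\<^sub>R y = r *\<^sub>R (x * y)"
    by (transfer; rule blinfun_eqI; simp add: blinfun.bilinear_simps)+
  show "norm (x * y) \<le> norm x * norm y" by transfer (rule norm_blinfun_compose)
  show "1 * x = x" "x * 1 = x" by (transfer; rule blinfun_eqI; simp)+
next
  fix X :: "nat \<Rightarrow> 'a endo" assume "Cauchy X"
  then have "Cauchy (\<lambda>n. blinfun_of (X n))" unfolding Cauchy_def by transfer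
  then obtain l where "(\<lambda>n. blinfun_of (X n)) \<longlonglongrightarrow> l" using Cauchy_convergent convergent_def by blast
  then have "X \<longlonglongrightarrow> endo_of l"
    unfolding lim_sequentially dist_endo.rep_eq by (simp add: endo_of_inverse)
  then show "convergent X" by (auto simp: convergent_def)
qed
end

lift_definition endo_apply :: "'a::banach endo \<Rightarrow> 'a \<Rightarrow> 'a" is blinfun_apply .

lemma endo_eqI: "(\<And>v. endo_apply x v = endo_apply y v) \<Longrightarrow> x = y"
  by transfer (rule blinfun_eqI)

lemma endo_apply_simps [simp]:
  "endo_apply (x + y) v = endo_apply x v + endo_apply y v"
  "endo_apply (x - y) v = endo_apply x v - endo_apply y v"
  "endo_apply (- x) v = - endo_apply x v"
  "endo_apply (r *\<^sub>R x) v = r *\<^sub>R endo_apply x v"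
  "endo_apply (x * y) v = endo_apply x (endo_apply y v)"
  "endo_apply 1 v = v" "endo_apply 0 v = 0"
  "endo_apply x (v + w) = endo_apply x v + endo_apply x w"
  "endo_apply x (v - w) = endo_apply x v - endo_apply x w"
  "endo_apply x (- v) = - endo_apply x v"
  "endo_apply x (r *\<^sub>R v) = r *\<^sub>R endo_apply x v"
  "endo_apply x 0 = 0"
  by (transfer; simp add: blinfun.bilinear_simps)+

lemma bounded_linear_endo_apply: "bounded_linear (endo_apply x)"
  by transfer (rule blinfun.bounded_linear_right)

lemma bounded_linear_blinfun_of: "bounded_linear blinfun_of"
  by (rule bounded_linear_intro[where K=1])
     (simp_all add: plus_endo.rep_eq scaleR_endo.rep_eq norm_endo.rep_eq)

lemma norm_endo_apply: "norm (endo_apply x v) \<le> norm x * norm v"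
  by transfer (rule norm_blinfun)

lemma norm_endo_le: "0 \<le> b \<Longrightarrow> (\<And>v. norm (endo_apply x v) \<le> b * norm v) \<Longrightarrow> norm x \<le> b"
  by transfer (rule norm_blinfun_bound)

definition endo_fun :: "('a \<Rightarrow> 'a) \<Rightarrow> 'a::banach endo"
  where "endo_fun f = endo_of (Blinfun f)"

lemma endo_apply_endo_fun [simp]: "bounded_linear f \<Longrightarrow> endo_apply (endo_fun f) = f"
  unfolding endo_fun_def by (simp add: endo_apply.rep_eq endo_of_inverse bounded_linear_Blinfun_apply)

lemma blinfun_of_endo_fun: "blinfun_of (endo_fun f) = Blinfun f"
  by (simp add: endo_fun_def endo_of_inverse)

definition commutant :: "'a::times set \<Rightarrow> 'a set"
  where "commutant X = {y. \<forall>x\<in>X. y * x = x * y}"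

lemma commutant_subset: "X \<subseteq> commutant (commutant X)"
  by (auto simp: commutant_def)

text \<open>As \<open>X\<close> is commutative, it lies in its commutant, so the bicommutant lies in
  the commutant and is commutative itself. Commutation passes to limits and to inverses; the closed
  algebra generated by \<open>X\<close> need not contain the inverses of its elements.\<close>

lemma complex_subalgebra_bicommutant:
  fixes X :: "'a::unital_banach_algebra set"
  assumes comm: "\<And>x y. x \<in> X \<Longrightarrow> y \<in> X \<Longrightarrow> x * y = y * x" and j: "j \<in> X" "j * j = - 1"
  shows "complex_subalgebra (commutant (commutant X)) j"
proof
  have X: "X \<subseteq> commutant X" using comm by (auto simp: commutant_def)
  then have sub: "commutant (commutant X) \<subseteq> commutant X" unfolding commutant_def by blast
  show "subspace (commutant (commutant X))"
    unfolding subspace_def by (auto simp: commutant_def algebra_simps)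
  have "closed {y. y * x = x * y}" for x :: 'a
    by (intro closed_Collect_eq continuous_intros)
  moreover have "commutant (commutant X) = (\<Inter>x\<in>commutant X. {y. y * x = x * y})"
    by (auto simp: commutant_def)
  ultimately show "closed (commutant (commutant X))" by auto
  show "1 \<in> commutant (commutant X)" by (auto simp: commutant_def)
  show "j \<in> commutant (commutant X)" using j commutant_subset by blast
  show "j * j = - 1" by fact
  fix x y
  show "x * y \<in> commutant (commutant X)" if "x \<in> commutant (commutant X)" "y \<in> commutant (commutant X)"
    using that unfolding commutant_def by simp (metis mult.assoc)
  show "x * y = y * x" if "x \<in> commutant (commutant X)" "y \<in> commutant (commutant X)"
    using that sub unfolding commutant_def by blast
  show "y \<in> commutant (commutant X)" if x: "x \<in> commutant (commutant X)" and xy: "x * y = 1" "y * x = 1"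
  proof -
    have "y * z = z * y" if "z \<in> commutant X" for z
    proof -
      have "x * z = z * x" using x that by (auto simp: commutant_def)
      then have "y * (x * z) * y = y * (z * x) * y" by simp
      then show ?thesis using xy by (simp add: mult.assoc) (metis mult.assoc mult_1_left)
    qed
    then show ?thesis by (auto simp: commutant_def)
  qed
qed

section \<open>Clifford multiplication\<close>

text \<open>The factors over \<open>A \<inter> B\<close> occur twice on the right and square to
  1.\<close>

lemma prod_sym_diff:
  fixes f :: "'a \<Rightarrow> real"
  assumes "finite A" "finite B" and f: "\<And>x. f x * f x = 1"
  shows "prod f (sym_diff A B) = prod f A * prod f B"
proof -
  have "prod f A = prod f (A - B) * prod f (A \<inter> B)" "prod f B = prod f (B - A) * prod f (A \<inter> B)"
    using assms prod.Int_Diff[of A f B] prod.Int_Diff[of B f A] by (simp_all add: Int_commute mult.commute)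
  moreover have "prod f (A \<inter> B) * prod f (A \<inter> B) = 1"
    by (simp flip: prod.distrib add: f)
  moreover have "prod f (sym_diff A B) = prod f (A - B) * prod f (B - A)"
    using assms by (intro prod.union_disjoint) auto
  ultimately show ?thesis by (simp add: algebra_simps)
qed

text \<open>The sign is a bicharacter of the group of subsets under symmetric difference.
  Associativity of the Clifford product rests on this and on
  \<open>clif_sign_square\<close>.\<close>

lemma clif_sign_sym_diff_left:
  "clif_sign (sym_diff A B) C = clif_sign A C * clif_sign B C"
  unfolding clif_sign_eq_prod by (intro prod_sym_diff) (auto simp flip: prod.distrib intro!: prod.neutral)

lemma clif_sign_sym_diff_right:
  "clif_sign C (sym_diff A B) = clif_sign C A * clif_sign C B"
proof -
  have "clif_sign C X = (\<Prod>b\<in>X. \<Prod>a\<in>C. if b \<le> a then - 1 else (1::real))" for X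
    unfolding clif_sign_eq_prod by (rule prod.swap)
  then show ?thesis
    by (simp only:) (intro prod_sym_diff, auto simp flip: prod.distrib intro!: prod.neutral)
qed

lemma clif_sign_square: "clif_sign A B * clif_sign A B = 1"
  unfolding clif_sign_def by (simp flip: power_mult_distrib)

lemma clif_sign_empty [simp]: "clif_sign {} A = 1" "clif_sign A {} = 1"
  by (simp_all add: clif_sign_eq_prod)

lemma sym_diff_cancel: "sym_diff A (sym_diff A B) = B"
  by auto

lemma clif_rmult_nth:
  "(v *\<^sub>r a) $ C = (\<Sum>A\<in>UNIV. (clif_sign (sym_diff A C) A * a $ A) *\<^sub>R v $ (sym_diff A C))"
  unfolding clif_rmult_def vec_lambda_beta
proof (rule sum.reindex_bij_witness[where i="\<lambda>A. (sym_diff A C, A)" and j=snd])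
  fix p :: "'b set \<times> 'b set"
  assume "p \<in> {(B, A). sym_diff B A = C}"
  then obtain B A where p: "p = (B, A)" "sym_diff B A = C" by auto
  have B: "sym_diff A C = B" using p(2) by auto
  show "(sym_diff (snd p) C, snd p) = p" "snd p \<in> UNIV" using p(1) B by auto
  show "(clif_sign (sym_diff (snd p) C) (snd p) * a $ snd p) *\<^sub>R v $ sym_diff (snd p) C =
      (case p of (B, A) \<Rightarrow> (clif_sign B A * a $ A) *\<^sub>R v $ B)"
    unfolding p(1) snd_conv B by simp
next
  fix A :: "'b set"
  show "snd (sym_diff A C, A) = A" by simp
  show "(sym_diff A C, A) \<in> {(B, A). sym_diff B A = C}" by auto
qed

lemma bij_sym_diff: "bij (\<lambda>B. sym_diff A B)"
  by (rule o_bij[where g="\<lambda>B. sym_diff A B"]) (auto simp: fun_eq_iff)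

lemma sum_sym_diff: "(\<Sum>D\<in>UNIV. f (sym_diff A D)) = (\<Sum>D\<in>(UNIV :: 'n::finite set set). f D)"
  by (rule sum.reindex_bij_betw[OF bij_sym_diff])

text \<open>Both sides are sums over pairs of subsets; the substitution
  \<open>D = sym_diff A B\<close> matches the terms, and the bicharacter property matches their
  signs.\<close>

lemma clif_lmult_assoc: "(a *\<^sub>l b) *\<^sub>l v = a *\<^sub>l (b *\<^sub>l v)"
proof (rule vec_eq_iff[THEN iffD2], rule allI)
  fix C
  define f where "f A D = (clif_sign D (sym_diff D C) * (clif_sign A (sym_diff A D) * a $ A * b $ (sym_diff A D)))
    *\<^sub>R v $ (sym_diff D C)" for A D
  have "((a *\<^sub>l b) *\<^sub>l v) $ C = (\<Sum>D\<in>UNIV. \<Sum>A\<in>UNIV. f A D)"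
    by (simp add: f_def clif_lmult_nth scaleR_sum_left sum_distrib_left algebra_simps)
  also have "\<dots> = (\<Sum>A\<in>UNIV. \<Sum>D\<in>UNIV. f A D)" by (rule sum.swap)
  also have "\<dots> = (\<Sum>A\<in>UNIV. \<Sum>B\<in>UNIV. f A (sym_diff A B))"
    by (rule sum.cong[OF refl], rule sum_sym_diff[symmetric])
  also have "\<dots> = (\<Sum>A\<in>UNIV. \<Sum>B\<in>UNIV. (clif_sign A (sym_diff A C) * a $ A *
      (clif_sign B (sym_diff B (sym_diff A C)) * b $ B)) *\<^sub>R v $ (sym_diff B (sym_diff A C)))"
  proof (intro sum.cong refl)
    fix A B
    have e: "sym_diff (sym_diff A B) C = sym_diff B (sym_diff A C)" by auto
    \<comment> \<open>Expanding the first factor produces a second \<open>clif_sign A B\<close>, and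
      its square is 1.\<close>
    have "clif_sign (sym_diff A B) (sym_diff B (sym_diff A C)) * clif_sign A B =
       clif_sign A (sym_diff A C) * clif_sign B (sym_diff B (sym_diff A C)) * (clif_sign A B * clif_sign A B)"
      by (simp only: clif_sign_sym_diff_left clif_sign_sym_diff_right) (simp add: algebra_simps)
    then have "clif_sign (sym_diff A B) (sym_diff B (sym_diff A C)) * clif_sign A B =
       clif_sign A (sym_diff A C) * clif_sign B (sym_diff B (sym_diff A C))"
      unfolding clif_sign_square by simp
    then show "f A (sym_diff A B) = (clif_sign A (sym_diff A C) * a $ A *
      (clif_sign B (sym_diff B (sym_diff A C)) * b $ B)) *\<^sub>R v $ (sym_diff B (sym_diff A C))"
      unfolding f_def e sym_diff_cancel by (simp only: mult.assoc[symmetric]) (simp only: mult_ac)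
  qed
  also have "\<dots> = (a *\<^sub>l (b *\<^sub>l v)) $ C"
    by (simp add: clif_lmult_nth scaleR_sum_right sum_distrib_left algebra_simps)
  finally show "((a *\<^sub>l b) *\<^sub>l v) $ C = (a *\<^sub>l (b *\<^sub>l v)) $ C" .
qed

lemma clif_rmult_assoc:
  fixes v :: "('v::real_vector, 'n::{finite,linorder}) cmodule"
  shows "(v *\<^sub>r a) *\<^sub>r b = v *\<^sub>r (a *\<^sub>l b)"
proof (rule vec_eq_iff[THEN iffD2], rule allI)
  fix C
  define f where "f A D = (clif_sign (sym_diff D C) D * (clif_sign A (sym_diff A D) * a $ A * b $ (sym_diff A D)))
    *\<^sub>R v $ (sym_diff D C)" for A D
  have "(v *\<^sub>r (a *\<^sub>l b)) $ C = (\<Sum>D\<in>UNIV. \<Sum>A\<in>UNIV. f A D)"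
    by (simp add: f_def clif_lmult_nth clif_rmult_nth scaleR_sum_left sum_distrib_left algebra_simps)
  also have "\<dots> = (\<Sum>D\<in>UNIV. \<Sum>B\<in>UNIV. f (sym_diff D B) D)"
    by (rule sum.cong[OF refl], rule sum_sym_diff[symmetric])
  also have "\<dots> = (\<Sum>B\<in>UNIV. \<Sum>D\<in>UNIV. f (sym_diff D B) D)" by (rule sum.swap)
  also have "\<dots> = (\<Sum>B\<in>UNIV. \<Sum>A\<in>UNIV. f (sym_diff (sym_diff B A) B) (sym_diff B A))"
    by (rule sum.cong[OF refl], rule sum_sym_diff[symmetric])
  also have "\<dots> = (\<Sum>B\<in>UNIV. \<Sum>A\<in>UNIV. (clif_sign (sym_diff B C) B * b $ B *
      (clif_sign (sym_diff A (sym_diff B C)) A * a $ A)) *\<^sub>R v $ (sym_diff A (sym_diff B C)))"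
  proof (intro sum.cong refl)
    fix A B
    have e: "sym_diff (sym_diff B A) C = sym_diff A (sym_diff B C)" "sym_diff (sym_diff B A) B = A"
      "sym_diff A (sym_diff B A) = B" by auto
    have "clif_sign (sym_diff A (sym_diff B C)) (sym_diff B A) * clif_sign A B =
       clif_sign (sym_diff B C) B * clif_sign (sym_diff A (sym_diff B C)) A * (clif_sign A B * clif_sign A B)"
      by (simp only: clif_sign_sym_diff_left clif_sign_sym_diff_right) (simp add: algebra_simps)
    then have "clif_sign (sym_diff A (sym_diff B C)) (sym_diff B A) * clif_sign A B =
       clif_sign (sym_diff B C) B * clif_sign (sym_diff A (sym_diff B C)) A"
      unfolding clif_sign_square by simp
    then show "f (sym_diff (sym_diff B A) B) (sym_diff B A) = (clif_sign (sym_diff B C) B * b $ B *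
      (clif_sign (sym_diff A (sym_diff B C)) A * a $ A)) *\<^sub>R v $ (sym_diff A (sym_diff B C))"
      unfolding f_def e by (simp only: mult.assoc[symmetric]) (simp only: mult_ac)
  qed
  also have "\<dots> = ((v *\<^sub>r a) *\<^sub>r b) $ C"
    by (simp add: clif_rmult_nth scaleR_sum_right sum_distrib_left algebra_simps)
  finally show "((v *\<^sub>r a) *\<^sub>r b) $ C = (v *\<^sub>r (a *\<^sub>l b)) $ C" by simp
qed

lemma clif_lmult_simps:
  "(a + b) *\<^sub>l v = a *\<^sub>l v + b *\<^sub>l v" "(a - b) *\<^sub>l v = a *\<^sub>l v - b *\<^sub>l v"
  "(- a) *\<^sub>l v = - (a *\<^sub>l v)" "(r *\<^sub>R a) *\<^sub>l v = r *\<^sub>R (a *\<^sub>l v)"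
  "a *\<^sub>l (v + w) = a *\<^sub>l v + a *\<^sub>l w" "a *\<^sub>l (v - w) = a *\<^sub>l v - a *\<^sub>l w"
  "a *\<^sub>l (- v) = - (a *\<^sub>l v)" "a *\<^sub>l (r *\<^sub>R v) = r *\<^sub>R (a *\<^sub>l v)"
  by (simp_all add: vec_eq_iff clif_lmult_nth algebra_simps sum.distrib sum_subtractf sum_negf scaleR_sum_right)

lemma clif_rmult_simps:
  "v *\<^sub>r (a + b) = v *\<^sub>r a + v *\<^sub>r b" "v *\<^sub>r (- a) = - (v *\<^sub>r a)" "v *\<^sub>r (r *\<^sub>R a) = r *\<^sub>R (v *\<^sub>r a)"
  "(v + w) *\<^sub>r a = v *\<^sub>r a + w *\<^sub>r a" "(v - w) *\<^sub>r a = v *\<^sub>r a - w *\<^sub>r a"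
  "(r *\<^sub>R v) *\<^sub>r a = r *\<^sub>R (v *\<^sub>r a)"
  by (simp_all add: vec_eq_iff clif_rmult_nth algebra_simps sum.distrib sum_subtractf sum_negf scaleR_sum_right)

lemma clif_one_lmult [simp]: "clif_one *\<^sub>l v = v"
  by (simp add: vec_eq_iff clif_lmult_nth clif_basis_def axis_def if_distrib if_distribR cong: if_cong)

lemma clif_rmult_one [simp]: "v *\<^sub>r clif_one = v"
  by (simp add: vec_eq_iff clif_rmult_nth clif_basis_def axis_def if_distrib if_distribR cong: if_cong)

lemma clif_lmult_one [simp]: "a *\<^sub>l clif_one = a"
proof (rule vec_eq_iff[THEN iffD2], rule allI)
  fix C
  have "(a *\<^sub>l clif_one) $ C = (\<Sum>A\<in>UNIV. if A = C then a $ A else 0)"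
    unfolding clif_lmult_nth by (rule sum.cong) (auto simp: clif_basis_def axis_def)
  then show "(a *\<^sub>l clif_one) $ C = a $ C" by simp
qed

lemma bounded_linear_vecI:
  fixes f :: "'a::real_normed_vector \<Rightarrow> ('b::real_normed_vector, 'k::finite) vec"
  assumes f: "\<And>i. bounded_linear (\<lambda>v. f v $ i)"
  shows "bounded_linear f"
proof -
  have "\<exists>K. \<forall>v. norm (f v $ i) \<le> norm v * K" for i
    using bounded_linear.bounded[OF f[of i]] by blast
  then obtain K where K: "\<And>i v. norm (f v $ i) \<le> norm v * K i" by metis
  show ?thesis
  proof (rule bounded_linear_intro)
    show "f (x + y) = f x + f y" for x y
      using linear_add[OF bounded_linear.linear[OF f]] by (simp add: vec_eq_iff)
    show "f (r *\<^sub>R x) = r *\<^sub>R f x" for r x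
      using linear_scale[OF bounded_linear.linear[OF f]] by (simp add: vec_eq_iff)
    fix v
    have "norm (f v) \<le> (\<Sum>i\<in>UNIV. norm (f v $ i))"
      unfolding norm_vec_def by (rule L2_set_le_sum) simp
    also have "\<dots> \<le> (\<Sum>i\<in>UNIV. norm v * K i)" by (intro sum_mono K)
    finally show "norm (f v) \<le> norm v * (\<Sum>i\<in>UNIV. K i)" by (simp add: sum_distrib_left)
  qed
qed

lemma bounded_linear_clif_lmult:
  "bounded_linear (\<lambda>v. a *\<^sub>l (v :: ('v::real_normed_vector, 'n::{finite,linorder}) cmodule))"
  by (rule bounded_linear_vecI, unfold clif_lmult_nth)
    (intro bounded_linear_sum bounded_linear_const_scaleR bounded_linear_vec_nth)

lemma bounded_linear_clif_rmult:
  "bounded_linear (\<lambda>v. (v :: ('v::real_normed_vector, 'n::{finite,linorder}) cmodule) *\<^sub>r a)"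
  by (rule bounded_linear_vecI, unfold clif_rmult_nth)
    (intro bounded_linear_sum bounded_linear_const_scaleR bounded_linear_vec_nth)

text \<open>The mixed terms cancel in pairs under swapping the generators.\<close>

lemma vector_square:
  fixes s :: "'n::{finite,linorder} clif"
  assumes s: "s \<in> paravectors" "sc s = 0"
  shows "s *\<^sub>l s = - ((norm s)\<^sup>2 *\<^sub>R clif_one)"
proof -
  define c where "c i = s $ {i}" for i
  have z: "s $ A = 0" if "\<And>i. A \<noteq> {i}" for A
  proof (cases "A = {}")
    case True
    then show ?thesis using s by (simp add: sc_def)
  next
    case False
    then have "card A \<noteq> 0" "card A \<noteq> 1" using that by (auto simp: card_1_singleton_iff)
    then have "card A > 1" by linarith
    then show ?thesis using s by (simp add: paravectors_def)
  qed
  have ss: "(\<Sum>A\<in>UNIV. f A) = (\<Sum>i\<in>UNIV. f {i})" if "\<And>A. s $ A = 0 \<Longrightarrow> f A = 0" for f :: "'n set \<Rightarrow> real"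
  proof -
    have "(\<Sum>A\<in>UNIV. f A) = (\<Sum>A\<in>range (\<lambda>i. {i}). f A)"
    proof (rule sum.mono_neutral_right)
      show "\<forall>A\<in>UNIV - range (\<lambda>i. {i}). f A = 0" by (intro ballI that z) blast
    qed auto
    also have "\<dots> = (\<Sum>i\<in>UNIV. f {i})" by (subst sum.reindex) (auto intro: injI)
    finally show ?thesis .
  qed
  have norm: "(norm s)\<^sup>2 = (\<Sum>i\<in>UNIV. (c i)\<^sup>2)"
    unfolding norm_vec_def L2_set_def c_def by (simp add: sum_nonneg ss)
  have expand: "s = (\<Sum>i\<in>UNIV. c i *\<^sub>R clif_basis {i})"
  proof (rule vec_eq_iff[THEN iffD2], rule allI)
    fix A
    show "s $ A = (\<Sum>i\<in>UNIV. c i *\<^sub>R clif_basis {i}) $ A"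
    proof (cases "\<exists>i. A = {i}")
      case True
      then obtain k where k: "A = {k}" by blast
      have "(\<Sum>i\<in>UNIV. c i *\<^sub>R clif_basis {i}) $ A = (\<Sum>i\<in>UNIV. if i = k then c k else 0)"
        unfolding sum_component by (rule sum.cong) (auto simp: k clif_basis_def axis_def)
      then show ?thesis by (simp add: k c_def)
    next
      case False
      then have "(\<Sum>i\<in>UNIV. c i *\<^sub>R clif_basis {i}) $ A = 0"
        unfolding sum_component by (intro sum.neutral) (auto simp: clif_basis_def axis_def)
      then show ?thesis using z False by simp
    qed
  qed
  have suml: "(\<Sum>i\<in>UNIV. f i) *\<^sub>l v = (\<Sum>i\<in>UNIV. f i *\<^sub>l v)" for f :: "'n \<Rightarrow> 'n clif" and v :: "'n clif"
    by (rule linear_sum) (rule linearI; simp add: clif_lmult_simps)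
  have sumr: "v *\<^sub>l (\<Sum>i\<in>UNIV. f i) = (\<Sum>i\<in>UNIV. v *\<^sub>l f i)" for f :: "'n \<Rightarrow> 'n clif" and v :: "'n clif"
    by (rule linear_sum) (rule linearI; simp add: clif_lmult_simps)
  define e where "e i k = clif_basis {i} *\<^sub>l clif_basis {k}" for i k :: 'n
  have sq: "s *\<^sub>l s = (\<Sum>i\<in>UNIV. \<Sum>k\<in>UNIV. (c i * c k) *\<^sub>R e i k)"
  proof -
    have "s *\<^sub>l s = (\<Sum>i\<in>UNIV. c i *\<^sub>R clif_basis {i}) *\<^sub>l (\<Sum>k\<in>UNIV. c k *\<^sub>R clif_basis {k})"
      using expand by metis
    then show ?thesis
      by (subst sum.swap) (simp add: suml sumr clif_lmult_simps e_def mult.commute scaleR_sum_right)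
  qed
  have e: "e i k + e k i = (if i = k then - 2 *\<^sub>R clif_one else 0)" for i k
    using clif_generators_anticommute[of i k] by (auto simp: e_def clif_generator_square scaleR_2)
  have "2 *\<^sub>R (s *\<^sub>l s) = s *\<^sub>l s + (\<Sum>k\<in>UNIV. \<Sum>i\<in>UNIV. (c i * c k) *\<^sub>R e i k)"
    unfolding scaleR_2 by (subst sum.swap) (simp add: sq)
  also have "\<dots> = (\<Sum>i\<in>UNIV. \<Sum>k\<in>UNIV. (c i * c k) *\<^sub>R (e i k + e k i))"
    unfolding sq by (simp add: sum.distrib scaleR_add_right mult.commute)
  also have "\<dots> = (\<Sum>i\<in>UNIV. (c i * c i) *\<^sub>R (- 2 *\<^sub>R clif_one))"
    unfolding e by (simp add: if_distrib if_distribR cong: if_cong)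
  also have "\<dots> = 2 *\<^sub>R (- ((norm s)\<^sup>2 *\<^sub>R clif_one))"
    unfolding norm by (simp add: power2_eq_square sum_negf scaleR_sum_left scaleR_sum_right mult_ac)
  finally show ?thesis by (metis scaleR_left_imp_eq zero_neq_numeral)
qed

lemma unit_imag_square: "J \<in> unit_imag \<Longrightarrow> J *\<^sub>l J = - clif_one"
  by (simp add: unit_imag_def vector_square)

section \<open>Slices and intrinsic functions\<close>

text \<open>For \<open>J\<close> in \<open>unit_imag\<close> this is a ring isomorphism from the
  complex numbers onto the slice of \<open>J\<close>, so that computations in a slice become complex
  ones.\<close>

definition slice_embed :: "'n::{finite,linorder} clif \<Rightarrow> complex \<Rightarrow> 'n clif"
  where "slice_embed J z = slice_pt J (Re z) (Im z)"

text \<open>Together with \<open>sc s\<close> this determines the sphere of a paravector, i.e. the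
  paravector up to its imaginary direction; \<open>Q_op\<close> sees nothing finer.\<close>

definition vec_norm :: "'n::{finite,linorder} clif \<Rightarrow> real"
  where "vec_norm s = norm (s - sc s *\<^sub>R clif_one)"

text \<open>The trace of the double sector on a slice. Strictness excludes 0, where
  \<open>gext\<close> has its value by convention.\<close>

definition double_wedge :: "real \<Rightarrow> complex set"
  where "double_wedge \<theta> = {z. \<bar>Im z\<bar> < tan \<theta> * \<bar>Re z\<bar>}"

lemma slice_embed_mult:
  assumes "J \<in> unit_imag"
  shows "slice_embed J z *\<^sub>l (slice_embed J w *\<^sub>l v) = slice_embed J (z * w) *\<^sub>l v"
proof -
  have "J *\<^sub>l (J *\<^sub>l v) = - v"
    using unit_imag_square[OF assms] by (simp add: clif_lmult_simps flip: clif_lmult_assoc)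
  then show ?thesis
    by (simp add: slice_embed_def slice_pt_def clif_lmult_simps algebra_simps)
qed

lemma slice_embed_mult':
  assumes "J \<in> unit_imag"
  shows "slice_embed J z *\<^sub>l slice_embed J w = slice_embed J (z * w)"
  using slice_embed_mult[OF assms, of z w clif_one] by simp

lemma slice_embed_simps:
  "slice_embed J 1 = clif_one" "slice_embed J 0 = 0" "slice_embed J \<i> = J"
  "slice_embed J (z + w) = slice_embed J z + slice_embed J w"
  "slice_embed J (- z) = - slice_embed J z"
  "slice_embed J (z - w) = slice_embed J z - slice_embed J w"
  "slice_embed J (of_real r) = r *\<^sub>R clif_one"
  "slice_embed J (of_real r * z) = r *\<^sub>R slice_embed J z"
  by (simp_all add: slice_embed_def slice_pt_def algebra_simps)

lemma clif_inv_slice_embed: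
  assumes J: "J \<in> unit_imag" and z: "z \<noteq> 0"
  shows "clif_inv (slice_embed J z) = slice_embed J (1 / z)"
  unfolding clif_inv_def
proof (rule the_equality)
  show "slice_embed J z *\<^sub>l slice_embed J (1 / z) = clif_one \<and> slice_embed J (1 / z) *\<^sub>l slice_embed J z = clif_one"
    using z by (simp add: slice_embed_mult'[OF J] slice_embed_simps)
  fix b assume b: "slice_embed J z *\<^sub>l b = clif_one \<and> b *\<^sub>l slice_embed J z = clif_one"
  have "b = slice_embed J (1 / z) *\<^sub>l (slice_embed J z *\<^sub>l b)"
    using z by (simp add: slice_embed_mult[OF J] slice_embed_simps)
  then show "b = slice_embed J (1 / z)" using b by simp
qed

lemma sc_clif_one [simp]: "sc clif_one = 1"
  by (simp add: sc_def clif_basis_def)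

lemma sc_slice_pt [simp]: "I \<in> unit_imag \<Longrightarrow> sc (slice_pt I x y) = x"
  by (simp add: unit_imag_def sc_def slice_pt_def clif_basis_def)

lemma vec_norm_slice_pt [simp]: "I \<in> unit_imag \<Longrightarrow> vec_norm (slice_pt I x y) = \<bar>y\<bar>"
  by (simp add: vec_norm_def) (simp add: slice_pt_def unit_imag_def)

lemma norm_square_eq:
  fixes s :: "'n::{finite,linorder} clif"
  shows "(norm s)\<^sup>2 = (sc s)\<^sup>2 + (vec_norm s)\<^sup>2"
proof -
  have one: "inner clif_one a = sc a" for a :: "'n clif"
    by (simp add: clif_basis_def inner_axis' sc_def)
  define v where "v = s - sc s *\<^sub>R clif_one"
  have "inner clif_one v = 0" unfolding v_def inner_diff_right inner_scaleR_right one by simp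
  moreover have "s = sc s *\<^sub>R clif_one + v" by (simp add: v_def)
  then have "(norm s)\<^sup>2 = inner (sc s *\<^sub>R clif_one + v) (sc s *\<^sub>R clif_one + v)"
    by (metis power2_norm_eq_inner)
  moreover have "inner v clif_one = inner clif_one v" by (rule inner_commute)
  ultimately have "(norm s)\<^sup>2 = (sc s)\<^sup>2 * inner clif_one (clif_one :: 'n clif) + inner v v"
    by (simp only: inner_add_left inner_add_right inner_scaleR_left inner_scaleR_right) (simp add: power2_eq_square)
  then show ?thesis by (simp add: one vec_norm_def v_def power2_norm_eq_inner)
qed

lemma norm_slice_pt: "I \<in> unit_imag \<Longrightarrow> (norm (slice_pt I x y))\<^sup>2 = x\<^sup>2 + y\<^sup>2"
  by (simp add: norm_square_eq)

lemma norm_slice_embed [simp]: "I \<in> unit_imag \<Longrightarrow> norm (slice_embed I z) = norm z"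
  by (simp add: slice_embed_def cmod_def flip: norm_slice_pt)

lemma slice_pt_paravector [simp]: "I \<in> unit_imag \<Longrightarrow> slice_pt I x y \<in> paravectors"
  by (auto simp: slice_pt_def paravectors_def unit_imag_def clif_basis_def axis_def)

text \<open>A real paravector has no direction of its own and lies in every slice; \<open>J\<close>
  then serves as \<open>I\<close>.\<close>

lemma paravector_slice:
  fixes s J :: "'n::{finite,linorder} clif"
  assumes s: "s \<in> paravectors" and J: "J \<in> unit_imag"
  obtains I where "I \<in> unit_imag" "s = slice_pt I (sc s) (vec_norm s)"
proof (cases "vec_norm s = 0")
  case True
  then have "s = slice_pt J (sc s) (vec_norm s)" by (simp add: vec_norm_def slice_pt_def)
  then show ?thesis using that J by blast
next
  case False
  define I where "I = (1 / vec_norm s) *\<^sub>R (s - sc s *\<^sub>R clif_one)"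
  have "I \<in> paravectors" using s by (auto simp: I_def paravectors_def clif_basis_def axis_def)
  moreover have "sc I = 0" by (simp add: I_def sc_def clif_basis_def)
  moreover have "norm I = 1" using False by (simp add: I_def vec_norm_def)
  ultimately have "I \<in> unit_imag" by (simp add: unit_imag_def)
  moreover have "s = slice_pt I (sc s) (vec_norm s)" using False by (simp add: slice_pt_def I_def)
  ultimately show ?thesis using that by blast
qed

lemma sc_slice_embed [simp]: "I \<in> unit_imag \<Longrightarrow> sc (slice_embed I z) = Re z"
  and vec_norm_slice_embed [simp]: "I \<in> unit_imag \<Longrightarrow> vec_norm (slice_embed I z) = \<bar>Im z\<bar>"
  and slice_embed_paravector [simp]: "I \<in> unit_imag \<Longrightarrow> slice_embed I z \<in> paravectors"
  by (simp_all add: slice_embed_def)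

lemma pv_cnj_slice_embed: "I \<in> unit_imag \<Longrightarrow> pv_cnj (slice_embed I z) = slice_embed I (cnj z)"
  by (auto simp: vec_eq_iff pv_cnj_def slice_embed_def slice_pt_def unit_imag_def sc_def clif_basis_def axis_def)

lemma scaleR_slice_exp: "t *\<^sub>R slice_exp I \<phi> = slice_embed I (of_real t * cis \<phi>)"
  by (simp add: slice_exp_def slice_embed_def slice_pt_def algebra_simps)

lemma bisector_angle_tan:
  assumes "0 < \<theta>" "\<theta> < pi / 2" "\<phi> \<in> bisector_angles \<theta>"
  shows "\<bar>sin \<phi>\<bar> < tan \<theta> * \<bar>cos \<phi>\<bar>"
proof -
  have *: "\<bar>sin u\<bar> < tan \<theta> * \<bar>cos u\<bar>" if "- \<theta> < u" "u < \<theta>" for u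
  proof -
    have c: "cos u > 0" using that assms by (intro cos_gt_zero_pi) auto
    have "tan u < tan \<theta>" using that assms by (intro tan_monotone) auto
    moreover have "tan (- \<theta>) < tan u" using that assms by (intro tan_monotone) auto
    ultimately have "\<bar>tan u\<bar> < tan \<theta>" by auto
    then show ?thesis using c by (simp add: tan_def field_simps)
  qed
  from assms(3) consider "- \<theta> < \<phi>" "\<phi> < \<theta>" | "- \<theta> < \<phi> - pi" "\<phi> - pi < \<theta>"
    by (auto simp: bisector_angles_def)
  then show ?thesis
  proof cases
    case 2
    then show ?thesis using *[of "\<phi> - pi"] by simp
  qed (rule *)
qed

lemma double_sector_bound:
  assumes "0 < \<theta>" "\<theta> < pi / 2" "s \<in> double_sector \<theta>"
  shows "vec_norm s < tan \<theta> * \<bar>sc s\<bar>"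
proof -
  obtain r I \<phi> where s: "s = r *\<^sub>R slice_exp I \<phi>" "r > 0" "I \<in> unit_imag" "\<phi> \<in> bisector_angles \<theta>"
    using assms(3) by (auto simp: double_sector_def)
  have "s = slice_pt I (r * cos \<phi>) (r * sin \<phi>)"
    by (simp add: s slice_exp_def slice_pt_def algebra_simps)
  then have "vec_norm s = r * \<bar>sin \<phi>\<bar>" "\<bar>sc s\<bar> = r * \<bar>cos \<phi>\<bar>" using s by (simp_all add: abs_mult)
  then show ?thesis using bisector_angle_tan[OF assms(1,2) s(4)] s(2) by simp
qed

lemma closure_double_sector_bound:
  assumes "0 < \<theta>" "\<theta> < pi / 2" "s \<in> closure (double_sector \<theta>)"
  shows "vec_norm s \<le> tan \<theta> * \<bar>sc s\<bar>"
proof -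
  have "closed {s. vec_norm s \<le> tan \<theta> * \<bar>sc s\<bar>}"
    unfolding vec_norm_def sc_def by (intro closed_Collect_le continuous_intros)
  moreover have "double_sector \<theta> \<subseteq> {s. vec_norm s \<le> tan \<theta> * \<bar>sc s\<bar>}"
    using double_sector_bound[OF assms(1,2)] by (auto intro: less_imp_le)
  ultimately show ?thesis using assms(3) closure_minimal by blast
qed

lemma slice_pt_double_sector:
  assumes \<theta>: "0 < \<theta>" "\<theta> < pi / 2" and I: "I \<in> unit_imag" and xy: "\<bar>y\<bar> < tan \<theta> * \<bar>x\<bar>"
  shows "slice_pt I x y \<in> double_sector \<theta>"
proof -
  \<comment> \<open>The radius is signed: \<open>arctan (y / x)\<close> stays within
    \<open>\<theta>\<close> of 0 on both halves of the sector, and a negative radius is finally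
    traded for the angle \<open>pi + u\<close>.\<close>
  define r where "r = sgn x * sqrt (x\<^sup>2 + y\<^sup>2)"
  have x: "x \<noteq> 0" using xy by auto
  define u where "u = arctan (y / x)"
  have "\<bar>y / x\<bar> < tan \<theta>" using xy x by (simp add: abs_divide field_simps)
  then have "arctan (y / x) < arctan (tan \<theta>)" "arctan (- (tan \<theta>)) < arctan (y / x)"
    unfolding arctan_less_iff by linarith+
  then have u: "- \<theta> < u" "u < \<theta>" using \<theta> arctan_tan[of \<theta>] by (simp_all add: u_def arctan_minus)
  have sq: "sqrt (1 + (y / x)\<^sup>2) = sqrt (x\<^sup>2 + y\<^sup>2) / \<bar>x\<bar>"
  proof -
    have "1 + (y / x)\<^sup>2 = (x\<^sup>2 + y\<^sup>2) / x\<^sup>2" using x by (simp add: field_simps)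
    then show ?thesis by (simp add: real_sqrt_divide)
  qed
  have pos: "sqrt (x\<^sup>2 + y\<^sup>2) > 0" using x by (simp add: sum_power2_gt_zero_iff)
  have "cos u = 1 / (sqrt (x\<^sup>2 + y\<^sup>2) / \<bar>x\<bar>)" "sin u = (y / x) / (sqrt (x\<^sup>2 + y\<^sup>2) / \<bar>x\<bar>)"
    unfolding u_def cos_arctan sin_arctan sq by (rule refl)+
  then have r: "r * cos u = x" "r * sin u = y"
    using x pos by (simp_all add: r_def sgn_if)
  show ?thesis
  proof (cases "x > 0")
    case True
    have "slice_pt I x y = r *\<^sub>R slice_exp I u"
      using r by (simp add: slice_exp_def slice_pt_def algebra_simps)
    moreover have "r > 0" using True pos by (simp add: r_def)
    ultimately show ?thesis unfolding double_sector_def bisector_angles_def using u I by fastforce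
  next
    case False
    have "slice_pt I x y = (- r) *\<^sub>R slice_exp I (pi + u)"
      using r by (simp add: slice_exp_def slice_pt_def algebra_simps)
    moreover have "- r > 0" using False x pos by (simp add: r_def)
    moreover have "pi + u \<in> {pi - \<theta><..<pi + \<theta>}" using u by auto
    ultimately show ?thesis unfolding double_sector_def bisector_angles_def using I by blast
  qed
qed

lemma double_wedge_cnj [simp]: "cnj z \<in> double_wedge \<theta> \<longleftrightarrow> z \<in> double_wedge \<theta>"
  and double_wedge_Re: "z \<in> double_wedge \<theta> \<Longrightarrow> Re z \<noteq> 0"
  by (auto simp: double_wedge_def)

lemma double_wedge_or_zero:
  assumes "0 < \<omega>" "\<omega> < \<theta>" "\<theta> < pi / 2" "\<bar>Im z\<bar> \<le> tan \<omega> * \<bar>Re z\<bar>"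
  shows "z \<in> double_wedge \<theta> \<or> z = 0"
proof (cases "Re z = 0")
  case True
  then show ?thesis using assms by (simp add: complex_eq_iff)
next
  case False
  have "tan \<omega> < tan \<theta>" using assms by (intro tan_monotone) auto
  then have "tan \<omega> * \<bar>Re z\<bar> < tan \<theta> * \<bar>Re z\<bar>" using False by (intro mult_strict_right_mono) auto
  then show ?thesis using assms(4) unfolding double_wedge_def mem_Collect_eq by linarith
qed

text \<open>An intrinsic function acts on all slices as one complex function, whose real and
  imaginary parts are the real components \<open>f0\<close> and \<open>f1\<close>. The slice
  conditions become the Cauchy-Riemann equations and symmetry under conjugation; boundedness and
  integrability are read off on the slice of \<open>J\<close>.\<close>

lemma N0_complex_representation:
  assumes f: "f \<in> N0 \<theta>" and \<theta>: "0 < \<theta>" "\<theta> < pi / 2" and J: "(J :: 'n::{finite,linorder} clif) \<in> unit_imag"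
  obtains h B where
    "\<And>I z. I \<in> unit_imag \<Longrightarrow> z \<in> double_wedge \<theta> \<Longrightarrow> f (slice_embed I z :: 'n clif) = slice_embed I (h z)"
    "\<And>z. z \<in> double_wedge \<theta> \<Longrightarrow> h (cnj z) = cnj (h z)"
    "h holomorphic_on double_wedge \<theta>"
    "\<And>z. z \<in> double_wedge \<theta> \<Longrightarrow> norm (h z) \<le> B"
    "\<And>\<phi>. \<phi> \<in> bisector_angles \<theta> \<Longrightarrow> (\<lambda>t. norm (h (of_real t * cis \<phi>)) / t) integrable_on {0<..}"
proof -
  define U :: "'n clif set" where "U = double_sector \<theta>"
  obtain f0 f1 where comp: "slice_components U f f0 f1"
    and re: "\<And>p. p \<in> slice_dom U \<Longrightarrow> f0 p \<in> range (\<lambda>r. r *\<^sub>R clif_one) \<and> f1 p \<in> range (\<lambda>r. r *\<^sub>R clif_one)"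
    using f by (auto simp: N0_def intrinsic_def U_def)
  have dom: "(Re z, Im z) \<in> slice_dom U" if "z \<in> double_wedge \<theta>" for z
    using that slice_pt_double_sector[OF \<theta>] by (auto simp: slice_dom_def U_def double_wedge_def)
  define h where "h z = Complex (f0 (Re z, Im z) $ {}) (f1 (Re z, Im z) $ {})" for z
  have real: "f0 p = (f0 p $ {}) *\<^sub>R clif_one" "f1 p = (f1 p $ {}) *\<^sub>R clif_one" if "p \<in> slice_dom U" for p
    using re[OF that] by (auto simp: clif_basis_def)
  have rep: "f (slice_embed I z) = slice_embed I (h z)" if "I \<in> unit_imag" "z \<in> double_wedge \<theta>" for I z
  proof -
    have "f (slice_pt I (Re z) (Im z)) = f0 (Re z, Im z) + I *\<^sub>l f1 (Re z, Im z)"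
      using comp dom[OF that(2)] that(1) unfolding slice_components_def by blast
    also have "\<dots> = (f0 (Re z, Im z) $ {}) *\<^sub>R clif_one + I *\<^sub>l ((f1 (Re z, Im z) $ {}) *\<^sub>R clif_one)"
      using real[OF dom[OF that(2)]] by metis
    finally show ?thesis by (simp add: slice_embed_def slice_pt_def h_def clif_lmult_simps)
  qed
  have sym: "h (cnj z) = cnj (h z)" if "z \<in> double_wedge \<theta>" for z
  proof -
    have "f0 (Re z, - Im z) = f0 (Re z, Im z)" "f1 (Re z, - Im z) = - f1 (Re z, Im z)"
      using comp dom[OF that] unfolding slice_components_def by blast+
    then show ?thesis by (simp add: h_def complex_eq_iff)
  qed
  have bnd: "\<exists>B. \<forall>z\<in>double_wedge \<theta>. norm (h z) \<le> B"
  proof -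
    have "bounded (f ` U)" using f by (simp add: N0_def SH_L0_def U_def)
    then obtain B where B: "\<And>s. s \<in> U \<Longrightarrow> norm (f s) \<le> B" unfolding bounded_iff by auto
    have "norm (h z) \<le> B" if "z \<in> double_wedge \<theta>" for z
    proof -
      have "slice_embed J z \<in> U" using dom[OF that] J by (simp add: slice_dom_def slice_embed_def)
      then show ?thesis using B rep[OF J that] J by fastforce
    qed
    then show ?thesis by blast
  qed
  have hol: "h field_differentiable (at z)" if z: "z \<in> double_wedge \<theta>" for z
  proof -
    let ?p = "(Re z, Im z)"
    obtain A where A: "(f0 has_derivative blinfun_apply A) (at ?p)"
      using comp dom[OF z] unfolding slice_components_def cont_differentiable_on_def by blast
    obtain B where B: "(f1 has_derivative blinfun_apply B) (at ?p)"
      using comp dom[OF z] unfolding slice_components_def cont_differentiable_on_def by blast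
    have pd: "pd_x f0 ?p = pd_y f1 ?p" "pd_y f0 ?p = - pd_x f1 ?p"
      using comp dom[OF z] unfolding slice_components_def by blast+
    then have CR: "A (1, 0) = B (0, 1)" "A (0, 1) = - B (1, 0)"
      unfolding pd_x_def pd_y_def using frechet_derivative_at[OF A] frechet_derivative_at[OF B] by simp_all
    have lin: "blinfun_apply A (x, y) = x *\<^sub>R A (1, 0) + y *\<^sub>R A (0, 1)"
      "blinfun_apply B (x, y) = x *\<^sub>R B (1, 0) + y *\<^sub>R B (0, 1)" for x y
      by (simp_all flip: blinfun.scaleR_right blinfun.add_right)
    \<comment> \<open>The Cauchy-Riemann equations leave two real coefficients, the scalar parts of
      \<open>A (1, 0)\<close> and \<open>B (1, 0)\<close>; they are the real and imaginary part of
      the complex derivative.\<close>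
    have lin: "A (Re d, Im d) $ {} = Re d * (A (1, 0) $ {}) - Im d * (B (1, 0) $ {})"
      "B (Re d, Im d) $ {} = Re d * (B (1, 0) $ {}) + Im d * (A (1, 0) $ {})" for d
      unfolding lin[of "Re d" "Im d"] using CR by simp_all
    have der_p: "((\<lambda>z. (Re z, Im z)) has_derivative (\<lambda>d. (Re d, Im d))) (at z)"
      by (intro derivative_intros)
    have nth: "bounded_linear (\<lambda>v. (v :: 'n clif) $ {})" by (rule bounded_linear_vec_nth)
    have 1: "((\<lambda>z. f0 (Re z, Im z) $ {}) has_derivative (\<lambda>d. A (Re d, Im d) $ {})) (at z)"
      using bounded_linear.has_derivative[OF nth has_derivative_compose[OF der_p A]] by simp
    have 2: "((\<lambda>z. f1 (Re z, Im z) $ {}) has_derivative (\<lambda>d. B (Re d, Im d) $ {})) (at z)"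
      using bounded_linear.has_derivative[OF nth has_derivative_compose[OF der_p B]] by simp
    have hc: "h = (\<lambda>z. of_real (f0 (Re z, Im z) $ {}) + \<i> * of_real (f1 (Re z, Im z) $ {}))"
      by (auto simp: h_def complex_eq_iff)
    have "(h has_derivative (\<lambda>d. of_real (A (Re d, Im d) $ {}) + \<i> * of_real (B (Re d, Im d) $ {}))) (at z)"
      unfolding hc by (intro has_derivative_add has_derivative_mult_right has_derivative_of_real 1 2)
    also have "(\<lambda>d. of_real (A (Re d, Im d) $ {}) + \<i> * of_real (B (Re d, Im d) $ {})) =
      (*) (Complex (A (1, 0) $ {}) (B (1, 0) $ {}))"
      by (auto simp: fun_eq_iff complex_eq_iff lin algebra_simps)
    finally show ?thesis unfolding field_differentiable_def has_field_derivative_def by blast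
  qed
  have int: "(\<lambda>t. norm (h (of_real t * cis \<phi>)) / t) integrable_on {0<..}" if \<phi>: "\<phi> \<in> bisector_angles \<theta>" for \<phi>
  proof -
    have "set_integrable lborel {0<..} (\<lambda>t. norm (f (t *\<^sub>R slice_exp J \<phi>)) / t)"
      using f J \<phi> by (simp add: N0_def SH_L0_def)
    then have "(\<lambda>t. norm (f (t *\<^sub>R slice_exp J \<phi>)) / t) integrable_on {0<..}"
      by (rule set_borel_integral_eq_integral(1))
    then show ?thesis
    proof (rule integrable_eq)
      fix t :: real assume t: "t \<in> {0<..}"
      then have "of_real t * cis \<phi> \<in> double_wedge \<theta>"
        using bisector_angle_tan[OF \<theta> \<phi>] by (simp add: double_wedge_def abs_mult)
      then show "norm (f (t *\<^sub>R slice_exp J \<phi>)) / t = norm (h (of_real t * cis \<phi>)) / t"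
        by (simp add: scaleR_slice_exp rep[OF J] J)
    qed
  qed
  obtain B where B: "\<And>z. z \<in> double_wedge \<theta> \<Longrightarrow> norm (h z) \<le> B" using bnd by blast
  have "open (double_wedge \<theta>)" unfolding double_wedge_def by (intro open_Collect_less continuous_intros)
  then have "h holomorphic_on double_wedge \<theta>"
    using hol by (simp add: holomorphic_on_open field_differentiable_def)
  then show ?thesis using that rep sym B int by blast
qed

text \<open>The polynomial Q_s vanishes at a complex number exactly if that number is one of the two
  points representing the sphere of \<open>s\<close>. Spectral points are thus found up to
  conjugation.\<close>

lemma quadratic_roots:
  fixes \<mu> z :: complex
  shows "\<mu>\<^sup>2 - of_real (2 * Re z) * \<mu> + of_real ((norm z)\<^sup>2) = (\<mu> - z) * (\<mu> - cnj z)"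
proof -
  have "of_real (2 * Re z) = z + cnj z" "of_real ((norm z)\<^sup>2) = z * cnj z"
    by (simp_all add: complex_add_cnj complex_norm_square[symmetric])
  then show ?thesis by (simp add: power2_eq_square algebra_simps)
qed

section \<open>Right-linear bounded operators\<close>

definition right_linear_endos :: "('v::banach, 'n::{finite,linorder}) cmodule endo set"
  where "right_linear_endos = {X. \<forall>v a. endo_apply X (v *\<^sub>r a) = endo_apply X v *\<^sub>r a}"

lemma subspace_right_linear_endos: "subspace right_linear_endos"
  by (auto simp: subspace_def right_linear_endos_def clif_rmult_simps)
    (metis clif_rmult_simps(6) scaleR_zero_left)

lemma closed_right_linear_endos:
  "closed (right_linear_endos :: ('v::banach, 'n::{finite,linorder}) cmodule endo set)"
proof -
  have lin: "bounded_linear (\<lambda>X. endo_apply X v)" for v :: "('v, 'n) cmodule"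
    by (rule bounded_linear_intro[where K="norm v"]) (auto simp: norm_endo_apply)
  have eq: "right_linear_endos = (\<Inter>v :: ('v, 'n) cmodule. \<Inter>a. {X. endo_apply X (v *\<^sub>r a) = endo_apply X v *\<^sub>r a})"
    by (auto simp: right_linear_endos_def)
  show ?thesis unfolding eq
    by (intro closed_INT ballI closed_Collect_eq linear_continuous_on[OF lin]
        linear_continuous_on[OF bounded_linear_compose[OF bounded_linear_clif_rmult lin]])
qed

text \<open>For an everywhere defined operator \<open>Q_op\<close> is a polynomial in
  \<open>X\<close> inside the algebra of bounded operators, and a bounded inverse is an inverse in
  that algebra. Right linearity of the inverse is inherited from \<open>X\<close>.\<close>

lemma S_resolvent_UNIV:
  fixes X :: "('v::banach, 'n::{finite,linorder}) cmodule endo"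
  defines "Q \<equiv> \<lambda>p. X * X - (2 * sc p) *\<^sub>R X + (norm p)\<^sup>2 *\<^sub>R 1"
  assumes X: "X \<in> right_linear_endos" and p: "p \<in> paravectors"
  shows "p \<in> S_resolvent_set UNIV (endo_apply X) \<longleftrightarrow> (\<exists>y. Q p * y = 1 \<and> y * Q p = 1)"
proof -
  let ?q = "Q_op (endo_apply X) p"
  have Q: "?q v = endo_apply (Q p) v" for v by (simp add: Q_op_def Q_def)
  have dom: "dom_sq UNIV (endo_apply X) = UNIV" by (auto simp: dom_sq_def)
  show ?thesis
  proof
    assume "p \<in> S_resolvent_set UNIV (endo_apply X)"
    then have bij: "bij ?q" and b: "bounded_linear (inv ?q)"
      by (auto simp: S_resolvent_set_def dom Q_inv_def bounded_rlinear_def)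
    have "?q (inv ?q v) = v" "inv ?q (?q v) = v" for v
      using bij by (simp_all add: bij_is_surj surj_f_inv_f bij_is_inj)
    then have "Q p * endo_fun (inv ?q) = 1" "endo_fun (inv ?q) * Q p = 1"
      using b by (auto intro!: endo_eqI simp flip: Q)
    then show "\<exists>y. Q p * y = 1 \<and> y * Q p = 1" by blast
  next
    assume "\<exists>y. Q p * y = 1 \<and> y * Q p = 1"
    then obtain y where y: "Q p * y = 1" "y * Q p = 1" by blast
    have y': "?q (endo_apply y v) = v" "endo_apply y (?q v) = v" for v
      unfolding Q using y by (metis endo_apply_simps(5,6))+
    have bij: "bij ?q" by (rule bijI') (metis y')+
    have inv: "inv ?q = endo_apply y" using y' by (intro inv_equality) auto
    have "?q (v *\<^sub>r a) = ?q v *\<^sub>r a" for v a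
      using X by (simp add: Q_op_def right_linear_endos_def clif_rmult_simps)
    then have "endo_apply y (v *\<^sub>r a) = endo_apply y v *\<^sub>r a" for v a by (metis y')
    then show "p \<in> S_resolvent_set UNIV (endo_apply X)"
      using p bij bounded_linear_endo_apply[of y]
      by (simp add: S_resolvent_set_def dom Q_inv_def bounded_rlinear_def inv)
  qed
qed

section \<open>The resolvents of a bisectorial operator\<close>

locale bisectorial_operator =
  fixes D :: "('v::banach, 'n::{finite,linorder}) cmodule set"
    and T :: "('v, 'n) cmodule \<Rightarrow> ('v, 'n) cmodule"
    and \<omega> \<phi> :: real and J :: "'n clif"
  assumes T: "closed_rlinear D T" and \<omega>: "0 < \<omega>" "\<omega> < \<phi>" "\<phi> < pi / 2"
    and bisectorial: "bisectorial \<omega> D T" and J: "J \<in> unit_imag"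
begin

abbreviation "\<rho> \<equiv> S_resolvent_set D T"

lemma D_simps [simp]:
  "0 \<in> D" "v \<in> D \<Longrightarrow> w \<in> D \<Longrightarrow> v + w \<in> D" "v \<in> D \<Longrightarrow> v *\<^sub>r a \<in> D"
  "v \<in> D \<Longrightarrow> r *\<^sub>R v \<in> D" "v \<in> D \<Longrightarrow> w \<in> D \<Longrightarrow> v - w \<in> D"
proof -
  show 1: "0 \<in> D" "v \<in> D \<Longrightarrow> w \<in> D \<Longrightarrow> v + w \<in> D" "v \<in> D \<Longrightarrow> v *\<^sub>r a \<in> D" for v w a
    using T by (auto simp: closed_rlinear_def)
  show 2: "v \<in> D \<Longrightarrow> r *\<^sub>R v \<in> D" for v r using 1(3)[of v "r *\<^sub>R clif_one"] by (simp add: clif_rmult_simps)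
  show "v \<in> D \<Longrightarrow> w \<in> D \<Longrightarrow> v - w \<in> D" using 1(2)[of v "- 1 *\<^sub>R w"] 2[of w "-1"] by simp
qed

lemma T_simps [simp]:
  "v \<in> D \<Longrightarrow> w \<in> D \<Longrightarrow> T (v + w) = T v + T w" "v \<in> D \<Longrightarrow> T (v *\<^sub>r a) = T v *\<^sub>r a"
  "v \<in> D \<Longrightarrow> T (r *\<^sub>R v) = r *\<^sub>R T v" "v \<in> D \<Longrightarrow> w \<in> D \<Longrightarrow> T (v - w) = T v - T w"
proof -
  show 1: "v \<in> D \<Longrightarrow> w \<in> D \<Longrightarrow> T (v + w) = T v + T w" "v \<in> D \<Longrightarrow> T (v *\<^sub>r a) = T v *\<^sub>r a" for v w a
    using T by (auto simp: closed_rlinear_def)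
  show 2: "v \<in> D \<Longrightarrow> T (r *\<^sub>R v) = r *\<^sub>R T v" for v r using 1(2)[of v "r *\<^sub>R clif_one"] by (simp add: clif_rmult_simps)
  show "v \<in> D \<Longrightarrow> w \<in> D \<Longrightarrow> T (v - w) = T v - T w" using 1(1)[of v "- 1 *\<^sub>R w"] 2[of w "-1"] D_simps(4)[of w "-1"] by simp
qed

lemma Q_inv_props:
  assumes "s \<in> \<rho>"
  shows "Q_op T s (Q_inv D T s w) = w" "Q_inv D T s w \<in> D" "T (Q_inv D T s w) \<in> D"
    "v \<in> D \<Longrightarrow> T v \<in> D \<Longrightarrow> Q_inv D T s (Q_op T s v) = v"
    "bounded_linear (Q_inv D T s)" "Q_inv D T s (w *\<^sub>r a) = Q_inv D T s w *\<^sub>r a"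
proof -
  have bij: "bij_betw (Q_op T s) (dom_sq D T) UNIV" and b: "bounded_rlinear (Q_inv D T s)"
    using assms by (auto simp: S_resolvent_set_def)
  show "Q_op T s (Q_inv D T s w) = w"
    unfolding Q_inv_def using bij_betw_inv_into_right[OF bij] by simp
  have "Q_inv D T s w \<in> dom_sq D T"
    unfolding Q_inv_def using bij by (metis UNIV_I bij_betw_imp_surj_on inv_into_into)
  then show "Q_inv D T s w \<in> D" "T (Q_inv D T s w) \<in> D" by (auto simp: dom_sq_def)
  show "Q_inv D T s (Q_op T s v) = v" if "v \<in> D" "T v \<in> D"
    unfolding Q_inv_def using bij_betw_inv_into_left[OF bij] that by (simp add: dom_sq_def)
  show "bounded_linear (Q_inv D T s)" "Q_inv D T s (w *\<^sub>r a) = Q_inv D T s w *\<^sub>r a"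
    using b by (auto simp: bounded_rlinear_def)
qed

lemma resolvent_memI:
  assumes "s \<in> paravectors" "tan \<omega> * \<bar>sc s\<bar> < vec_norm s"
  shows "s \<in> \<rho>"
proof (rule ccontr)
  assume "s \<notin> \<rho>"
  then have "s \<in> closure (double_sector \<omega>)"
    using assms(1) bisectorial by (auto simp: bisectorial_def S_spectrum_def)
  then show False using closure_double_sector_bound[of \<omega> s] \<omega> assms(2) by simp
qed

lemma Q_op_cong: "sc s = sc s' \<Longrightarrow> norm s = norm s' \<Longrightarrow> Q_op T s = Q_op T s'"
  by (simp add: Q_op_def fun_eq_iff)

lemma resolvent_cong: "s' \<in> paravectors \<Longrightarrow> sc s = sc s' \<Longrightarrow> norm s = norm s' \<Longrightarrow> s \<in> \<rho> \<Longrightarrow> s' \<in> \<rho>"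
  unfolding S_resolvent_set_def Q_inv_def using Q_op_cong[of s s'] by simp

text \<open>\<open>P s\<close> and, below, \<open>R s\<close> are Q_s[T]^-1 and T Q_s[T]^-1, the
  constituents of the left S-resolvent. Unlike the S-resolvent itself, they depend only on the
  sphere of \<open>s\<close>, and on \<open>off_sector\<close> both lie in the commutative
  algebra.\<close>

definition P :: "'n clif \<Rightarrow> ('v, 'n) cmodule endo"
  where "P s = endo_fun (Q_inv D T s)"

definition R :: "'n clif \<Rightarrow> ('v, 'n) cmodule endo"
  where "R s = endo_fun (\<lambda>v. T (Q_inv D T s v))"

lemma P_cong: "sc s = sc s' \<Longrightarrow> norm s = norm s' \<Longrightarrow> P s = P s'"
  and R_cong: "sc s = sc s' \<Longrightarrow> norm s = norm s' \<Longrightarrow> R s = R s'"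
  unfolding P_def R_def Q_inv_def using Q_op_cong[of s s'] by simp_all

text \<open>A region where the resolvent estimate holds, written through real and vector part. It
  contains \<open>J\<close> and, except for 0, the integration path, which runs along its
  boundary.\<close>

definition off_sector :: "'n clif set"
  where "off_sector = {s \<in> paravectors. s \<noteq> 0 \<and> tan \<phi> * \<bar>sc s\<bar> \<le> vec_norm s}"

lemma off_sector_resolvent: "s \<in> off_sector \<Longrightarrow> s \<in> \<rho>"
proof (rule resolvent_memI)
  assume s: "s \<in> off_sector"
  then show "s \<in> paravectors" by (simp add: off_sector_def)
  show "tan \<omega> * \<bar>sc s\<bar> < vec_norm s"
  proof (cases "sc s = 0")
    case True
    then have "vec_norm s \<noteq> 0" using s norm_square_eq[of s] by (auto simp: off_sector_def)
    then show ?thesis using True by (simp add: vec_norm_def)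
  next
    case False
    have "tan \<omega> < tan \<phi>" using \<omega> by (intro tan_monotone) auto
    then have "tan \<omega> * \<bar>sc s\<bar> < tan \<phi> * \<bar>sc s\<bar>" using False by (intro mult_strict_right_mono) auto
    then show ?thesis using s by (auto simp: off_sector_def)
  qed
qed

lemma S_left_resolvent_bound:
  obtains C where "C \<ge> 0"
    "\<And>s. s \<in> off_sector \<Longrightarrow> bounded_linear (S_left_resolvent D T s)"
    "\<And>s. s \<in> off_sector \<Longrightarrow> onorm (S_left_resolvent D T s) \<le> C / norm s"
proof -
  obtain C where C: "C \<ge> 0" "\<And>s. s \<in> paravectors - (double_sector \<phi> \<union> {0}) \<Longrightarrow>
      bounded_linear (S_left_resolvent D T s) \<and> onorm (S_left_resolvent D T s) \<le> C / norm s"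
    using bisectorial \<omega> unfolding bisectorial_def by (meson greaterThanLessThan_iff)
  have "s \<in> paravectors - (double_sector \<phi> \<union> {0})" if "s \<in> off_sector" for s
    using that double_sector_bound[of \<phi> s] \<omega> by (auto simp: off_sector_def)
  then show ?thesis using that C by blast
qed

lemma J_off_sector: "J \<in> off_sector"
proof -
  have "J = slice_pt J 0 1" by (simp add: slice_pt_def)
  then have "vec_norm J = 1" "sc J = 0" using J vec_norm_slice_pt[OF J, of 0 1] sc_slice_pt[OF J, of 0 1] by simp_all
  moreover have "J \<noteq> 0" "J \<in> paravectors" using J by (auto simp: unit_imag_def)
  ultimately show ?thesis by (simp add: off_sector_def)
qed

lemma P_apply: "s \<in> \<rho> \<Longrightarrow> endo_apply (P s) = Q_inv D T s"
  by (simp add: P_def Q_inv_props)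

text \<open>Boundedness of the left S-resolvent is part of bisectoriality, and T Q_s[T]^-1 is what
  remains when the S-resolvent is subtracted from the bounded operator Q_s[T]^-1 composed with left
  multiplication by the conjugate of \<open>s\<close>.\<close>

lemma bounded_linear_TQ_inv:
  assumes s: "s \<in> off_sector"
  shows "bounded_linear (\<lambda>v. T (Q_inv D T s v))"
proof -
  have "(\<lambda>v. T (Q_inv D T s v)) = (\<lambda>v. Q_inv D T s (pv_cnj s *\<^sub>l v) - S_left_resolvent D T s v)"
    by (simp add: S_left_resolvent_def)
  moreover have "bounded_linear (S_left_resolvent D T s)" using S_left_resolvent_bound s by blast
  ultimately show ?thesis
    using bounded_linear_sub[OF bounded_linear_compose[OF Q_inv_props(5)[OF off_sector_resolvent[OF s]] bounded_linear_clif_lmult[of "pv_cnj s"]]]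
    by simp
qed

lemma R_apply: "s \<in> off_sector \<Longrightarrow> endo_apply (R s) = (\<lambda>v. T (Q_inv D T s v))"
  by (simp add: R_def bounded_linear_TQ_inv)

text \<open>Since \<open>Q\<^sub>J[T] = 1 + T\<^sup>2\<close>, these are \<open>(1 + T\<^sup>2)\<^sup>-\<^sup>1\<close> and \<open>T (1 + T\<^sup>2)\<^sup>-\<^sup>1\<close>.\<close>

abbreviation "A \<equiv> P J"
abbreviation "B \<equiv> R J"

lemma J_res [simp]: "J \<in> \<rho>" by (rule off_sector_resolvent[OF J_off_sector])

lemma J_sc_norm: "sc J = 0" "norm J = 1" using J by (auto simp: unit_imag_def)

lemma A_facts:
  "endo_apply A w \<in> D" "T (endo_apply A w) = endo_apply B w" "endo_apply B w \<in> D"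
  "T (endo_apply B w) = w - endo_apply A w"
  using Q_inv_props[OF J_res] Q_inv_props(1)[OF J_res, of w]
  by (simp_all add: J_off_sector P_apply R_apply) (simp add: Q_op_def J_sc_norm algebra_simps eq_diff_eq)

lemma A_surj:
  assumes "v \<in> D" "T v \<in> D"
  shows "v = endo_apply A (v + T (T v))"
  using Q_inv_props(4)[OF J_res assms] by (simp add: P_apply Q_op_def J_sc_norm add.commute)

text \<open>The vector \<open>T (A v)\<close> lies in the domain of T^2, so \<open>A_surj\<close>
  recovers it from its image under 1 + T^2, and this image is \<open>T v\<close>.\<close>

lemma A_T: "v \<in> D \<Longrightarrow> endo_apply A (T v) = endo_apply B v"
proof -
  assume v: "v \<in> D"
  let ?w = "endo_apply A v"
  have "T ?w \<in> D" "T (T ?w) \<in> D" using v by (simp_all add: A_facts)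
  from A_surj[OF this] have "T ?w = endo_apply A (T ?w + T (T (T ?w)))" .
  moreover have "T ?w + T (T (T ?w)) = T v" using v by (simp add: A_facts)
  ultimately show ?thesis using A_facts(2)[of v] by metis
qed

section \<open>The commutative algebra attached to the operator\<close>

definition Jr :: "('v, 'n) cmodule endo" where "Jr = endo_fun (\<lambda>v. v *\<^sub>r J)"

lemma Jr_apply [simp]: "endo_apply Jr v = v *\<^sub>r J"
  by (simp add: Jr_def bounded_linear_clif_rmult)

definition \<A> :: "('v, 'n) cmodule endo set"
  where "\<A> = commutant (commutant {A, B, Jr})"

sublocale alg: complex_subalgebra \<A> Jr
  unfolding \<A>_def
proof (rule complex_subalgebra_bicommutant)
  have "A * B = B * A"
    by (rule endo_eqI) (simp only: endo_apply_simps A_facts(2)[symmetric] A_T A_facts(1))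
  moreover have "A * Jr = Jr * A"
    by (rule endo_eqI) (simp add: Q_inv_props(6) P_apply)
  moreover have "B * Jr = Jr * B"
    by (rule endo_eqI) (simp add: Q_inv_props J_off_sector R_apply)
  ultimately show "x * y = y * x" if "x \<in> {A, B, Jr}" "y \<in> {A, B, Jr}" for x y using that by auto
  show "Jr \<in> {A, B, Jr}" by simp
  show "Jr * Jr = - 1"
    by (rule endo_eqI) (simp add: clif_rmult_assoc unit_imag_square[OF J] clif_rmult_simps)
qed

lemma A_mem [simp]: "A \<in> \<A>" and B_mem [simp]: "B \<in> \<A>"
  unfolding \<A>_def by (rule subsetD[OF commutant_subset], simp)+

text \<open>The identity T^2 (1 + T^2)^-2 = (1 + T^2)^-1 - (1 + T^2)^-2, which ties the two scalars
  of an ideal together.\<close>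

lemma B_square: "B * B = A - A * A"
proof (rule endo_eqI)
  fix v
  have "endo_apply B (endo_apply B v) = T (endo_apply A (T (endo_apply A v)))"
    by (simp add: A_facts)
  also have "\<dots> = T (endo_apply B (endo_apply A v))"
    by (simp add: A_T A_facts(1))
  also have "\<dots> = endo_apply A v - endo_apply A (endo_apply A v)" by (rule A_facts(4))
  finally show "endo_apply (B * B) v = endo_apply (A - A * A) v" by (simp)
qed

text \<open>Vectors in the domain of T^2 have the form \<open>A w\<close>, and \<open>T\<close> and
  T^2 send them to \<open>B w\<close> and \<open>w - A w\<close>. Commuting with \<open>A\<close>
  and \<open>B\<close> therefore means commuting with \<open>T\<close> there.\<close>

lemma commutant_T:
  assumes X: "X \<in> commutant {A, B, Jr}" and v: "v \<in> D" "T v \<in> D"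
  shows "endo_apply X v \<in> D" "T (endo_apply X v) = endo_apply X (T v)"
    "T (endo_apply X v) \<in> D" "T (endo_apply X (T v)) = endo_apply X (T (T v))"
proof -
  define w where "w = v + T (T v)"
  have v': "v = endo_apply A w" using A_surj[OF v] by (simp add: w_def)
  have XA: "endo_apply X (endo_apply A u) = endo_apply A (endo_apply X u)"
    and XB: "endo_apply X (endo_apply B u) = endo_apply B (endo_apply X u)" for u
  proof -
    have "X * A = A * X" "X * B = B * X" using X unfolding commutant_def by blast+
    then show "endo_apply X (endo_apply A u) = endo_apply A (endo_apply X u)"
      "endo_apply X (endo_apply B u) = endo_apply B (endo_apply X u)" for u
      by (metis endo_apply_simps(5))+
  qed
  show 1: "endo_apply X v \<in> D" "T (endo_apply X v) = endo_apply X (T v)"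
    unfolding v' XA by (simp_all add: A_facts XB)
  show "T (endo_apply X v) \<in> D" unfolding v' XA by (simp add: A_facts)
  show "T (endo_apply X (T v)) = endo_apply X (T (T v))"
    unfolding v' by (simp add: A_facts XA XB)
qed

lemma commutant_Q_inv:
  assumes X: "X \<in> commutant {A, B, Jr}" and s: "s \<in> \<rho>"
  shows "Q_inv D T s (endo_apply X u) = endo_apply X (Q_inv D T s u)"
proof -
  let ?v = "Q_inv D T s u"
  note v = Q_inv_props[OF s]
  have "Q_op T s (endo_apply X ?v) = endo_apply X (Q_op T s ?v)"
    unfolding Q_op_def using commutant_T[OF X v(2,3)] by simp
  then have "Q_inv D T s (endo_apply X u) = Q_inv D T s (Q_op T s (endo_apply X ?v))" by (simp add: v)
  also have "\<dots> = endo_apply X ?v" by (intro v(4) commutant_T[OF X v(2,3)])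
  finally show ?thesis .
qed

lemma P_mem [simp]: "P s \<in> \<A>" if s: "s \<in> \<rho>"
proof -
  have "P s * X = X * P s" if "X \<in> commutant {A, B, Jr}" for X
    by (rule endo_eqI) (simp add: commutant_Q_inv[OF that s] P_apply s)
  then show ?thesis unfolding \<A>_def commutant_def[of "commutant {A, B, Jr}"] by blast
qed

lemma R_mem [simp]: "R s \<in> \<A>" if s: "s \<in> off_sector"
proof -
  note s' = off_sector_resolvent[OF s]
  have "R s * X = X * R s" if "X \<in> commutant {A, B, Jr}" for X
    by (rule endo_eqI)
      (simp add: commutant_Q_inv[OF that s'] commutant_T[OF that Q_inv_props(2,3)[OF s']] R_apply s)
  then show ?thesis unfolding \<A>_def commutant_def[of "commutant {A, B, Jr}"] by blast
qed

text \<open>\<open>N s\<close> is the bounded operator \<open>Q\<^sub>s[T] (1 + T\<^sup>2)\<^sup>-\<^sup>1\<close>.\<close>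

definition N :: "'n clif \<Rightarrow> ('v, 'n) cmodule endo"
  where "N s = 1 + ((norm s)\<^sup>2 - 1) *\<^sub>R A - (2 * sc s) *\<^sub>R B"

lemma N_mem [simp]: "N s \<in> \<A>" by (simp add: N_def)

lemma Q_op_A: "Q_op T s (endo_apply A w) = endo_apply (N s) w"
  by (simp add: Q_op_def N_def A_facts algebra_simps)

lemma P_N: "s \<in> \<rho> \<Longrightarrow> P s * N s = A"
proof (rule endo_eqI)
  fix v assume s: "s \<in> \<rho>"
  have "endo_apply (P s * N s) v = Q_inv D T s (Q_op T s (endo_apply A v))"
    using s by (simp only: endo_apply_simps Q_op_A P_apply)
  also have "\<dots> = endo_apply A v" by (intro Q_inv_props(4)[OF s]) (simp_all only: A_facts)
  finally show "endo_apply (P s * N s) v = endo_apply A v" .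
qed

lemma R_N: "s \<in> off_sector \<Longrightarrow> R s * N s = B"
proof (rule endo_eqI)
  fix v assume s: "s \<in> off_sector"
  have "endo_apply (R s * N s) v = T (endo_apply (P s * N s) v)"
    using s by (simp add: off_sector_resolvent P_apply R_apply)
  also have "\<dots> = endo_apply B v" using s by (simp only: P_N off_sector_resolvent A_facts)
  finally show "endo_apply (R s * N s) v = endo_apply B v" .
qed

text \<open>If \<open>y\<close> inverted \<open>N s\<close>, then \<open>A * y\<close> would invert
  Q_s[T]: from the right because Q_s[T] A is \<open>N s\<close>, and from the left because the
  domain of T^2 is the range of \<open>A\<close>.\<close>

lemma N_singular:
  assumes s: "s \<in> paravectors" "s \<notin> \<rho>" and y: "y \<in> \<A>"
  shows "N s * y \<noteq> 1"
proof
  assume Ny: "N s * y = 1"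
  then have yN: "y * N s = 1" using alg.commute[OF N_mem y] by simp
  have Ny': "endo_apply (N s) (endo_apply y w) = w" and yN': "endo_apply y (endo_apply (N s) w) = w" for w
    using Ny yN by (metis endo_apply_simps(5,6))+
  have dom: "endo_apply A w \<in> dom_sq D T" for w unfolding dom_sq_def by (simp only: mem_Collect_eq A_facts simp_thms)
  have inj: "inj_on (Q_op T s) (dom_sq D T)"
  proof (rule inj_onI)
    fix u v assume uv: "u \<in> dom_sq D T" "v \<in> dom_sq D T" "Q_op T s u = Q_op T s v"
    obtain u' v' where uv': "u = endo_apply A u'" "v = endo_apply A v'"
      using A_surj uv unfolding dom_sq_def by blast
    then have "endo_apply (N s) u' = endo_apply (N s) v'" using uv(3) by (simp only: Q_op_A)
    then show "u = v" using yN' uv' by metis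
  qed
  have right: "Q_op T s (endo_apply A (endo_apply y w)) = w" for w by (simp only: Q_op_A Ny')
  have "range (\<lambda>w. Q_op T s (endo_apply A (endo_apply y w))) \<subseteq> Q_op T s ` dom_sq D T" using dom by blast
  then have bij: "bij_betw (Q_op T s) (dom_sq D T) UNIV"
    unfolding bij_betw_def using inj by (simp only: right) auto
  have Qi: "Q_inv D T s = endo_apply (A * y)"
  proof
    fix w
    have "Q_inv D T s (Q_op T s (endo_apply A (endo_apply y w))) = endo_apply A (endo_apply y w)"
      unfolding Q_inv_def by (rule inv_into_f_f[OF inj dom])
    then show "Q_inv D T s w = endo_apply (A * y) w" by (simp only: right endo_apply_simps)
  qed
  have "Q_inv D T s (v *\<^sub>r a) = Q_inv D T s v *\<^sub>r a" for v a
  proof -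
    let ?u = "Q_inv D T s v"
    have u: "?u \<in> dom_sq D T" "Q_op T s ?u = v" unfolding Qi endo_apply_simps by (rule dom right)+
    have "Q_op T s (?u *\<^sub>r a) = Q_op T s ?u *\<^sub>r a" and ua: "?u *\<^sub>r a \<in> dom_sq D T"
      using u(1) by (auto simp: dom_sq_def Q_op_def clif_rmult_simps)
    then have "Q_op T s (?u *\<^sub>r a) = v *\<^sub>r a" unfolding u(2) by simp
    then show ?thesis using inv_into_f_f[OF inj ua] unfolding Q_inv_def by simp
  qed
  then have "s \<in> \<rho>" unfolding S_resolvent_set_def bounded_rlinear_def
    using s bij bounded_linear_endo_apply[of "A * y"] by (simp add: Qi)
  then show False using s by simp
qed

text \<open>Two scalars govern everything: \<open>N s\<close> is affine in \<open>A\<close> and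
  \<open>B\<close>, so it is \<open>n s\<close> modulo \<open>M\<close>, and
  \<open>P s * N s = A\<close>, \<open>R s * N s = B\<close> express \<open>P s\<close> and
  \<open>R s\<close> by division.\<close>

lemma P_mod_ideal:
  assumes M: "alg.proper_ideal M" and \<alpha>: "A - alg.emb \<alpha> \<in> M" and \<beta>: "B - alg.emb \<beta> \<in> M"
  defines "n \<equiv> \<lambda>s. 1 + of_real ((norm s)\<^sup>2 - 1) * \<alpha> - of_real (2 * sc s) * \<beta>"
  shows "\<beta>\<^sup>2 = \<alpha> - \<alpha>\<^sup>2" "s \<in> \<rho> \<Longrightarrow> n s \<noteq> 0" "s \<in> \<rho> \<Longrightarrow> P s - alg.emb (\<alpha> / n s) \<in> M"
    "s \<in> off_sector \<Longrightarrow> R s - alg.emb (\<beta> / n s) \<in> M" "N s - alg.emb (n s) \<in> M"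
proof -
  note Mf = alg.ideal_facts[OF M]
  have sq: "B * B - alg.emb (\<beta> * \<beta>) \<in> M" "A * A - alg.emb (\<alpha> * \<alpha>) \<in> M"
    unfolding alg.emb_mult
    by (rule alg.ideal_cong_mult[OF M \<beta> \<beta>] alg.ideal_cong_mult[OF M \<alpha> \<alpha>]; simp)+
  have "(B * B - alg.emb (\<beta> * \<beta>)) - ((A - alg.emb \<alpha>) - (A * A - alg.emb (\<alpha> * \<alpha>))) \<in> M"
    by (rule Mf(7)[OF sq(1) Mf(7)[OF \<alpha> sq(2)]])
  moreover have "(B * B - alg.emb (\<beta> * \<beta>)) - ((A - alg.emb \<alpha>) - (A * A - alg.emb (\<alpha> * \<alpha>)))
      = alg.emb (\<alpha> - \<alpha> * \<alpha> - \<beta> * \<beta>)"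
    by (simp add: B_square alg.emb_diff)
  ultimately show b: "\<beta>\<^sup>2 = \<alpha> - \<alpha>\<^sup>2"
    using alg.proper_ideal_emb_iff[OF M, of "\<alpha> - \<alpha> * \<alpha> - \<beta> * \<beta>"] by (simp add: power2_eq_square)
  have N: "N s - alg.emb (n s) \<in> M" for s
  proof -
    have "N s - alg.emb (n s) = ((norm s)\<^sup>2 - 1) *\<^sub>R (A - alg.emb \<alpha>) - (2 * sc s) *\<^sub>R (B - alg.emb \<beta>)"
      unfolding N_def n_def alg.emb_add alg.emb_diff alg.emb_mult alg.emb_of_real by (simp add: algebra_simps)
    then show ?thesis using Mf(7)[OF Mf(8)[OF \<alpha>] Mf(8)[OF \<beta>]] by metis
  qed
  then show "N s - alg.emb (n s) \<in> M" .
  have P1: "alg.emb (n s) * P s - alg.emb \<alpha> \<in> M" if s: "s \<in> \<rho>" for s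
  proof -
    have "(A - alg.emb \<alpha>) - P s * (N s - alg.emb (n s)) \<in> M" using s by (intro Mf(7)[OF \<alpha>] Mf(5)[OF _ N]) auto
    moreover have "(A - alg.emb \<alpha>) - P s * (N s - alg.emb (n s)) = alg.emb (n s) * P s - alg.emb \<alpha>"
      using P_N[OF s] s by (simp add: right_diff_distrib alg.commute[of "P s" "alg.emb (n s)"])
    ultimately show ?thesis by simp
  qed
  \<comment> \<open>A zero of \<open>n s\<close> would give \<open>\<alpha> = 0\<close> by
    \<open>P1\<close>, then \<open>\<beta> = 0\<close> by the relation between the scalars, and then
    \<open>n s = 1\<close>.\<close>
  have n0: "n s \<noteq> 0" if s: "s \<in> \<rho>" for s
  proof
    assume 0: "n s = 0"
    then have "alg.emb (- \<alpha>) \<in> M" using P1[OF s] by (simp add: alg.emb_minus)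
    then have "\<alpha> = 0" unfolding alg.proper_ideal_emb_iff[OF M] by simp
    then show False using b 0 by (simp add: n_def)
  qed
  then show "s \<in> \<rho> \<Longrightarrow> n s \<noteq> 0" .
  have div: "X - alg.emb (c / n s) \<in> M" if "alg.emb (n s) * X - alg.emb c \<in> M" "s \<in> \<rho>" for X s c
  proof -
    have "alg.emb (1 / n s) * (alg.emb (n s) * X - alg.emb c) \<in> M" using that by (intro Mf(5)) auto
    also have "alg.emb (1 / n s) * (alg.emb (n s) * X - alg.emb c) = X - alg.emb (c / n s)"
      using n0[OF that(2)] by (simp add: right_diff_distrib flip: mult.assoc alg.emb_mult)
    finally show ?thesis .
  qed
  show "s \<in> \<rho> \<Longrightarrow> P s - alg.emb (\<alpha> / n s) \<in> M" using div P1 by blast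
  show "R s - alg.emb (\<beta> / n s) \<in> M" if s: "s \<in> off_sector"
  proof -
    have "(B - alg.emb \<beta>) - R s * (N s - alg.emb (n s)) \<in> M" using s by (intro Mf(7)[OF \<beta>] Mf(5)[OF _ N]) auto
    moreover have "(B - alg.emb \<beta>) - R s * (N s - alg.emb (n s)) = alg.emb (n s) * R s - alg.emb \<beta>"
      using R_N[OF s] s by (simp add: right_diff_distrib alg.commute[of "R s" "alg.emb (n s)"])
    ultimately show ?thesis using div off_sector_resolvent[OF s] by simp
  qed
qed

section \<open>The functional calculus modulo an ideal\<close>

text \<open>The path in the complex coordinate of its slice, written so that \<open>t\<close> and
  \<open>- t\<close> visibly give conjugate points.\<close>

definition zpath :: "real \<Rightarrow> real \<Rightarrow> complex"
  where "zpath \<epsilon> t = Complex (\<epsilon> * \<bar>t\<bar> * cos \<phi>) (- (\<epsilon> * t * sin \<phi>))"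

abbreviation spath :: "real \<Rightarrow> real \<Rightarrow> 'n clif"
  where "spath \<epsilon> t \<equiv> slice_embed J (zpath \<epsilon> t)"

lemma cos_sin_pos: "cos \<phi> > 0" "sin \<phi> > 0"
  using \<omega> by (auto intro: cos_gt_zero sin_gt_zero)

lemma bisector_path_eq: "bisector_path J \<phi> \<epsilon> t = spath \<epsilon> t"
  by (cases "t = 0"; cases "t > 0")
    (simp_all add: bisector_path_def zpath_def slice_embed_def slice_exp_def slice_pt_def
      scaleR_add_right scaleR_diff_right mult.assoc)

lemma bisector_path_derivative:
  assumes "t \<noteq> 0"
  shows "vector_derivative (bisector_path J \<phi> \<epsilon>) (at t) =
    slice_embed J (Complex (\<epsilon> * sgn t * cos \<phi>) (- (\<epsilon> * sin \<phi>)))"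
proof (rule vector_derivative_at)
  have "((\<lambda>x. sgn t * x) has_real_derivative sgn t) (at t)"
    by (rule derivative_eq_intros refl | simp)+
  then have abs: "(abs has_real_derivative sgn t) (at t)"
    by (rule has_field_derivative_transform_within_open[of _ _ _ "{x. 0 < sgn t * x}"])
      (use assms in \<open>auto intro!: open_Collect_less continuous_intros simp: sgn_if split: if_splits\<close>)
  have eq: "bisector_path J \<phi> \<epsilon> = (\<lambda>t. (\<epsilon> * \<bar>t\<bar> * cos \<phi>) *\<^sub>R clif_one + (- (\<epsilon> * t * sin \<phi>)) *\<^sub>R J)"
    by (simp add: fun_eq_iff bisector_path_eq zpath_def slice_embed_def slice_pt_def)
  show "(bisector_path J \<phi> \<epsilon> has_vector_derivative
      slice_embed J (Complex (\<epsilon> * sgn t * cos \<phi>) (- (\<epsilon> * sin \<phi>)))) (at t)"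
  proof -
    have 1: "((\<lambda>t. \<epsilon> * \<bar>t\<bar> * cos \<phi>) has_real_derivative (\<epsilon> * sgn t * cos \<phi>)) (at t)"
      by (rule DERIV_cmult_right[OF DERIV_cmult[OF abs]])
    have 2: "((\<lambda>t. - (\<epsilon> * t * sin \<phi>)) has_real_derivative (- (\<epsilon> * sin \<phi>))) (at t)"
      by (auto intro!: derivative_eq_intros)
    show ?thesis unfolding eq slice_embed_def slice_pt_def complex.sel
      using has_vector_derivative_add[OF has_vector_derivative_scaleR[OF 1 has_vector_derivative_const[of clif_one]]
        has_vector_derivative_scaleR[OF 2 has_vector_derivative_const[of J]]] by simp
  qed
qed

lemma norm_zpath [simp]: "\<epsilon> \<in> {1, - 1} \<Longrightarrow> norm (zpath \<epsilon> t) = \<bar>t\<bar>"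
proof -
  assume "\<epsilon> \<in> {1, - 1}"
  then have "(norm (zpath \<epsilon> t))\<^sup>2 = t\<^sup>2 * (cos \<phi>)\<^sup>2 + t\<^sup>2 * (sin \<phi>)\<^sup>2"
    unfolding cmod_power2 zpath_def by (auto simp: power_mult_distrib)
  also have "\<dots> = t\<^sup>2 * ((cos \<phi>)\<^sup>2 + (sin \<phi>)\<^sup>2)" by (simp only: distrib_left)
  finally show ?thesis using real_sqrt_unique[of "norm (zpath \<epsilon> t)" "t\<^sup>2"] by simp
qed

lemma zpath_Im: "\<bar>Im (zpath \<epsilon> t)\<bar> = tan \<phi> * \<bar>Re (zpath \<epsilon> t)\<bar>"
  using cos_sin_pos by (simp add: zpath_def abs_mult tan_def)

lemma spath_off_sector: "\<epsilon> \<in> {1, - 1} \<Longrightarrow> t \<noteq> 0 \<Longrightarrow> spath \<epsilon> t \<in> off_sector"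
proof -
  assume *: "\<epsilon> \<in> {1, - 1}" "t \<noteq> 0"
  then have "norm (spath \<epsilon> t) \<noteq> 0" using J by simp
  then show ?thesis using J zpath_Im[of \<epsilon> t]
    by (auto simp: off_sector_def slice_embed_def)
qed

lemma sc_spath: "sc (spath \<epsilon> t) = \<epsilon> * \<bar>t\<bar> * cos \<phi>"
  using J by (simp add: slice_embed_def zpath_def)

lemma spath_minus: "P (spath \<epsilon> (- t)) = P (spath \<epsilon> t)" "R (spath \<epsilon> (- t)) = R (spath \<epsilon> t)"
  if "\<epsilon> \<in> {1, - 1}"
  by (rule P_cong R_cong; use that J in \<open>simp add: sc_spath\<close>)+

text \<open>At two conjugate points Q_s[T]^-1 is the same operator, so the difference of the two
  S-resolvents is Q_s[T]^-1 applied to a multiple of \<open>Im z *\<^sub>R J\<close>. Two estimates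
  of order 1/|t| and \<open>\<bar>Im z\<bar> = \<bar>t\<bar> * sin \<phi>\<close> thus bound
  \<open>P\<close> by order 1/t^2; the bound for \<open>R\<close> then follows from the definition
  of the S-resolvent.\<close>

lemma spath_bounds:
  obtains K where "K \<ge> 0"
    "\<And>\<epsilon> t. \<epsilon> \<in> {1, - 1} \<Longrightarrow> t \<noteq> 0 \<Longrightarrow> norm (P (spath \<epsilon> t)) \<le> K / t\<^sup>2"
    "\<And>\<epsilon> t. \<epsilon> \<in> {1, - 1} \<Longrightarrow> t \<noteq> 0 \<Longrightarrow> norm (R (spath \<epsilon> t)) \<le> K / \<bar>t\<bar>"
proof -
  obtain C where C: "C \<ge> 0"
    "\<And>s. s \<in> off_sector \<Longrightarrow> bounded_linear (S_left_resolvent D T s)"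
    "\<And>s. s \<in> off_sector \<Longrightarrow> onorm (S_left_resolvent D T s) \<le> C / norm s"
    by (rule S_left_resolvent_bound) blast
  have S: "norm (S_left_resolvent D T s v) \<le> C / norm s * norm v" if "s \<in> off_sector" for s v
    using onorm[OF C(2)[OF that], of v] mult_right_mono[OF C(3)[OF that] norm_ge_zero[of v]] by linarith
  obtain j where j: "j \<ge> 0" "\<And>v :: ('v, 'n) cmodule. norm (J *\<^sub>l v) \<le> norm v * j"
    using bounded_linear.nonneg_bounded[OF bounded_linear_clif_lmult[of J]] by blast
  have JJ: "J *\<^sub>l (J *\<^sub>l v) = - v" for v :: "('v, 'n) cmodule"
    using unit_imag_square[OF J] by (simp add: clif_lmult_simps flip: clif_lmult_assoc)
  define K1 where "K1 = C * j / sin \<phi>"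
  define K where "K = K1 * (1 + j) + C"
  have K1: "K1 \<ge> 0" using C(1) j(1) cos_sin_pos by (simp add: K1_def)
  then have K1': "K1 \<le> K" using C(1) j(1) by (simp add: K_def distrib_left)
  have PK: "norm (P (spath \<epsilon> t)) \<le> K1 / t\<^sup>2" and RK: "norm (R (spath \<epsilon> t)) \<le> K / \<bar>t\<bar>"
    if \<epsilon>: "\<epsilon> \<in> {1, - 1}" and t: "t \<noteq> 0" for \<epsilon> t
  proof -
    define z where "z = zpath \<epsilon> t"
    define s where "s = slice_embed J z"
    define s' where "s' = slice_embed J (cnj z)"
    have s: "s \<in> off_sector" unfolding s_def z_def by (rule spath_off_sector[OF \<epsilon> t])
    have eq: "cnj z = zpath \<epsilon> (- t)" by (simp add: z_def zpath_def complex_eq_iff)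
    have s': "s' \<in> off_sector" unfolding s'_def eq using spath_off_sector[OF \<epsilon>, of "- t"] t by simp
    have ns: "norm s = \<bar>t\<bar>" "norm s' = \<bar>t\<bar>" "sc s = sc s'"
      unfolding s_def s'_def z_def using J \<epsilon> by (simp, simp, simp add: slice_embed_def)
    have Qs: "Q_inv D T s' = Q_inv D T s" unfolding Q_inv_def using Q_op_cong[of s s'] ns by simp
    interpret Q: bounded_linear "Q_inv D T s" by (rule Q_inv_props(5)[OF off_sector_resolvent[OF s]])
    have imz: "\<bar>Im z\<bar> = \<bar>t\<bar> * sin \<phi>" using \<epsilon> cos_sin_pos by (auto simp: z_def zpath_def abs_mult)
    then have y: "Im z \<noteq> 0" using t cos_sin_pos by auto
    have Pb: "norm (Q_inv D T s u) \<le> K1 / t\<^sup>2 * norm u" for u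
    proof -
      \<comment> \<open>Chosen so that \<open>J *\<^sub>l v = u\<close>, which removes the left
        factor \<open>J\<close> from the difference.\<close>
      define v where "v = - (J *\<^sub>l u)"
      have "S_left_resolvent D T s v - S_left_resolvent D T s' v = Q_inv D T s (pv_cnj s *\<^sub>l v) - Q_inv D T s (pv_cnj s' *\<^sub>l v)"
        by (simp add: S_left_resolvent_def Qs)
      also have "\<dots> = Q_inv D T s ((pv_cnj s - pv_cnj s') *\<^sub>l v)" by (simp add: Q.diff clif_lmult_simps)
      also have "pv_cnj s - pv_cnj s' = (- 2 * Im z) *\<^sub>R J"
        unfolding s_def s'_def pv_cnj_slice_embed[OF J] by (simp add: slice_embed_def slice_pt_def vec_eq_iff algebra_simps)
      also have "((- 2 * Im z) *\<^sub>R J) *\<^sub>l v = (- 2 * Im z) *\<^sub>R u" by (simp add: clif_lmult_simps v_def JJ)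
      also have "Q_inv D T s ((- 2 * Im z) *\<^sub>R u) = (- 2 * Im z) *\<^sub>R Q_inv D T s u" by (rule Q.scaleR)
      finally have "2 * \<bar>Im z\<bar> * norm (Q_inv D T s u) = norm (S_left_resolvent D T s v - S_left_resolvent D T s' v)"
        by (simp add: abs_mult)
      also have "\<dots> \<le> C / \<bar>t\<bar> * norm v + C / \<bar>t\<bar> * norm v"
        using S[OF s, of v] S[OF s', of v] norm_triangle_ineq4[of "S_left_resolvent D T s v" "S_left_resolvent D T s' v"] ns by simp
      finally have "\<bar>Im z\<bar> * norm (Q_inv D T s u) \<le> C / \<bar>t\<bar> * norm v" by simp
      also have "\<dots> \<le> C / \<bar>t\<bar> * (norm u * j)" using C(1) j by (intro mult_left_mono) (auto simp: v_def)
      finally have "\<bar>t\<bar> * sin \<phi> * norm (Q_inv D T s u) \<le> C / \<bar>t\<bar> * (norm u * j)" unfolding imz .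
      then have "norm (Q_inv D T s u) \<le> C / \<bar>t\<bar> * (norm u * j) / (\<bar>t\<bar> * sin \<phi>)"
        using t cos_sin_pos by (simp add: pos_le_divide_eq mult_ac)
      also have "\<dots> = K1 / (\<bar>t\<bar> * \<bar>t\<bar>) * norm u"
        by (simp add: K1_def mult_ac del: abs_mult_self_eq)
      finally show ?thesis by (simp add: power2_eq_square)
    qed
    then show "norm (P (spath \<epsilon> t)) \<le> K1 / t\<^sup>2"
      using K1 off_sector_resolvent[OF s] unfolding s_def[unfolded z_def, symmetric]
      by (intro norm_endo_le) (auto simp: P_apply)
    have "norm (T (Q_inv D T s u)) \<le> K / \<bar>t\<bar> * norm u" for u
    proof -
      have "T (Q_inv D T s u) = Q_inv D T s (pv_cnj s *\<^sub>l u) - S_left_resolvent D T s u"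
        by (simp add: S_left_resolvent_def)
      then have "norm (T (Q_inv D T s u)) \<le> norm (Q_inv D T s (pv_cnj s *\<^sub>l u)) + norm (S_left_resolvent D T s u)"
        by (simp only: norm_triangle_ineq4)
      also have "\<dots> \<le> K1 / t\<^sup>2 * norm (pv_cnj s *\<^sub>l u) + C / \<bar>t\<bar> * norm u"
        using Pb[of "pv_cnj s *\<^sub>l u"] S[OF s, of u] ns by simp
      also have "\<dots> \<le> K1 / t\<^sup>2 * (\<bar>t\<bar> * (1 + j) * norm u) + C / \<bar>t\<bar> * norm u"
      proof (intro add_right_mono mult_left_mono)
        have "pv_cnj s *\<^sub>l u = Re z *\<^sub>R u - Im z *\<^sub>R (J *\<^sub>l u)"
          unfolding s_def pv_cnj_slice_embed[OF J] by (simp add: slice_embed_def slice_pt_def clif_lmult_simps)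
        then have "norm (pv_cnj s *\<^sub>l u) \<le> \<bar>Re z\<bar> * norm u + \<bar>Im z\<bar> * norm (J *\<^sub>l u)"
          using norm_triangle_ineq4[of "Re z *\<^sub>R u" "Im z *\<^sub>R (J *\<^sub>l u)"] by simp
        also have "\<dots> \<le> \<bar>t\<bar> * norm u + \<bar>t\<bar> * (norm u * j)"
          using abs_Re_le_cmod[of z] abs_Im_le_cmod[of z] norm_zpath[OF \<epsilon>, of t] j
          by (intro add_mono mult_mono) (auto simp: z_def)
        finally show "norm (pv_cnj s *\<^sub>l u) \<le> \<bar>t\<bar> * (1 + j) * norm u" by (simp add: algebra_simps)
      qed (use K1 in simp)
      also have "\<dots> = K / \<bar>t\<bar> * norm u"
      proof -
        have e: "t\<^sup>2 = \<bar>t\<bar> * \<bar>t\<bar>" by (simp add: power2_eq_square)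
        have "K1 / t\<^sup>2 * (\<bar>t\<bar> * (1 + j) * norm u) = K1 * (1 + j) / \<bar>t\<bar> * norm u"
          unfolding e using t by (simp del: abs_mult_self_eq)
        then show ?thesis by (simp add: K_def add_divide_distrib distrib_right)
      qed
      finally show ?thesis .
    qed
    then show "norm (R (spath \<epsilon> t)) \<le> K / \<bar>t\<bar>"
      using K1 K1' s unfolding s_def[unfolded z_def, symmetric]
      by (intro norm_endo_le) (auto simp: R_apply)
  qed
  show ?thesis
  proof (rule that[of K])
    show "K \<ge> 0" using K1 K1' by linarith
    show "norm (P (spath \<epsilon> t)) \<le> K / t\<^sup>2" if "\<epsilon> \<in> {1, - 1}" "t \<noteq> 0" for \<epsilon> t
      using PK[OF that] divide_right_mono[OF K1', of "t\<^sup>2"] by simp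
  qed (rule RK)
qed

lemma continuous_on_spath:
  assumes \<epsilon>: "\<epsilon> \<in> {1, - 1}"
  shows "continuous_on (- {0}) (\<lambda>t. P (spath \<epsilon> t))" "continuous_on (- {0}) (\<lambda>t. R (spath \<epsilon> t))"
proof -
  obtain K where K: "K \<ge> 0"
    "\<And>\<epsilon> t. \<epsilon> \<in> {1, - 1} \<Longrightarrow> t \<noteq> 0 \<Longrightarrow> norm (P (spath \<epsilon> t)) \<le> K / t\<^sup>2"
    "\<And>\<epsilon> t. \<epsilon> \<in> {1, - 1} \<Longrightarrow> t \<noteq> 0 \<Longrightarrow> norm (R (spath \<epsilon> t)) \<le> K / \<bar>t\<bar>"
    by (rule spath_bounds) blast
  \<comment> \<open>This is (Q_u[T] - Q_t[T]) Q_u[T]^-1, the subscripts standing for the path points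
    at these parameters; \<open>diff\<close> is the resulting resolvent identity.\<close>
  define E where "E t u = (2 * (sc (spath \<epsilon> t) - sc (spath \<epsilon> u))) *\<^sub>R R (spath \<epsilon> u) + (u\<^sup>2 - t\<^sup>2) *\<^sub>R P (spath \<epsilon> u)" for t u
  have diff: "P (spath \<epsilon> t) - P (spath \<epsilon> u) = P (spath \<epsilon> t) * E t u"
    "R (spath \<epsilon> t) - R (spath \<epsilon> u) = R (spath \<epsilon> t) * E t u" if t: "t \<noteq> 0" and u: "u \<noteq> 0" for t u
  proof -
    have ot: "spath \<epsilon> t \<in> off_sector" "spath \<epsilon> u \<in> off_sector" using spath_off_sector[OF \<epsilon>] t u by auto
    note rt = off_sector_resolvent[OF ot(1)] off_sector_resolvent[OF ot(2)]
    have n: "(norm (spath \<epsilon> t))\<^sup>2 = t\<^sup>2" "(norm (spath \<epsilon> u))\<^sup>2 = u\<^sup>2" using \<epsilon> J by simp_all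
    have main: "endo_apply (P (spath \<epsilon> t)) w - endo_apply (P (spath \<epsilon> u)) w = endo_apply (P (spath \<epsilon> t)) (endo_apply (E t u) w)" for w
    proof -
      define v where "v = Q_inv D T (spath \<epsilon> u) w"
      have v: "v \<in> D" "T v \<in> D" unfolding v_def by (rule Q_inv_props[OF rt(2)])+
      have "Q_op T (spath \<epsilon> t) v = Q_op T (spath \<epsilon> u) v - endo_apply (E t u) w"
        unfolding Q_op_def n E_def using rt ot by (simp add: v_def P_apply R_apply algebra_simps)
      also have "Q_op T (spath \<epsilon> u) v = w" unfolding v_def by (rule Q_inv_props(1)[OF rt(2)])
      finally have "endo_apply (P (spath \<epsilon> t)) (w - endo_apply (E t u) w) = v"
        using Q_inv_props(4)[OF rt(1) v] rt by (simp only: P_apply)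
      moreover have "v = endo_apply (P (spath \<epsilon> u)) w" using rt by (simp only: P_apply v_def)
      ultimately show ?thesis by (simp add: algebra_simps)
    qed
    show "P (spath \<epsilon> t) - P (spath \<epsilon> u) = P (spath \<epsilon> t) * E t u"
      by (rule endo_eqI) (simp add: main)
    have TP: "T (endo_apply (P (spath \<epsilon> t)) w) = endo_apply (R (spath \<epsilon> t)) w"
      "T (endo_apply (P (spath \<epsilon> u)) w) = endo_apply (R (spath \<epsilon> u)) w" for w
      using rt ot by (simp_all add: P_apply R_apply)
    have PD: "endo_apply (P (spath \<epsilon> t)) w \<in> D" "endo_apply (P (spath \<epsilon> u)) w \<in> D" for w
      using rt by (simp_all add: P_apply Q_inv_props)
    show "R (spath \<epsilon> t) - R (spath \<epsilon> u) = R (spath \<epsilon> t) * E t u"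
    proof (rule endo_eqI)
      fix w
      show "endo_apply (R (spath \<epsilon> t) - R (spath \<epsilon> u)) w = endo_apply (R (spath \<epsilon> t) * E t u) w"
        using arg_cong[OF main[of w], of T] PD by (simp add: TP)
    qed
  qed
  have lim: "((\<lambda>t. norm (E t u)) \<longlongrightarrow> 0) (at u within - {0})" for u
  proof -
    have "((\<lambda>t. norm ((2 * (\<epsilon> * \<bar>t\<bar> * cos \<phi> - \<epsilon> * \<bar>u\<bar> * cos \<phi>)) *\<^sub>R R (spath \<epsilon> u) + (u\<^sup>2 - t\<^sup>2) *\<^sub>R P (spath \<epsilon> u)))
      \<longlongrightarrow> norm ((2 * (\<epsilon> * \<bar>u\<bar> * cos \<phi> - \<epsilon> * \<bar>u\<bar> * cos \<phi>)) *\<^sub>R R (spath \<epsilon> u) + (u\<^sup>2 - u\<^sup>2) *\<^sub>R P (spath \<epsilon> u))) (at u within - {0})"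
      by (intro tendsto_intros)
    then show ?thesis by (simp add: E_def sc_spath)
  qed
  have K_cont: "continuous_on (- {0}) (\<lambda>t::real. K / t\<^sup>2)" "continuous_on (- {0}) (\<lambda>t::real. K / \<bar>t\<bar>)"
    by (intro continuous_intros; simp)+
  show "continuous_on (- {0}) (\<lambda>t. P (spath \<epsilon> t))"
    by (rule continuous_on_resolvent_type[OF _ _ K_cont(1) lim]) (use diff K \<epsilon> in auto)
  show "continuous_on (- {0}) (\<lambda>t. R (spath \<epsilon> t))"
    by (rule continuous_on_resolvent_type[OF _ _ K_cont(2) lim]) (use diff K \<epsilon> in auto)
qed

section \<open>The integrand of the functional calculus\<close>

definition Jl :: "('v, 'n) cmodule endo" where "Jl = endo_fun (\<lambda>v. J *\<^sub>l v)"

lemma Jl_apply [simp]: "endo_apply Jl v = J *\<^sub>l v"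
  by (simp add: Jl_def bounded_linear_clif_lmult)

text \<open>The complex coordinate of the derivative of the path, divided by \<open>J\<close> and
  multiplied by the function value; the first factor is \<open>- \<i>\<close> times the derivative
  of \<open>zpath\<close>.\<close>

definition path_coef :: "(complex \<Rightarrow> complex) \<Rightarrow> real \<Rightarrow> real \<Rightarrow> complex"
  where "path_coef h \<epsilon> t = Complex (- (\<epsilon> * sin \<phi>)) (- (\<epsilon> * sgn t * cos \<phi>)) * h (zpath \<epsilon> t)"

text \<open>The left S-resolvent after left multiplication by the coefficient \<open>a\<close>,
  split into real parts and parts along \<open>Jl\<close>. The coefficient \<open>b\<close> of
  Q_s[T]^-1 absorbs the conjugate of \<open>s\<close>.\<close>

definition path_op :: "(complex \<Rightarrow> complex) \<Rightarrow> real \<Rightarrow> real \<Rightarrow> ('v, 'n) cmodule endo"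
  where "path_op h \<epsilon> t = (let a = path_coef h \<epsilon> t; b = cnj (zpath \<epsilon> t) * a; s = spath \<epsilon> t in
    Re b *\<^sub>R P s + Im b *\<^sub>R (P s * Jl) - (Re a *\<^sub>R R s + Im a *\<^sub>R (R s * Jl)))"

lemma slice_embed_lmult: "slice_embed J z *\<^sub>l v = Re z *\<^sub>R v + Im z *\<^sub>R (J *\<^sub>l v)"
  by (simp add: slice_embed_def slice_pt_def clif_lmult_simps)

lemma clif_inv_J: "clif_inv J = slice_embed J (- \<i>)"
proof -
  have "clif_inv (slice_embed J \<i>) = slice_embed J (1 / \<i>)" by (rule clif_inv_slice_embed[OF J]) simp
  then show ?thesis by (simp add: slice_embed_simps)
qed

lemma zpath_double_wedge:
  assumes "\<epsilon> \<in> {1, - 1}" "t \<noteq> 0" "\<phi> < \<theta>" "\<theta> < pi / 2"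
  shows "zpath \<epsilon> t \<in> double_wedge \<theta>"
proof -
  have "\<bar>Re (zpath \<epsilon> t)\<bar> > 0" using assms cos_sin_pos by (auto simp: zpath_def)
  moreover have "tan \<phi> < tan \<theta>" using assms \<omega> by (intro tan_monotone) auto
  ultimately show ?thesis unfolding double_wedge_def mem_Collect_eq zpath_Im by (rule mult_strict_right_mono[rotated])
qed

lemma omega_integrand:
  assumes \<epsilon>: "\<epsilon> \<in> {1, - 1}" and t: "t \<noteq> 0" and \<theta>: "\<phi> < \<theta>" "\<theta> < pi / 2"
    and f: "\<And>z. z \<in> double_wedge \<theta> \<Longrightarrow> f (slice_embed J z) = slice_embed J (h z)"
  shows "(let \<gamma> = bisector_path J \<phi> \<epsilon>; \<gamma>' = vector_derivative \<gamma> (at t) in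
      Blinfun (\<lambda>v. S_left_resolvent D T (\<gamma> t) ((\<gamma>' *\<^sub>l clif_inv J *\<^sub>l f (\<gamma> t)) *\<^sub>l v))) = blinfun_of (path_op h \<epsilon> t)"
proof -
  let ?s = "spath \<epsilon> t"
  let ?a = "path_coef h \<epsilon> t"
  have s: "?s \<in> off_sector" by (rule spath_off_sector[OF \<epsilon> t])
  note sr = off_sector_resolvent[OF s]
  interpret Q: bounded_linear "Q_inv D T ?s" by (rule Q_inv_props(5)[OF sr])
  interpret TQ: bounded_linear "\<lambda>v. T (Q_inv D T ?s v)" by (rule bounded_linear_TQ_inv[OF s])
  have coef: "vector_derivative (bisector_path J \<phi> \<epsilon>) (at t) *\<^sub>l clif_inv J *\<^sub>l f (bisector_path J \<phi> \<epsilon> t) = slice_embed J ?a"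
  proof -
    have "Complex (\<epsilon> * sgn t * cos \<phi>) (- (\<epsilon> * sin \<phi>)) * (- \<i> * h (zpath \<epsilon> t)) = ?a"
      by (simp add: path_coef_def complex_eq_iff)
    then show ?thesis
      unfolding bisector_path_derivative[OF t] bisector_path_eq clif_inv_J f[OF zpath_double_wedge[OF \<epsilon> t \<theta>]]
      by (simp only: slice_embed_mult'[OF J])
  qed
  have "S_left_resolvent D T ?s (slice_embed J ?a *\<^sub>l v) = endo_apply (path_op h \<epsilon> t) v" for v
  proof -
    have "Q_inv D T ?s (slice_embed J b *\<^sub>l v) = Re b *\<^sub>R Q_inv D T ?s v + Im b *\<^sub>R Q_inv D T ?s (J *\<^sub>l v)" for b
      by (simp only: slice_embed_lmult Q.add Q.scaleR)
    moreover have "T (Q_inv D T ?s (slice_embed J b *\<^sub>l v)) = Re b *\<^sub>R T (Q_inv D T ?s v) + Im b *\<^sub>R T (Q_inv D T ?s (J *\<^sub>l v))" for b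
      by (simp only: slice_embed_lmult TQ.add TQ.scaleR)
    ultimately show ?thesis
      unfolding S_left_resolvent_def pv_cnj_slice_embed[OF J] slice_embed_mult[OF J] path_op_def Let_def
      by (simp add: P_apply[OF sr] R_apply[OF s])
  qed
  then have "(\<lambda>v. S_left_resolvent D T ?s (slice_embed J ?a *\<^sub>l v)) = endo_apply (path_op h \<epsilon> t)" by blast
  then show ?thesis
    unfolding Let_def coef unfolding bisector_path_eq[of \<epsilon> t] by (simp add: endo_apply.rep_eq blinfun_apply_inverse)
qed

text \<open>
  The contributions of \<open>t\<close> and \<open>- t\<close> are conjugate, so the left multiplication by \<open>J\<close>, which need not
  commute with \<open>T\<close>, cancels.
\<close>

lemma path_op_symmetric:
  assumes \<epsilon>: "\<epsilon> \<in> {1, - 1}" and t: "t \<noteq> 0" and \<theta>: "\<phi> < \<theta>" "\<theta> < pi / 2"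
    and sym: "\<And>z. z \<in> double_wedge \<theta> \<Longrightarrow> h (cnj z) = cnj (h z)"
  shows "path_op h \<epsilon> t + path_op h \<epsilon> (- t) =
    2 *\<^sub>R (Re (cnj (zpath \<epsilon> t) * path_coef h \<epsilon> t) *\<^sub>R P (spath \<epsilon> t) - Re (path_coef h \<epsilon> t) *\<^sub>R R (spath \<epsilon> t))"
    "path_coef h \<epsilon> (- t) = cnj (path_coef h \<epsilon> t)" "zpath \<epsilon> (- t) = cnj (zpath \<epsilon> t)"
proof -
  show z: "zpath \<epsilon> (- t) = cnj (zpath \<epsilon> t)" by (simp add: zpath_def complex_eq_iff)
  have "Complex (- (\<epsilon> * sin \<phi>)) (- (\<epsilon> * sgn (- t) * cos \<phi>)) = cnj (Complex (- (\<epsilon> * sin \<phi>)) (- (\<epsilon> * sgn t * cos \<phi>)))"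
    by (simp add: complex_eq_iff)
  then show a: "path_coef h \<epsilon> (- t) = cnj (path_coef h \<epsilon> t)"
    unfolding path_coef_def z sym[OF zpath_double_wedge[OF \<epsilon> t \<theta>]] by simp
  define p where "p = path_coef h \<epsilon> t"
  define w where "w = zpath \<epsilon> t"
  have e1: "path_op h \<epsilon> (- t) = (let a = cnj p; b = cnj (cnj w) * a in
      Re b *\<^sub>R P (spath \<epsilon> t) + Im b *\<^sub>R (P (spath \<epsilon> t) * Jl) - (Re a *\<^sub>R R (spath \<epsilon> t) + Im a *\<^sub>R (R (spath \<epsilon> t) * Jl)))"
    unfolding path_op_def a Let_def spath_minus[OF \<epsilon>] unfolding z p_def w_def ..
  have e2: "path_op h \<epsilon> t = (let a = p; b = cnj w * a in
      Re b *\<^sub>R P (spath \<epsilon> t) + Im b *\<^sub>R (P (spath \<epsilon> t) * Jl) - (Re a *\<^sub>R R (spath \<epsilon> t) + Im a *\<^sub>R (R (spath \<epsilon> t) * Jl)))"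
    unfolding path_op_def p_def w_def Let_def ..
  show "path_op h \<epsilon> t + path_op h \<epsilon> (- t) =
    2 *\<^sub>R (Re (cnj (zpath \<epsilon> t) * path_coef h \<epsilon> t) *\<^sub>R P (spath \<epsilon> t) - Re (path_coef h \<epsilon> t) *\<^sub>R R (spath \<epsilon> t))"
    unfolding e1 e2 p_def[symmetric] w_def[symmetric] scaleR_2 by (simp add: Let_def algebra_simps)
qed

text \<open>The coefficient of \<open>P\<close> exceeds that of \<open>R\<close> by the factor |t|,
  which the better bound of order 1/t^2 for \<open>P\<close> makes up for. Both terms are at most a
  constant times the modulus of \<open>h\<close> divided by |t|, which is integrable by
  assumption.\<close>

lemma path_op_integrable:
  assumes \<epsilon>: "\<epsilon> \<in> {1, - 1}" and \<theta>: "\<phi> < \<theta>" "\<theta> < pi / 2"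
    and sym: "\<And>z. z \<in> double_wedge \<theta> \<Longrightarrow> h (cnj z) = cnj (h z)"
    and hol: "h holomorphic_on double_wedge \<theta>"
    and int: "(\<lambda>t. norm (h (of_real (\<epsilon> * t) * cis \<phi>)) / t) integrable_on {0<..}"
  shows "path_op h \<epsilon> integrable_on UNIV"
proof -
  obtain K where K: "K \<ge> 0"
    "\<And>\<epsilon> t. \<epsilon> \<in> {1, - 1} \<Longrightarrow> t \<noteq> 0 \<Longrightarrow> norm (P (spath \<epsilon> t)) \<le> K / t\<^sup>2"
    "\<And>\<epsilon> t. \<epsilon> \<in> {1, - 1} \<Longrightarrow> t \<noteq> 0 \<Longrightarrow> norm (R (spath \<epsilon> t)) \<le> K / \<bar>t\<bar>"
    by (rule spath_bounds) blast
  define j where "j = norm Jl"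
  define k where "k t = norm (h (of_real (\<epsilon> * t) * cis \<phi>)) / t" for t
  define g where "g t = 2 * K * (1 + j) * k \<bar>t\<bar>" for t
  obtain y where "(k has_integral y) {0<..}" using int unfolding k_def by blast
  from has_integral_even_extension[OF this] have "(\<lambda>t. k \<bar>t\<bar>) integrable_on UNIV" by blast
  then have g: "g integrable_on UNIV" unfolding g_def by (rule integrable_on_mult_right)
  have le: "norm (path_op h \<epsilon> t) \<le> g t" if t: "t \<noteq> 0" for t
  proof -
    define a where "a = path_coef h \<epsilon> t"
    define b where "b = cnj (zpath \<epsilon> t) * a"
    have "(norm (Complex (- (\<epsilon> * sin \<phi>)) (- (\<epsilon> * sgn t * cos \<phi>))))\<^sup>2 = 1"
      unfolding cmod_power2 using \<epsilon> t by (auto simp: power_mult_distrib sgn_if)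
    then have "norm (Complex (- (\<epsilon> * sin \<phi>)) (- (\<epsilon> * sgn t * cos \<phi>))) = 1"
      by (metis norm_ge_zero power2_eq_1_iff le_minus_one_simps(3))
    then have "norm a = norm (h (zpath \<epsilon> t))" by (simp add: a_def path_coef_def norm_mult)
    also have "\<dots> = norm (h (of_real (\<epsilon> * \<bar>t\<bar>) * cis \<phi>))"
    proof (cases "t > 0")
      case True
      have "of_real (\<epsilon> * \<bar>t\<bar>) * cis \<phi> = cnj (zpath \<epsilon> t)"
        using True by (simp add: zpath_def complex_eq_iff)
      then show ?thesis using sym[OF zpath_double_wedge[OF \<epsilon> t \<theta>]] by simp
    next
      case False
      have "of_real (\<epsilon> * \<bar>t\<bar>) * cis \<phi> = zpath \<epsilon> t"
        using False by (simp add: zpath_def complex_eq_iff)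
      then show ?thesis by simp
    qed
    finally have na: "norm a / \<bar>t\<bar> = k \<bar>t\<bar>" by (simp add: k_def)
    have nb: "norm b = \<bar>t\<bar> * norm a" using \<epsilon> by (simp add: b_def norm_mult)
    have part: "norm (Re c *\<^sub>R X + Im c *\<^sub>R (X * Jl)) \<le> norm c * norm X * (1 + j)" for c and X :: "('v, 'n) cmodule endo"
    proof -
      have "norm (Re c *\<^sub>R X + Im c *\<^sub>R (X * Jl)) \<le> \<bar>Re c\<bar> * norm X + \<bar>Im c\<bar> * norm (X * Jl)"
        by (rule order_trans[OF norm_triangle_ineq]) simp
      also have "\<dots> \<le> norm c * norm X + norm c * (norm X * j)"
        unfolding j_def by (intro add_mono mult_mono norm_mult_ineq abs_Re_le_cmod abs_Im_le_cmod) auto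
      finally show ?thesis by (simp add: algebra_simps)
    qed
    have "norm (path_op h \<epsilon> t) \<le> norm b * norm (P (spath \<epsilon> t)) * (1 + j) + norm a * norm (R (spath \<epsilon> t)) * (1 + j)"
      unfolding path_op_def Let_def a_def[symmetric] b_def[symmetric]
      using part[of b "P (spath \<epsilon> t)"] part[of a "R (spath \<epsilon> t)"] by (intro order_trans[OF norm_triangle_ineq4] add_mono) auto
    also have "\<dots> \<le> norm b * (K / t\<^sup>2) * (1 + j) + norm a * (K / \<bar>t\<bar>) * (1 + j)"
      using K(2,3)[OF \<epsilon> t] by (intro add_mono mult_right_mono mult_left_mono) (auto simp: j_def)
    also have "norm b * (K / t\<^sup>2) = norm a * (K / \<bar>t\<bar>)"
    proof -
      have e: "t\<^sup>2 = \<bar>t\<bar> * \<bar>t\<bar>" by (simp add: power2_eq_square)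
      show ?thesis unfolding nb e using t by (simp del: abs_mult_self_eq)
    qed
    finally show ?thesis by (simp add: g_def algebra_simps add_divide_distrib flip: na)
  qed
  have cz: "continuous_on (- {0}) (zpath \<epsilon>)"
    unfolding zpath_def[abs_def] by (intro continuous_intros)
  have "continuous_on (- {0}) (\<lambda>t. h (zpath \<epsilon> t))"
    by (rule continuous_on_compose2[OF holomorphic_on_imp_continuous_on[OF hol] cz])
      (use zpath_double_wedge[OF \<epsilon> _ \<theta>] in auto)
  then have ca: "continuous_on (- {0}) (path_coef h \<epsilon>)"
    unfolding path_coef_def[abs_def] by (intro continuous_intros) auto
  have "continuous_on (- {0}) (path_op h \<epsilon>)"
    unfolding path_op_def[abs_def] Let_def
    by (intro continuous_intros ca cz continuous_on_spath[OF \<epsilon>])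
  then show ?thesis by (rule integrable_on_dominated_off_0[OF _ le g])
qed

text \<open>Twice the integral is the integral of the symmetrized integrand, from which
  \<open>Jl\<close> has disappeared. The function \<open>c\<close> is 0 for a subspace containing
  all \<open>P\<close> and \<open>R\<close> involved, and the scalar value of the symmetrized
  integrand for an ideal.\<close>

lemma path_op_integral_mem:
  assumes \<epsilon>: "\<epsilon> \<in> {1, - 1}" and \<theta>: "\<phi> < \<theta>" "\<theta> < pi / 2"
    and sym: "\<And>z. z \<in> double_wedge \<theta> \<Longrightarrow> h (cnj z) = cnj (h z)"
    and int: "path_op h \<epsilon> integrable_on UNIV"
    and W: "subspace W" "closed W" and c: "((\<lambda>t. c \<bar>t\<bar>) has_integral y + y) UNIV"
    and mem: "\<And>t. t > 0 \<Longrightarrow> 2 *\<^sub>R (Re (cnj (zpath \<epsilon> t) * path_coef h \<epsilon> t) *\<^sub>R P (spath \<epsilon> t)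
      - Re (path_coef h \<epsilon> t) *\<^sub>R R (spath \<epsilon> t)) - c t \<in> W"
  shows "integral UNIV (path_op h \<epsilon>) - y \<in> W"
proof -
  let ?i = "integral UNIV (path_op h \<epsilon>)"
  define G where "G t = path_op h \<epsilon> t + path_op h \<epsilon> (- t) - c \<bar>t\<bar>" for t
  have i: "(path_op h \<epsilon> has_integral ?i) UNIV" using int by (rule integrable_integral)
  have "(G has_integral (?i + ?i - (y + y))) UNIV" unfolding G_def
    by (intro has_integral_diff has_integral_add i has_integral_reflect_UNIV c)
  then have G': "((\<lambda>t. if t = 0 then 0 else G t) has_integral (?i + ?i - (y + y))) UNIV"
    by (rule has_integral_spike[OF negligible_sing[of 0], rotated]) simp
  have pos: "G t \<in> W" if "t > 0" for t
    using mem[OF that] path_op_symmetric(1)[where h=h and t=t, OF \<epsilon> _ \<theta> sym] that by (simp add: G_def)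
  have "G t \<in> W" if "t \<noteq> 0" for t
  proof (cases "t > 0")
    case False
    then have "G (- t) \<in> W" using pos[of "- t"] that by simp
    then show ?thesis by (simp add: G_def add.commute)
  qed (rule pos)
  then have "?i + ?i - (y + y) \<in> W"
    by (intro has_integral_in_closed_subspace[OF G' _ W]) (auto simp: subspace_0[OF W(1)])
  then have "(1/2) *\<^sub>R (?i + ?i - (y + y)) \<in> W" by (rule subspace_scale[OF W(1)])
  moreover have "(1/2) *\<^sub>R (?i + ?i - (y + y)) = ?i - y"
    by (simp add: scaleR_diff_right scaleR_add_right flip: scaleR_left_distrib)
  ultimately show ?thesis by simp
qed

lemma P_right_linear [simp]: "s \<in> \<rho> \<Longrightarrow> P s \<in> right_linear_endos"
  by (simp add: right_linear_endos_def P_apply Q_inv_props)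

lemma R_right_linear [simp]: "s \<in> off_sector \<Longrightarrow> R s \<in> right_linear_endos"
  by (simp add: right_linear_endos_def R_apply Q_inv_props off_sector_resolvent)

text \<open>Multiplication by \<open>\<epsilon>\<close> carries the left branch of the contour to
  the right one, so both are instances of the formula for one wedge, and a branch contributes only
  if \<open>\<mu>\<close> lies on its side. After this reflection the first term belongs to the
  lower ray and the second to the upper ray.\<close>

lemma path_scalar_integral:
  fixes h :: "complex \<Rightarrow> complex"
  assumes \<epsilon>: "\<epsilon> \<in> {1, - 1}" and \<theta>: "\<phi> < \<theta>" "\<theta> < pi / 2"
    and sym: "\<And>z. z \<in> double_wedge \<theta> \<Longrightarrow> h (cnj z) = cnj (h z)"
    and hol: "h holomorphic_on double_wedge \<theta>"
    and bnd: "\<And>z. z \<in> double_wedge \<theta> \<Longrightarrow> norm (h z) \<le> C"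
    and int: "(\<lambda>t. norm (h (of_real (\<epsilon> * t) * cis \<phi>)) / t) integrable_on {0<..}"
    and \<mu>: "\<bar>Im \<mu>\<bar> \<le> tan \<omega> * \<bar>Re \<mu>\<bar>"
  shows "((\<lambda>t. path_coef h \<epsilon> t / (zpath \<epsilon> t - \<mu>) + cnj (path_coef h \<epsilon> t) / (cnj (zpath \<epsilon> t) - \<mu>))
    has_integral (if \<epsilon> * Re \<mu> > 0 then 2 * pi * h \<mu> else 0)) {0<..}"
proof -
  define e where "e = complex_of_real \<epsilon>"
  have ee: "e * e = 1" using \<epsilon> by (auto simp: e_def)
  define he where "he w = h (e * w)" for w
  have wedge: "e * z \<in> double_wedge \<theta>" if "z \<in> wedge \<theta>" for z
  proof -
    have "tan \<theta> > 0" using \<omega> \<theta> by (intro tan_gt_zero) auto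
    then have "Re z > 0" using that abs_ge_zero[of "Im z"] unfolding wedge_def mem_Collect_eq
      by (metis order_le_less_trans zero_less_mult_pos)
    then show ?thesis using that \<epsilon> by (auto simp: e_def wedge_def double_wedge_def)
  qed
  have zp: "of_real (\<epsilon> * t) * cis (- \<phi>) = zpath \<epsilon> t" "of_real (\<epsilon> * t) * cis \<phi> = cnj (zpath \<epsilon> t)" if "t > 0" for t
    using that by (simp_all add: zpath_def complex_eq_iff)
  have main: "(ray_difference \<phi> (\<lambda>z. he z / (z - e * \<mu>)) has_integral (if Re (e * \<mu>) > 0 then 2 * pi * \<i> * he (e * \<mu>) else 0)) {0<..}"
  proof (rule wedge_Cauchy[where B=C, OF \<omega>(1,2) \<theta>])
    show "he holomorphic_on wedge \<theta>"
      unfolding he_def using holomorphic_on_compose_gen[OF _ hol, of "(*) e" "wedge \<theta>"] wedge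
      by (auto simp: o_def intro!: holomorphic_intros)
    show "norm (he z) \<le> C" if "z \<in> wedge \<theta>" for z using bnd[OF wedge[OF that]] by (simp add: he_def)
    show "(\<lambda>t. norm (he (of_real t * cis \<phi>)) / t) integrable_on {0<..}"
      using int by (simp add: he_def e_def mult.assoc)
    show "(\<lambda>t. norm (he (of_real t * cis (- \<phi>))) / t) integrable_on {0<..}"
    proof (rule integrable_eq[OF int])
      fix t :: real assume "t \<in> {0<..}"
      then have t: "t > 0" by simp
      have "h (cnj (zpath \<epsilon> t)) = cnj (h (zpath \<epsilon> t))" using t by (intro sym zpath_double_wedge \<epsilon> \<theta>) auto
      moreover have "e * (of_real t * cis (- \<phi>)) = zpath \<epsilon> t" using zp(1)[OF t] by (simp add: e_def mult.assoc)
      ultimately show "norm (h (of_real (\<epsilon> * t) * cis \<phi>)) / t = norm (he (of_real t * cis (- \<phi>))) / t"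
        unfolding zp(2)[OF t] he_def by simp
    qed
    show "\<bar>Im (e * \<mu>)\<bar> \<le> tan \<omega> * \<bar>Re (e * \<mu>)\<bar>" using \<mu> \<epsilon> by (auto simp: e_def)
  qed
  have val: "- \<i> * (if Re (e * \<mu>) > 0 then 2 * pi * \<i> * he (e * \<mu>) else 0) = (if \<epsilon> * Re \<mu> > 0 then 2 * pi * h \<mu> else 0)"
  proof -
    have "he (e * \<mu>) = h \<mu>" using ee by (simp add: he_def flip: mult.assoc)
    then show ?thesis by (simp add: e_def)
  qed
  \<comment> \<open>The factor \<open>- \<i>\<close> is the division by \<open>J\<close> in the
    calculus; it cancels the \<open>\<i>\<close> of the Cauchy formula.\<close>
  have "((\<lambda>t. - \<i> * ray_difference \<phi> (\<lambda>z. he z / (z - e * \<mu>)) t) has_integral (if \<epsilon> * Re \<mu> > 0 then 2 * pi * h \<mu> else 0)) {0<..}"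
    using has_integral_mult_right[OF main, of "- \<i>"] unfolding val .
  then show ?thesis
  proof (rule has_integral_eq[rotated])
    fix t :: real assume "t \<in> {0<..}"
    then have t: "t > 0" by simp
    have z: "zpath \<epsilon> t = e * (of_real t * cis (- \<phi>))" "cnj (zpath \<epsilon> t) = e * (of_real t * cis \<phi>)"
      using zp[OF t] by (simp_all add: e_def mult.assoc)
    define H1 where "H1 = h (zpath \<epsilon> t)"
    define H2 where "H2 = h (cnj (zpath \<epsilon> t))"
    define w1 where "w1 = of_real t * cis (- \<phi>)"
    define w2 where "w2 = of_real t * cis \<phi>"
    have r: "e * x / (e * w - \<mu>) = x / (w - e * \<mu>)" for x w
    proof -
      have "e * w - \<mu> = e * (w - e * \<mu>)" using ee by (simp add: right_diff_distrib flip: mult.assoc)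
      then show ?thesis using ee by auto
    qed
    have a: "path_coef h \<epsilon> t = e * (- \<i> * cis (- \<phi>) * H1)"
      using t by (simp add: path_coef_def e_def H1_def complex_eq_iff algebra_simps)
    have "H2 = cnj H1" unfolding H1_def H2_def using t by (intro sym zpath_double_wedge[OF \<epsilon> _ \<theta>]) auto
    then have a': "cnj (path_coef h \<epsilon> t) = e * (\<i> * cis \<phi> * H2)"
      unfolding a by (simp add: e_def cis_cnj)
    have 1: "path_coef h \<epsilon> t / (zpath \<epsilon> t - \<mu>) = - \<i> * cis (- \<phi>) * H1 / (w1 - e * \<mu>)"
      unfolding a z(1) w1_def by (rule r)
    have 2: "cnj (path_coef h \<epsilon> t) / (cnj (zpath \<epsilon> t) - \<mu>) = \<i> * cis \<phi> * H2 / (w2 - e * \<mu>)"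
      unfolding a' z(2) w2_def by (rule r)
    have 3: "he w1 = H1" "he w2 = H2" unfolding he_def H1_def H2_def w1_def w2_def z[symmetric] by (rule refl)+
    show "- \<i> * ray_difference \<phi> (\<lambda>z. he z / (z - e * \<mu>)) t =
      path_coef h \<epsilon> t / (zpath \<epsilon> t - \<mu>) + cnj (path_coef h \<epsilon> t) / (cnj (zpath \<epsilon> t) - \<mu>)"
      unfolding 1 2 ray_difference_def w1_def[symmetric] w2_def[symmetric] 3 by (simp add: right_diff_distrib mult.assoc)
  qed
qed

text \<open>With \<open>\<beta> = \<alpha> * \<mu>\<close> the relation
  \<open>\<beta>\<^sup>2 = \<alpha> - \<alpha>\<^sup>2\<close> determines \<open>\<alpha>\<close>
  from \<open>\<mu>\<close>, and the scalar of \<open>N s\<close> becomes \<open>\<alpha>\<close>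
  times the value of Q_s at \<open>\<mu>\<close>. That value is 0 on the sphere of
  \<open>\<mu>\<close>, whereas the scalar is nonzero at every resolvent point.\<close>

lemma spectrum_point:
  assumes M: "alg.proper_ideal M" and \<alpha>: "A - alg.emb \<alpha> \<in> M" and \<beta>: "B - alg.emb \<beta> \<in> M" and \<alpha>0: "\<alpha> \<noteq> 0"
  defines "\<mu> \<equiv> \<beta> / \<alpha>"
  shows "\<alpha> * (1 + \<mu>\<^sup>2) = 1"
    "1 + of_real ((norm s)\<^sup>2 - 1) * \<alpha> - of_real (2 * sc s) * \<beta> = \<alpha> * (\<mu>\<^sup>2 - of_real (2 * sc s) * \<mu> + of_real ((norm s)\<^sup>2))"
    "I \<in> unit_imag \<Longrightarrow> slice_embed I \<mu> \<notin> \<rho>" "\<bar>Im \<mu>\<bar> \<le> tan \<omega> * \<bar>Re \<mu>\<bar>"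
proof -
  have b: "\<beta> = \<alpha> * \<mu>" using \<alpha>0 by (simp add: \<mu>_def)
  have "\<alpha> * (\<alpha> * (1 + \<mu>\<^sup>2)) = \<alpha> * 1"
    using P_mod_ideal(1)[OF M \<alpha> \<beta>] unfolding b by (simp add: power2_eq_square algebra_simps)
  then show 1: "\<alpha> * (1 + \<mu>\<^sup>2) = 1" using \<alpha>0 mult_left_cancel by blast
  show 2: "1 + of_real ((norm s)\<^sup>2 - 1) * \<alpha> - of_real (2 * sc s) * \<beta> = \<alpha> * (\<mu>\<^sup>2 - of_real (2 * sc s) * \<mu> + of_real ((norm s)\<^sup>2))" for s
    unfolding b using 1 by (simp add: algebra_simps)
  show 3: "slice_embed I \<mu> \<notin> \<rho>" if I: "I \<in> unit_imag" for I
  proof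
    assume "slice_embed I \<mu> \<in> \<rho>"
    from P_mod_ideal(2)[OF M \<alpha> \<beta> this] have "\<alpha> * ((\<mu> - \<mu>) * (\<mu> - cnj \<mu>)) \<noteq> 0"
      unfolding 2 using I quadratic_roots[of \<mu> \<mu>] by (simp add: slice_embed_def) (simp flip: slice_embed_def)
    then show False by simp
  qed
  have "slice_embed J \<mu> \<in> closure (double_sector \<omega>)"
    using 3[OF J] bisectorial J by (auto simp: bisectorial_def S_spectrum_def slice_embed_def)
  then show "\<bar>Im \<mu>\<bar> \<le> tan \<omega> * \<bar>Re \<mu>\<bar>"
    using closure_double_sector_bound[of \<omega> "slice_embed J \<mu>"] \<omega> J by (simp add: slice_embed_def)
qed

text \<open>Modulo an ideal with \<open>\<alpha> \<noteq> 0\<close> the symmetrized integrand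
  becomes a sum of two Cauchy kernels at \<open>\<mu>\<close>; for \<open>\<alpha> = 0\<close> it
  becomes 0. The value for \<open>\<beta> = 0\<close> is 0 too, since neither branch encloses
  \<open>\<mu> = 0\<close>. The element \<open>y\<close> is the same for all ideals.\<close>

lemma omega_calc_mod_ideal:
  fixes h :: "complex \<Rightarrow> complex"
  assumes \<theta>: "\<phi> < \<theta>" "\<theta> < pi / 2"
    and rep: "\<And>z. z \<in> double_wedge \<theta> \<Longrightarrow> f (slice_embed J z) = slice_embed J (h z)"
    and sym: "\<And>z. z \<in> double_wedge \<theta> \<Longrightarrow> h (cnj z) = cnj (h z)"
    and hol: "h holomorphic_on double_wedge \<theta>"
    and bnd: "\<And>z. z \<in> double_wedge \<theta> \<Longrightarrow> norm (h z) \<le> K"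
    and int: "\<And>\<psi>. \<psi> \<in> bisector_angles \<theta> \<Longrightarrow> (\<lambda>t. norm (h (of_real t * cis \<psi>)) / t) integrable_on {0<..}"
  obtains y where "omega_calc \<phi> J D T f = blinfun_of y" "y \<in> \<A>" "y \<in> right_linear_endos"
    "\<And>M \<alpha> \<beta>. alg.proper_ideal M \<Longrightarrow> A - alg.emb \<alpha> \<in> M \<Longrightarrow> B - alg.emb \<beta> \<in> M \<Longrightarrow>
      y - alg.emb (if \<alpha> = 0 \<or> \<beta> = 0 then 0 else h (\<beta> / \<alpha>)) \<in> M"
proof -
  define Y where "Y \<epsilon> = integral UNIV (path_op h \<epsilon>)" for \<epsilon>
  have int_\<epsilon>: "(\<lambda>t. norm (h (of_real (\<epsilon> * t) * cis \<phi>)) / t) integrable_on {0<..}" if \<epsilon>: "\<epsilon> \<in> {1, - 1}" for \<epsilon>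
  proof (cases "\<epsilon> = 1")
    case True
    have "\<phi> \<in> bisector_angles \<theta>" using \<omega> \<theta> by (simp add: bisector_angles_def)
    then show ?thesis using int True by simp
  next
    case False
    have "pi + \<phi> \<in> bisector_angles \<theta>" using \<omega> \<theta> by (simp add: bisector_angles_def)
    moreover have "cis (pi + \<phi>) = - cis \<phi>" by (simp flip: cis_mult)
    ultimately show ?thesis using int[of "pi + \<phi>"] False \<epsilon> by simp
  qed
  have p_int: "path_op h \<epsilon> integrable_on UNIV" if "\<epsilon> \<in> {1, - 1}" for \<epsilon>
    by (rule path_op_integrable[OF that \<theta> sym hol int_\<epsilon>[OF that]])
  define y where "y = (1 / (2 * pi)) *\<^sub>R (\<Sum>\<epsilon>\<in>{1, - 1}. Y \<epsilon>)"
  show ?thesis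
  proof (rule that[of y])
    have "integral UNIV (\<lambda>t. let \<gamma> = bisector_path J \<phi> \<epsilon>; \<gamma>' = vector_derivative \<gamma> (at t) in
      Blinfun (\<lambda>v. S_left_resolvent D T (\<gamma> t) ((\<gamma>' *\<^sub>l clif_inv J *\<^sub>l f (\<gamma> t)) *\<^sub>l v))) = blinfun_of (Y \<epsilon>)"
      if \<epsilon>: "\<epsilon> \<in> {1, - 1}" for \<epsilon>
    proof (rule integral_unique)
      have "((\<lambda>t. blinfun_of (path_op h \<epsilon> t)) has_integral blinfun_of (Y \<epsilon>)) UNIV"
        using has_integral_linear[OF integrable_integral[OF p_int[OF \<epsilon>]] bounded_linear_blinfun_of]
        by (simp add: Y_def o_def)
      then show "((\<lambda>t. let \<gamma> = bisector_path J \<phi> \<epsilon>; \<gamma>' = vector_derivative \<gamma> (at t) in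
        Blinfun (\<lambda>v. S_left_resolvent D T (\<gamma> t) ((\<gamma>' *\<^sub>l clif_inv J *\<^sub>l f (\<gamma> t)) *\<^sub>l v))) has_integral blinfun_of (Y \<epsilon>)) UNIV"
        by (rule has_integral_spike[OF negligible_sing[of 0], rotated])
          (rule omega_integrand[where f=f and h=h, OF \<epsilon> _ \<theta> rep], auto)
    qed
    then have "omega_calc \<phi> J D T f = (1 / (2 * pi)) *\<^sub>R (\<Sum>\<epsilon>\<in>{1, - 1}. blinfun_of (Y \<epsilon>))"
      unfolding omega_calc_def by simp
    then show "omega_calc \<phi> J D T f = blinfun_of y"
      by (simp add: y_def plus_endo.rep_eq scaleR_endo.rep_eq)
  next
    \<comment> \<open>Used for the algebra, for the right-linear operators, and for an ideal at
      infinity, which contains all \<open>P s\<close> and \<open>R s\<close>.\<close>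
    have in_W: "y \<in> W" if W: "subspace W" "closed W"
      "\<And>s. s \<in> off_sector \<Longrightarrow> P s \<in> W" "\<And>s. s \<in> off_sector \<Longrightarrow> R s \<in> W" for W
    proof -
      have "Y \<epsilon> - 0 \<in> W" if \<epsilon>: "\<epsilon> \<in> {1, - 1}" for \<epsilon>
        unfolding Y_def
      proof (rule path_op_integral_mem[OF \<epsilon> \<theta> sym p_int[OF \<epsilon>] W(1,2), where c="\<lambda>_. 0"])
        show "((\<lambda>t. 0) has_integral 0 + 0) UNIV" by simp
        show "2 *\<^sub>R (Re (cnj (zpath \<epsilon> t) * path_coef h \<epsilon> t) *\<^sub>R P (spath \<epsilon> t)
          - Re (path_coef h \<epsilon> t) *\<^sub>R R (spath \<epsilon> t)) - 0 \<in> W" if "t > 0" for t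
          using spath_off_sector[OF \<epsilon>, of t] that
          by (auto intro!: subspace_scale[OF W(1)] subspace_diff[OF W(1)] W(3,4))
      qed
      then show ?thesis unfolding y_def by (intro subspace_scale[OF W(1)] subspace_sum[OF W(1)]) simp
    qed
    show "y \<in> \<A>" by (rule in_W[OF alg.subspace alg.closed]) (auto simp: off_sector_resolvent)
    show "y \<in> right_linear_endos"
      by (rule in_W[OF subspace_right_linear_endos closed_right_linear_endos]) (auto simp: off_sector_resolvent)
    fix M \<alpha> \<beta>
    assume M: "alg.proper_ideal M" and \<alpha>: "A - alg.emb \<alpha> \<in> M" and \<beta>: "B - alg.emb \<beta> \<in> M"
    note Mf = alg.ideal_facts[OF M]
    note PM = P_mod_ideal[OF M \<alpha> \<beta>]
    show "y - alg.emb (if \<alpha> = 0 \<or> \<beta> = 0 then 0 else h (\<beta> / \<alpha>)) \<in> M"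
    proof (cases "\<alpha> = 0")
      case True
      then have "\<beta> = 0" using PM(1) by simp
      with True have "y \<in> M" using PM(3,4) by (intro in_W Mf(1,2)) (auto simp: off_sector_resolvent)
      then show ?thesis using True by simp
    next
      case \<alpha>0: False
      define \<mu> where "\<mu> = \<beta> / \<alpha>"
      note sp = spectrum_point[OF M \<alpha> \<beta> \<alpha>0, folded \<mu>_def]
      define c where "c \<epsilon> = (if \<epsilon> * Re \<mu> > 0 then 2 * pi * h \<mu> else 0)" for \<epsilon>
      have Yc: "Y \<epsilon> - alg.emb (c \<epsilon>) \<in> M" if \<epsilon>: "\<epsilon> \<in> {1, - 1}" for \<epsilon>
        unfolding Y_def
      proof (rule path_op_integral_mem[OF \<epsilon> \<theta> sym p_int[OF \<epsilon>] Mf(1,2)])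
        let ?k = "\<lambda>t. path_coef h \<epsilon> t / (zpath \<epsilon> t - \<mu>) + cnj (path_coef h \<epsilon> t) / (cnj (zpath \<epsilon> t) - \<mu>)"
        have "(?k has_integral c \<epsilon>) {0<..}"
          unfolding c_def by (rule path_scalar_integral[OF \<epsilon> \<theta> sym hol bnd int_\<epsilon>[OF \<epsilon>] sp(4)])
        from has_integral_linear[OF has_integral_even_extension[OF this] alg.bounded_linear_emb]
        show "((\<lambda>t. (\<lambda>t. alg.emb (?k t)) \<bar>t\<bar>) has_integral alg.emb (c \<epsilon>) + alg.emb (c \<epsilon>)) UNIV"
          by (simp only: o_def alg.emb_add)
        fix t :: real assume t: "t > 0"
        define s where "s = spath \<epsilon> t"
        define a where "a = path_coef h \<epsilon> t"
        define z where "z = zpath \<epsilon> t"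
        have s: "s \<in> off_sector" "s \<in> \<rho>"
          using spath_off_sector[OF \<epsilon>, of t] t off_sector_resolvent by (auto simp: s_def)
        define n where "n = 1 + of_real ((norm s)\<^sup>2 - 1) * \<alpha> - of_real (2 * sc s) * \<beta>"
        have n0: "n \<noteq> 0" using PM(2)[OF s(2)] by (simp add: n_def)
        have ns: "norm s = norm z" "sc s = Re z" using J by (simp_all add: s_def z_def)
        have n: "n = \<alpha> * ((\<mu> - z) * (\<mu> - cnj z))"
        proof -
          have "n = \<alpha> * (\<mu>\<^sup>2 - of_real (2 * sc s) * \<mu> + of_real ((norm s)\<^sup>2))" unfolding n_def by (rule sp(2))
          then show ?thesis unfolding ns quadratic_roots .
        qed
        have "P s - alg.emb (\<alpha> / n) \<in> M" "R s - alg.emb (\<beta> / n) \<in> M"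
          using PM(3)[OF s(2)] PM(4)[OF s(1)] by (simp_all add: n_def)
        then have "2 *\<^sub>R (Re (cnj z * a) *\<^sub>R (P s - alg.emb (\<alpha> / n)) - Re a *\<^sub>R (R s - alg.emb (\<beta> / n))) \<in> M"
          by (rule Mf(8)[OF Mf(7)[OF Mf(8) Mf(8)]])
        also have "2 *\<^sub>R (Re (cnj z * a) *\<^sub>R (P s - alg.emb (\<alpha> / n)) - Re a *\<^sub>R (R s - alg.emb (\<beta> / n))) =
          2 *\<^sub>R (Re (cnj z * a) *\<^sub>R P s - Re a *\<^sub>R R s) -
          alg.emb (2 *\<^sub>R (Re (cnj z * a) *\<^sub>R (\<alpha> / n) - Re a *\<^sub>R (\<beta> / n)))"
          unfolding alg.emb_scaleR alg.emb_diff by (simp add: algebra_simps)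
        \<comment> \<open>The numerators combine to
          \<open>a * (cnj z - \<mu>) + cnj a * (z - \<mu>)\<close>, so the fraction over
          \<open>(\<mu> - z) * (\<mu> - cnj z)\<close> splits into one term for each of the
          conjugate points.\<close>
        also have "2 *\<^sub>R (Re (cnj z * a) *\<^sub>R (\<alpha> / n) - Re a *\<^sub>R (\<beta> / n)) = a / (z - \<mu>) + cnj a / (cnj z - \<mu>)"
        proof -
          have nz: "\<mu> - z \<noteq> 0" "\<mu> - cnj z \<noteq> 0" using n0 n by auto
          have gen: "- (x * q + x' * p) / (p * q) = - (x / p) - x' / q" if "p \<noteq> 0" "q \<noteq> 0" for x x' p q :: complex
            using that by (simp add: field_simps)
          have an: "\<alpha> / n = 1 / ((\<mu> - z) * (\<mu> - cnj z))" "\<beta> / n = \<mu> / ((\<mu> - z) * (\<mu> - cnj z))"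
            using \<alpha>0 n0 unfolding n by (auto simp: \<mu>_def)
          have "2 * of_real (Re (cnj z * a)) = cnj z * a + z * cnj a" "2 * of_real (Re a) = a + cnj a"
            using complex_add_cnj[of "cnj z * a"] complex_add_cnj[of a] by simp_all
          then have "2 *\<^sub>R (Re (cnj z * a) *\<^sub>R (\<alpha> / n) - Re a *\<^sub>R (\<beta> / n)) =
            ((cnj z * a + z * cnj a) - (a + cnj a) * \<mu>) / ((\<mu> - z) * (\<mu> - cnj z))"
            unfolding an by (simp add: scaleR_conv_of_real diff_divide_distrib flip: mult.assoc)
          also have "(cnj z * a + z * cnj a) - (a + cnj a) * \<mu> = - (a * (\<mu> - cnj z) + cnj a * (\<mu> - z))"
            by (simp add: algebra_simps)
          also have "\<dots> / ((\<mu> - z) * (\<mu> - cnj z)) = - (a / (\<mu> - z)) - cnj a / (\<mu> - cnj z)"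
            by (rule gen[OF nz])
          also have "\<dots> = a / (z - \<mu>) + cnj a / (cnj z - \<mu>)"
            using minus_divide_right[of a "\<mu> - z"] minus_divide_right[of "cnj a" "\<mu> - cnj z"] by simp
          finally show ?thesis .
        qed
        finally show "2 *\<^sub>R (Re (cnj (zpath \<epsilon> t) * path_coef h \<epsilon> t) *\<^sub>R P (spath \<epsilon> t)
          - Re (path_coef h \<epsilon> t) *\<^sub>R R (spath \<epsilon> t)) - (\<lambda>t. alg.emb (?k t)) t \<in> M"
          unfolding s_def a_def z_def .
      qed
      have "(1 / (2 * pi)) *\<^sub>R ((Y 1 - alg.emb (c 1)) + (Y (- 1) - alg.emb (c (- 1)))) \<in> M"
        by (intro Mf(6,8) Yc) auto
      also have "(1 / (2 * pi)) *\<^sub>R ((Y 1 - alg.emb (c 1)) + (Y (- 1) - alg.emb (c (- 1)))) =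
        y - alg.emb ((1 / (2 * pi)) *\<^sub>R (c 1 + c (- 1)))"
        unfolding alg.emb_scaleR alg.emb_add by (simp add: y_def algebra_simps)
      also have "(1 / (2 * pi)) *\<^sub>R (c 1 + c (- 1)) = (if \<alpha> = 0 \<or> \<beta> = 0 then 0 else h (\<beta> / \<alpha>))"
      proof (cases "Re \<mu> = 0")
        case True
        \<comment> \<open>The sector bound leaves only 0 on the imaginary axis, and there both
          branches contribute 0.\<close>
        then have "\<mu> = 0" using sp(4) by (simp add: complex_eq_iff)
        then show ?thesis using \<alpha>0 by (auto simp: c_def \<mu>_def)
      next
        case False
        then have "c 1 + c (- 1) = 2 * pi * h \<mu>" by (auto simp: c_def)
        moreover have "\<beta> \<noteq> 0" using False by (auto simp: \<mu>_def)
        ultimately show ?thesis using \<alpha>0 by (simp add: \<mu>_def scaleR_conv_of_real)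
      qed
      finally show ?thesis .
    qed
  qed
qed

end

section \<open>Spectral mapping\<close>

theorem theorem4p15:
  fixes D :: "('v::banach, 'n::{finite,linorder}) cmodule set"
    and T :: "('v, 'n) cmodule \<Rightarrow> ('v, 'n) cmodule"
    and \<omega> \<theta> \<phi> g0 ginf :: real
    and J :: "'n clif"
    and g gt :: "'n clif \<Rightarrow> 'n clif"
  assumes "closed_rlinear D T"
    and "0 < \<omega>" and "\<omega> < pi / 2"
    and "bisectorial \<omega> D T"
    and "\<omega> < \<theta>" and "\<theta> < pi / 2"
    and "N_bnd_decomp \<theta> g g0 ginf gt"
    and "\<omega> < \<phi>" and "\<phi> < \<theta>" and "J \<in> unit_imag"
  defines "gext \<equiv> g(0 := g0 *\<^sub>R clif_one)"
    and "gT \<equiv> extended_calc \<phi> J D T g0 ginf gt"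
  shows "S_spectrum UNIV (blinfun_apply gT) \<supseteq> gext ` S_spectrum D T
    \<and> S_spectrum UNIV (blinfun_apply gT) \<subseteq> gext ` S_spectrum D T \<union> {ginf *\<^sub>R clif_one}"
proof -
  interpret bisectorial_operator D T \<omega> \<phi> J
    using assms by unfold_locales auto
  have \<theta>: "0 < \<theta>" "\<phi> < \<theta>" "\<theta> < pi / 2" using assms by auto
  have gt: "gt \<in> N0 \<theta>" and g: "\<And>s. s \<in> double_sector \<theta> \<Longrightarrow>
      g s = ginf *\<^sub>R clif_one + (g0 - ginf) *\<^sub>R clif_inv (clif_one + s *\<^sub>l s) + gt s"
    using \<open>N_bnd_decomp \<theta> g g0 ginf gt\<close> by (auto simp: N_bnd_decomp_def)
  obtain h C where h:
    "\<And>I z. I \<in> unit_imag \<Longrightarrow> z \<in> double_wedge \<theta> \<Longrightarrow> gt (slice_embed I z) = slice_embed I (h z)"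
    "\<And>z. z \<in> double_wedge \<theta> \<Longrightarrow> h (cnj z) = cnj (h z)"
    "h holomorphic_on double_wedge \<theta>"
    "\<And>z. z \<in> double_wedge \<theta> \<Longrightarrow> norm (h z) \<le> C"
    "\<And>\<psi>. \<psi> \<in> bisector_angles \<theta> \<Longrightarrow> (\<lambda>t. norm (h (of_real t * cis \<psi>)) / t) integrable_on {0<..}"
    by (rule N0_complex_representation[OF gt \<theta>(1,3) J]) blast
  obtain y where y: "omega_calc \<phi> J D T gt = blinfun_of y" "y \<in> \<A>" "y \<in> right_linear_endos"
    "\<And>M \<alpha> \<beta>. alg.proper_ideal M \<Longrightarrow> A - alg.emb \<alpha> \<in> M \<Longrightarrow> B - alg.emb \<beta> \<in> M \<Longrightarrow>
      y - alg.emb (if \<alpha> = 0 \<or> \<beta> = 0 then 0 else h (\<beta> / \<alpha>)) \<in> M"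
    using omega_calc_mod_ideal[OF \<theta>(2,3) h(1)[OF J] h(2-5)] by metis
  define X where "X = ginf *\<^sub>R 1 + (g0 - ginf) *\<^sub>R A + y"
  have XA: "X \<in> \<A>" using y(2) by (simp add: X_def)
  have Xr: "X \<in> right_linear_endos"
    unfolding X_def by (intro subspace_add[OF subspace_right_linear_endos] subspace_scale[OF subspace_right_linear_endos] y)
      (auto simp: right_linear_endos_def P_apply Q_inv_props)
  have gT: "blinfun_apply gT = endo_apply X"
  proof -
    have "Q_op T J = (\<lambda>v. v + T (T v))" by (auto simp: Q_op_def J_sc_norm)
    then have "Blinfun (inv_into (dom_sq D T) (\<lambda>v. v + T (T v))) = blinfun_of A"
      by (simp add: P_def blinfun_of_endo_fun Q_inv_def)
    then have "gT = blinfun_of X"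
      unfolding gT_def extended_calc_def y(1)
      by (simp add: X_def plus_endo.rep_eq scaleR_endo.rep_eq one_endo.rep_eq)
    then show ?thesis by (simp add: endo_apply.rep_eq)
  qed
  \<comment> \<open>The complex function behind \<open>gext\<close>. Its value at 0 is set
    separately, because 0 lies outside \<open>double_wedge\<close>, where nothing is known of
    \<open>h\<close>.\<close>
  define gc where "gc z = (if z = 0 then of_real g0 else of_real ginf + of_real (g0 - ginf) / (1 + z\<^sup>2) + h z)" for z
  have gc_cnj: "gc (cnj z) = cnj (gc z)" if "z \<in> double_wedge \<theta> \<or> z = 0" for z
    using that h(2) by (auto simp: gc_def)
  have gext: "gext (slice_embed I z) = slice_embed I (gc z)"
    if I: "I \<in> unit_imag" and z: "z \<in> double_wedge \<theta> \<or> z = 0" for I z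
  proof (cases "z = 0")
    case True
    then show ?thesis by (simp add: gext_def gc_def slice_embed_simps)
  next
    case False
    then have z: "z \<in> double_wedge \<theta>" using z by simp
    have "slice_embed I z \<noteq> 0" using norm_slice_embed[OF I, of z] False by auto
    then have "gext (slice_embed I z) = g (slice_embed I z)" by (simp add: gext_def)
    also have "slice_embed I z \<in> double_sector \<theta>"
      using slice_pt_double_sector[OF \<theta>(1,3) I] z by (simp add: slice_embed_def double_wedge_def)
    then have "g (slice_embed I z) = ginf *\<^sub>R clif_one
        + (g0 - ginf) *\<^sub>R clif_inv (clif_one + slice_embed I z *\<^sub>l slice_embed I z) + gt (slice_embed I z)"
      by (rule g)
    also have "clif_one + slice_embed I z *\<^sub>l slice_embed I z = slice_embed I (1 + z\<^sup>2)"
      by (simp add: slice_embed_mult'[OF I] slice_embed_simps power2_eq_square)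
    also have "clif_inv (slice_embed I (1 + z\<^sup>2)) = slice_embed I (1 / (1 + z\<^sup>2))"
    proof (rule clif_inv_slice_embed[OF I])
      have "1 + z\<^sup>2 = (z - \<i>) * (z + \<i>)" by (simp add: power2_eq_square algebra_simps)
      moreover have "z \<noteq> \<i>" "z \<noteq> - \<i>" using double_wedge_Re[OF z] by auto
      ultimately show "1 + z\<^sup>2 \<noteq> 0" by (metis add_eq_0_iff2 eq_iff_diff_eq_0 mult_eq_0_iff)
    qed
    finally show ?thesis
      using False by (simp add: h(1)[OF I z] gc_def slice_embed_simps(4) flip: slice_embed_simps(7,8))
  qed
  \<comment> \<open>The Gelfand transform of \<open>g(T)\<close>: at an ideal over a finite point it
    is a value of \<open>gc\<close>, at an ideal over infinity it is \<open>ginf\<close>.\<close>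
  have char: "(\<alpha> \<noteq> 0 \<longrightarrow> (\<beta> / \<alpha> \<in> double_wedge \<theta> \<or> \<beta> / \<alpha> = 0)) \<and>
      X - alg.emb (if \<alpha> = 0 then of_real ginf else gc (\<beta> / \<alpha>)) \<in> M"
    if M: "alg.proper_ideal M" and \<alpha>: "A - alg.emb \<alpha> \<in> M" and \<beta>: "B - alg.emb \<beta> \<in> M" for M \<alpha> \<beta>
  proof (intro conjI impI)
    note Mf = alg.ideal_facts[OF M]
    note sp = spectrum_point[OF M \<alpha> \<beta>]
    show "\<beta> / \<alpha> \<in> double_wedge \<theta> \<or> \<beta> / \<alpha> = 0" if "\<alpha> \<noteq> 0"
      using sp(4)[OF that] \<omega> \<theta> by (intro double_wedge_or_zero[of \<omega>]) auto
    define k where "k = (if \<alpha> = 0 \<or> \<beta> = 0 then 0 else h (\<beta> / \<alpha>))"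
    have "(g0 - ginf) *\<^sub>R (A - alg.emb \<alpha>) + (y - alg.emb k) \<in> M"
      unfolding k_def by (intro Mf(6,8) y(4) M \<alpha> \<beta>)
    also have "(g0 - ginf) *\<^sub>R (A - alg.emb \<alpha>) + (y - alg.emb k) = X - alg.emb (of_real ginf + of_real (g0 - ginf) * \<alpha> + k)"
      unfolding alg.emb_add alg.emb_mult alg.emb_of_real X_def by (simp add: algebra_simps)
    also have "of_real ginf + of_real (g0 - ginf) * \<alpha> + k = (if \<alpha> = 0 then of_real ginf else gc (\<beta> / \<alpha>))"
    proof (cases "\<alpha> = 0")
      case False
      have "\<alpha> = 1 / (1 + (\<beta> / \<alpha>)\<^sup>2)" using sp(1)[OF False] by (metis mult_zero_right nonzero_eq_divide_eq zero_neq_one)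
      then have "of_real (g0 - ginf) * \<alpha> = of_real (g0 - ginf) / (1 + (\<beta> / \<alpha>)\<^sup>2)" by (metis mult.right_neutral times_divide_eq_right)
      \<comment> \<open>For \<open>\<beta> = 0\<close> the relation gives
        \<open>\<alpha> = 1\<close>, and the sum collapses to \<open>g0\<close>, the value of
        \<open>gc\<close> at 0.\<close>
      then show ?thesis using False sp(1)[OF False] by (auto simp: gc_def k_def)
    qed (simp add: k_def)
    finally show "X - alg.emb (if \<alpha> = 0 then of_real ginf else gc (\<beta> / \<alpha>)) \<in> M" .
  qed
  define Q where "Q p = X * X - (2 * sc p) *\<^sub>R X + (norm p)\<^sup>2 *\<^sub>R 1" for p :: "'n clif"
  have QA [simp]: "Q p \<in> \<A>" for p using XA by (simp add: Q_def)
  have res: "p \<in> S_resolvent_set UNIV (endo_apply X) \<longleftrightarrow> (\<exists>y. Q p * y = 1 \<and> y * Q p = 1)" if "p \<in> paravectors" for p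
    unfolding Q_def by (rule S_resolvent_UNIV[OF Xr that])
  \<comment> \<open>If \<open>X\<close> is the scalar \<open>\<gamma>\<close> modulo an ideal, then
    \<open>Q p\<close> is the polynomial of \<open>p\<close> evaluated at \<open>\<gamma>\<close>,
    in factored form.\<close>
  have Q_mod: "Q (slice_embed I w) - alg.emb ((\<gamma> - w) * (\<gamma> - cnj w)) \<in> M"
    if M: "alg.proper_ideal M" and \<gamma>: "X - alg.emb \<gamma> \<in> M" and I: "I \<in> unit_imag" for M \<gamma> w I
  proof -
    note Mf = alg.ideal_facts[OF M]
    have "(X * X - alg.emb \<gamma> * alg.emb \<gamma>) - (2 * Re w) *\<^sub>R (X - alg.emb \<gamma>) \<in> M"
      using XA by (intro Mf(7,8) alg.ideal_cong_mult[OF M \<gamma> \<gamma>] \<gamma>) auto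
    also have "(X * X - alg.emb \<gamma> * alg.emb \<gamma>) - (2 * Re w) *\<^sub>R (X - alg.emb \<gamma>) =
        Q (slice_embed I w) - alg.emb ((\<gamma> - w) * (\<gamma> - cnj w))"
      unfolding quadratic_roots[symmetric] alg.emb_add alg.emb_diff alg.emb_mult alg.emb_of_real power2_eq_square[of \<gamma>]
      using I by (simp add: Q_def algebra_simps)
    finally show ?thesis .
  qed
  have dc: "z \<in> double_wedge \<theta> \<or> z = 0" if I: "I \<in> unit_imag" and s: "slice_embed I z \<in> S_spectrum D T" for I z
  proof -
    have bound: "\<bar>Im z\<bar> \<le> tan \<omega> * \<bar>Re z\<bar>"
      using resolvent_memI[of "slice_embed I z"] s I by (force simp: S_spectrum_def)
    then show ?thesis using \<omega> \<theta> by (intro double_wedge_or_zero[of \<omega>]) auto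
  qed
  have "gext s \<in> S_spectrum UNIV (endo_apply X)" if s: "s \<in> S_spectrum D T" for s
  proof -
    have sp: "s \<in> paravectors" "s \<notin> \<rho>" using s by (auto simp: S_spectrum_def)
    obtain I where I: "I \<in> unit_imag" "s = slice_pt I (sc s) (vec_norm s)"
      using paravector_slice[OF sp(1) J] by blast
    define z where "z = Complex (sc s) (vec_norm s)"
    have sz: "s = slice_embed I z" using I(2) by (simp add: slice_embed_def z_def)
    have z: "z \<in> double_wedge \<theta> \<or> z = 0" using dc[OF I(1)] s sz by simp
    \<comment> \<open>An ideal containing \<open>N s\<close> sits over the sphere of
      \<open>s\<close>: the scalar of \<open>N s\<close> is 0 there, which forces
      \<open>\<mu>\<close> to be one of the two points representing that sphere.\<close>
    obtain M \<alpha> \<beta> where M: "alg.proper_ideal M" "N s \<in> M" "A - alg.emb \<alpha> \<in> M" "B - alg.emb \<beta> \<in> M"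
      using alg.singular_proper_ideal[OF N_mem N_singular[OF sp] A_mem B_mem] by blast
    note Mf = alg.ideal_facts[OF M(1)]
    define n where "n = 1 + of_real ((norm s)\<^sup>2 - 1) * \<alpha> - of_real (2 * sc s) * \<beta>"
    have "N s - (N s - alg.emb n) \<in> M" unfolding n_def by (rule Mf(7)[OF M(2) P_mod_ideal(5)[OF M(1,3,4)]])
    then have n0: "n = 0" using alg.proper_ideal_emb_iff[OF M(1)] by simp
    \<comment> \<open>Here \<open>\<alpha> = 0\<close> would give \<open>\<beta> = 0\<close> and
      hence \<open>n = 1\<close>.\<close>
    have \<alpha>0: "\<alpha> \<noteq> 0" using P_mod_ideal(1)[OF M(1,3,4)] n0 by (auto simp: n_def)
    define \<mu> where "\<mu> = \<beta> / \<alpha>"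
    have "n = \<alpha> * (\<mu>\<^sup>2 - of_real (2 * sc s) * \<mu> + of_real ((norm s)\<^sup>2))"
      unfolding n_def \<mu>_def by (rule spectrum_point(2)[OF M(1,3,4) \<alpha>0])
    moreover have "sc s = Re z" "norm s = norm z" using I(1) unfolding sz by simp_all
    ultimately have "(\<mu> - z) * (\<mu> - cnj z) = 0" using n0 \<alpha>0 quadratic_roots[of \<mu> z] by simp
    then have \<mu>: "\<mu> = z \<or> \<mu> = cnj z" by simp
    have "X - alg.emb (gc \<mu>) \<in> M" using char[OF M(1,3,4)] \<alpha>0 by (simp add: \<mu>_def)
    from Q_mod[OF M(1) this I(1)] have "Q (slice_embed I (gc z)) - alg.emb ((gc \<mu> - gc z) * (gc \<mu> - cnj (gc z))) \<in> M" .
    \<comment> \<open>Although \<open>\<mu>\<close> is known only up to conjugation,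
      \<open>gc \<mu>\<close> is \<open>gc z\<close> or its conjugate, and the product vanishes in
      either case.\<close>
    moreover have "(gc \<mu> - gc z) * (gc \<mu> - cnj (gc z)) = 0" using \<mu> gc_cnj[OF z] by auto
    ultimately have QM: "Q (gext s) \<in> M" by (simp add: sz gext[OF I(1) z])
    have p: "gext s \<in> paravectors" using I(1) by (simp add: sz gext[OF I(1) z])
    \<comment> \<open>An inverse among all bounded operators would belong to \<open>\<A>\<close> and
      would put 1 into \<open>M\<close>.\<close>
    have "\<not> (\<exists>y. Q (gext s) * y = 1 \<and> y * Q (gext s) = 1)"
    proof
      assume "\<exists>y. Q (gext s) * y = 1 \<and> y * Q (gext s) = 1"
      then obtain w where w: "Q (gext s) * w = 1" "w * Q (gext s) = 1" by blast
      then have "w \<in> \<A>" by (rule alg.inverse_mem[OF QA])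
      then show False using Mf(5)[OF _ QM, of w] w Mf(4) by simp
    qed
    then show ?thesis using res[OF p] p by (simp add: S_spectrum_def)
  qed
  moreover have "p \<in> gext ` S_spectrum D T \<union> {ginf *\<^sub>R clif_one}" if p: "p \<in> S_spectrum UNIV (endo_apply X)" for p
  proof -
    have pp: "p \<in> paravectors" and nres: "p \<notin> S_resolvent_set UNIV (endo_apply X)" using p by (auto simp: S_spectrum_def)
    obtain I where I: "I \<in> unit_imag" "p = slice_pt I (sc p) (vec_norm p)"
      using paravector_slice[OF pp J] by blast
    define w where "w = Complex (sc p) (vec_norm p)"
    have pw: "p = slice_embed I w" using I(2) by (simp add: slice_embed_def w_def)
    have "Q p * x \<noteq> 1" if "x \<in> \<A>" for x
      using res[OF pp] nres alg.commute[OF QA that] by metis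
    \<comment> \<open>For the second inclusion a singular \<open>Q p\<close> is placed in an ideal;
      the scalar of \<open>X\<close> there has to be \<open>w\<close> or its conjugate, and it is a
      value of \<open>gc\<close> or \<open>ginf\<close>.\<close>
    then obtain M \<alpha> \<beta> where M: "alg.proper_ideal M" "Q p \<in> M" "A - alg.emb \<alpha> \<in> M" "B - alg.emb \<beta> \<in> M"
      using alg.singular_proper_ideal[OF QA _ A_mem B_mem] by metis
    note Mf = alg.ideal_facts[OF M(1)]
    define \<gamma> where "\<gamma> = (if \<alpha> = 0 then of_real ginf else gc (\<beta> / \<alpha>))"
    have "X - alg.emb \<gamma> \<in> M" using char[OF M(1,3,4)] by (simp add: \<gamma>_def)
    from Mf(7)[OF M(2) Q_mod[OF M(1) this I(1), of w, folded pw]]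
    have "Q p - (Q p - alg.emb ((\<gamma> - w) * (\<gamma> - cnj w))) \<in> M" .
    then have "(\<gamma> - w) * (\<gamma> - cnj w) = 0" using alg.proper_ideal_emb_iff[OF M(1)] by simp
    then have \<gamma>w: "\<gamma> = w \<or> \<gamma> = cnj w" by simp
    show ?thesis
    proof (cases "\<alpha> = 0")
      case True
      \<comment> \<open>As \<open>ginf\<close> is real, the choice between \<open>w\<close> and its
        conjugate does not matter.\<close>
      then have "w = of_real ginf" using \<gamma>w by (auto simp: \<gamma>_def complex_eq_iff)
      then show ?thesis by (simp add: pw slice_embed_simps)
    next
      case False
      define \<mu> where "\<mu> = \<beta> / \<alpha>"
      have \<gamma>: "\<gamma> = gc \<mu>" using False by (simp add: \<gamma>_def \<mu>_def)
      have \<mu>: "\<mu> \<in> double_wedge \<theta> \<or> \<mu> = 0" using char[OF M(1,3,4)] False by (simp add: \<mu>_def)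
      have nr: "slice_embed I \<mu> \<notin> \<rho>" unfolding \<mu>_def by (rule spectrum_point(3)[OF M(1,3,4) False I(1)])
      \<comment> \<open>The spectrum consists of whole spheres. The conjugate of
        \<open>\<mu>\<close> is the point whose image is \<open>p\<close> when
        \<open>\<gamma>\<close> is the conjugate of \<open>w\<close>.\<close>
      have spec: "slice_embed I z \<in> S_spectrum D T" if "z = \<mu> \<or> z = cnj \<mu>" for z
      proof -
        have "slice_embed I z \<notin> \<rho>"
        proof
          assume "slice_embed I z \<in> \<rho>"
          then have "slice_embed I \<mu> \<in> \<rho>"
            by (rule resolvent_cong[rotated -1]) (use that I(1) in auto)
          then show False using nr by simp
        qed
        then show ?thesis using I(1) by (simp add: S_spectrum_def)
      qed
      from \<gamma>w show ?thesis
      proof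
        assume "\<gamma> = w"
        then have "gext (slice_embed I \<mu>) = p" using gext[OF I(1) \<mu>] \<gamma> pw by simp
        then show ?thesis using spec[of \<mu>] by blast
      next
        assume "\<gamma> = cnj w"
        then have "gc (cnj \<mu>) = w" using gc_cnj[OF \<mu>] \<gamma> by simp
        then have "gext (slice_embed I (cnj \<mu>)) = p" using gext[OF I(1), of "cnj \<mu>"] \<mu> pw by auto
        then show ?thesis using spec[of "cnj \<mu>"] by blast
      qed
    qed
  qed
  ultimately show ?thesis unfolding gT by blast
qed

end
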